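(* There is a randomized polynomial-time $\left(4e\cdot\big((e+o(1))\lfloor B\rfloor k\big)^{1/\lfloor B\rfloor}\right)$-approximation algorithm for $k$-CS-PIP, and a randomized polynomial-time (value-oracle) $\left(\frac{4e^2}{e-1}\cdot\big((e+o(1))\lfloor B\rfloor k\big)^{1/\lfloor B\rfloor}\right)$-approximation algorithm for maximizing any monotone submodular function $f:2^{[n]}\to\mathbb{R}_+$ subject to $k$-column sparse packing constraints; here $B\ge1$ is the slack of the instance and $o(1)$ denotes a quantity tending to $0$ as $k\to\infty$.
   Context: $k$-CS-PIP: given $w\in\mathbb{R}^n_+$, $c\in\mathbb{R}^m_+$ and $S=(s_{ij})\in\mathbb{R}^{m\times n}_+$ with at most $k$ nonzero entries per column, maximize $w^Tx$ subject to $Sx\le c$, $x\in\{0,1\}^n$. The submodular version maximizes a monotone submodular $f$ over sets $T\subseteq[n]$ with $\sum_{i\in T}s_{ij}\le c_j$ for all $j$. The slack is $B:=\min\{c_j/s_{ij}: i\in[n],j\in[m],s_{ij}>0\}$; standing assumption: $s_{ij}\le c_j$ for all $i,j$ (items violating this can be fixed to $0$), so $B\ge1$. A $\rho$-approximation algorithm always outputs a feasible solution whose expected objective value is at least $\mathrm{OPT}/\rho$. *)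

theory Defs
  imports "HOL-Probability.Probability" "HOL-Computational_Algebra.Polynomial"
begin

text \<open>
  Model of computation: programs of a probabilistic real RAM.  The data are real, so running time
  is the number of executed instructions, with exact real arithmetic at unit cost.  The model is
  uniform (one finite program for all input dimensions).  Two sorts of values are kept apart:

  \<^item> naturals, used for indices and control flow, with addition and truncated subtraction only, so
    that their bit length grows by at most a constant per instruction;
  \<^item> reals, with field operations and comparison.  There is no rounding from reals to naturals
    (which at unit cost would give unreasonable power), and the only constants are naturals.

  Memory consists of named, two-dimensional, initially zero arrays of either sort; scalars are the
  entries \<open>[0,0]\<close> and vectors the rows \<open>[0,_]\<close>.
\<close>

type_synonym vname = string

type_synonym state = "(vname \<Rightarrow> nat \<Rightarrow> nat \<Rightarrow> nat) \<times> (vname \<Rightarrow> nat \<Rightarrow> nat \<Rightarrow> real)"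

datatype nexp =
    NConst nat
  | NArr vname nexp nexp
  | NAdd nexp nexp
  | NSub nexp nexp

datatype rexp =
    RNat nexp
  | RArr vname nexp nexp
  | RAdd rexp rexp
  | RSub rexp rexp
  | RMul rexp rexp
  | RDiv rexp rexp

datatype bexp =
    NLe nexp nexp
  | RLe rexp rexp
  | BNot bexp
  | BAnd bexp bexp

datatype com =
    Skip
  | NAssign vname nexp nexp nexp
  | RAssign vname nexp nexp rexp
  | Flip vname
  | Query vname vname nexp
  | Seq com com
  | Cond bexp com com
  | While bexp com

primrec nval :: "nexp \<Rightarrow> state \<Rightarrow> nat" where
  "nval (NConst a) \<sigma> = a"
| "nval (NArr x d e) \<sigma> = fst \<sigma> x (nval d \<sigma>) (nval e \<sigma>)"
| "nval (NAdd d e) \<sigma> = nval d \<sigma> + nval e \<sigma>"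
| "nval (NSub d e) \<sigma> = nval d \<sigma> - nval e \<sigma>"

primrec rval :: "rexp \<Rightarrow> state \<Rightarrow> real" where
  "rval (RNat d) \<sigma> = real (nval d \<sigma>)"
| "rval (RArr x d e) \<sigma> = snd \<sigma> x (nval d \<sigma>) (nval e \<sigma>)"
| "rval (RAdd a b) \<sigma> = rval a \<sigma> + rval b \<sigma>"
| "rval (RSub a b) \<sigma> = rval a \<sigma> - rval b \<sigma>"
| "rval (RMul a b) \<sigma> = rval a \<sigma> * rval b \<sigma>"
| "rval (RDiv a b) \<sigma> = rval a \<sigma> / rval b \<sigma>"

primrec bval :: "bexp \<Rightarrow> state \<Rightarrow> bool" where
  "bval (NLe d e) \<sigma> \<longleftrightarrow> nval d \<sigma> \<le> nval e \<sigma>"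
| "bval (RLe a b) \<sigma> \<longleftrightarrow> rval a \<sigma> \<le> rval b \<sigma>"
| "bval (BNot p) \<sigma> \<longleftrightarrow> \<not> bval p \<sigma>"
| "bval (BAnd p q) \<sigma> \<longleftrightarrow> bval p \<sigma> \<and> bval q \<sigma>"

definition nupd :: "vname \<Rightarrow> nat \<Rightarrow> nat \<Rightarrow> nat \<Rightarrow> state \<Rightarrow> state" where
  "nupd x i j a \<sigma> = ((fst \<sigma>)(x := (fst \<sigma> x)(i := (fst \<sigma> x i)(j := a))), snd \<sigma>)"

definition rupd :: "vname \<Rightarrow> nat \<Rightarrow> nat \<Rightarrow> real \<Rightarrow> state \<Rightarrow> state" where
  "rupd x i j a \<sigma> = (fst \<sigma>, (snd \<sigma>)(x := (snd \<sigma> x)(i := (snd \<sigma> x i)(j := a))))"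

text \<open>
  One instruction, relative to a value oracle \<open>f\<close>.  \<open>Flip x\<close> stores a fair random bit in \<open>x[0,0]\<close>;
  \<open>Query y x d\<close> stores in \<open>y[0,0]\<close> the value of \<open>f\<close> on the set whose characteristic vector is row
  \<open>d\<close> of the natural-number array \<open>x\<close>.
\<close>

primrec step :: "(nat set \<Rightarrow> real) \<Rightarrow> com \<Rightarrow> state \<Rightarrow> (com \<times> state) pmf" where
  "step f Skip \<sigma> = return_pmf (Skip, \<sigma>)"
| "step f (NAssign x d e a) \<sigma> =
     return_pmf (Skip, nupd x (nval d \<sigma>) (nval e \<sigma>) (nval a \<sigma>) \<sigma>)"
| "step f (RAssign x d e a) \<sigma> =
     return_pmf (Skip, rupd x (nval d \<sigma>) (nval e \<sigma>) (rval a \<sigma>) \<sigma>)"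
| "step f (Flip x) \<sigma> =
     map_pmf (\<lambda>b. (Skip, nupd x 0 0 (if b then 1 else 0) \<sigma>)) (pmf_of_set (UNIV :: bool set))"
| "step f (Query y x d) \<sigma> =
     return_pmf (Skip, rupd y 0 0 (f {i. fst \<sigma> x (nval d \<sigma>) i \<noteq> 0}) \<sigma>)"
| "step f (Seq c1 c2) \<sigma> =
     (if c1 = Skip then return_pmf (c2, \<sigma>)
      else map_pmf (\<lambda>(c1', \<sigma>'). (Seq c1' c2, \<sigma>')) (step f c1 \<sigma>))"
| "step f (Cond b c1 c2) \<sigma> = return_pmf (if bval b \<sigma> then c1 else c2, \<sigma>)"
| "step f (While b c) \<sigma> = return_pmf (if bval b \<sigma> then Seq c (While b c) else Skip, \<sigma>)"

primrec run :: "(nat set \<Rightarrow> real) \<Rightarrow> nat \<Rightarrow> com \<Rightarrow> state \<Rightarrow> (com \<times> state) pmf" where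
  "run f 0 c \<sigma> = return_pmf (c, \<sigma>)"
| "run f (Suc t) c \<sigma> = bind_pmf (run f t c \<sigma>) (\<lambda>(c', \<sigma>'). step f c' \<sigma>')"

definition halts_within :: "(nat set \<Rightarrow> real) \<Rightarrow> nat \<Rightarrow> com \<Rightarrow> state \<Rightarrow> bool" where
  "halts_within f t c \<sigma> \<longleftrightarrow> (\<forall>(c', \<sigma>') \<in> set_pmf (run f t c \<sigma>). c' = Skip)"

definition final_states :: "(nat set \<Rightarrow> real) \<Rightarrow> nat \<Rightarrow> com \<Rightarrow> state \<Rightarrow> state pmf" where
  "final_states f t c \<sigma> = map_pmf snd (run f t c \<sigma>)"


text \<open>
  Packing constraints with items \<open>i < n\<close> and constraints \<open>j < m\<close>; \<open>s i j\<close> is the size of item \<open>i\<close> in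
  constraint \<open>j\<close>, so that \<open>s i\<close> is the \<open>i\<close>-th column of the constraint matrix.  Some entry has to
  be positive, as otherwise the minimum defining the slack ranges over the empty set.
\<close>

definition packing_instance ::
    "nat \<Rightarrow> nat \<Rightarrow> nat \<Rightarrow> (nat \<Rightarrow> real) \<Rightarrow> (nat \<Rightarrow> nat \<Rightarrow> real) \<Rightarrow> bool" where
  "packing_instance n m k c s \<longleftrightarrow>
     k \<ge> 1 \<and>
     (\<forall>j<m. 0 \<le> c j) \<and>
     (\<forall>i<n. \<forall>j<m. 0 \<le> s i j \<and> s i j \<le> c j) \<and>
     (\<forall>i<n. card {j. j < m \<and> s i j \<noteq> 0} \<le> k) \<and>
     (\<exists>i<n. \<exists>j<m. s i j > 0)"

definition slack :: "nat \<Rightarrow> nat \<Rightarrow> (nat \<Rightarrow> real) \<Rightarrow> (nat \<Rightarrow> nat \<Rightarrow> real) \<Rightarrow> real" where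
  "slack n m c s = Min {c j / s i j | i j. i < n \<and> j < m \<and> s i j > 0}"

definition input_state ::
    "nat \<Rightarrow> nat \<Rightarrow> nat \<Rightarrow> (nat \<Rightarrow> real) \<Rightarrow> (nat \<Rightarrow> real) \<Rightarrow> (nat \<Rightarrow> nat \<Rightarrow> real) \<Rightarrow> state" where
  "input_state n m k w c s =
     ((\<lambda>x i j. if i = 0 \<and> j = 0 then
                 (if x = ''n'' then n else if x = ''m'' then m else if x = ''k'' then k else 0)
               else 0),
      (\<lambda>x i j. if x = ''w'' \<and> i = 0 \<and> j < n then w j
               else if x = ''c'' \<and> i = 0 \<and> j < m then c j
               else if x = ''s'' \<and> i < n \<and> j < m then s i j
               else 0))"


definition pip_feasible ::
    "nat \<Rightarrow> nat \<Rightarrow> (nat \<Rightarrow> real) \<Rightarrow> (nat \<Rightarrow> nat \<Rightarrow> real) \<Rightarrow> (nat \<Rightarrow> real) \<Rightarrow> bool" where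
  "pip_feasible n m c s x \<longleftrightarrow>
     (\<forall>i<n. x i \<in> {0, 1}) \<and> (\<forall>j<m. (\<Sum>i<n. s i j * x i) \<le> c j)"

definition pip_opt ::
    "nat \<Rightarrow> nat \<Rightarrow> (nat \<Rightarrow> real) \<Rightarrow> (nat \<Rightarrow> real) \<Rightarrow> (nat \<Rightarrow> nat \<Rightarrow> real) \<Rightarrow> real" where
  "pip_opt n m w c s = Max {\<Sum>i<n. w i * x i | x. pip_feasible n m c s x}"

definition output_vector :: "state \<Rightarrow> nat \<Rightarrow> real" where
  "output_vector \<sigma> i = real (fst \<sigma> ''x'' 0 i)"

text \<open>
  The approximation ratio \<open>\<rho> k B\<close> may depend on the column sparsity and on the slack.  The running
  time is polynomial in the number of input reals.  The linear problem has no oracle; queries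
  return 0.
\<close>

definition pip_approx_algorithm :: "com \<Rightarrow> (nat \<Rightarrow> real \<Rightarrow> real) \<Rightarrow> bool" where
  "pip_approx_algorithm prog \<rho> \<longleftrightarrow>
     (\<exists>p :: nat poly. \<forall>n m k w c s.
        packing_instance n m k c s \<and> (\<forall>i<n. 0 \<le> w i) \<longrightarrow>
        (let t = poly p (n * m + n + m);
             \<sigma>0 = input_state n m k w c s;
             D = final_states (\<lambda>_. 0) t prog \<sigma>0
         in halts_within (\<lambda>_. 0) t prog \<sigma>0 \<and>
            (\<forall>\<sigma>\<in>set_pmf D. pip_feasible n m c s (output_vector \<sigma>)) \<and>
            measure_pmf.expectation D (\<lambda>\<sigma>. \<Sum>i<n. w i * output_vector \<sigma> i)
              \<ge> pip_opt n m w c s / \<rho> k (slack n m c s)))"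


definition submodular_on :: "nat set \<Rightarrow> (nat set \<Rightarrow> real) \<Rightarrow> bool" where
  "submodular_on V f \<longleftrightarrow> (\<forall>A\<subseteq>V. \<forall>B\<subseteq>V. f (A \<union> B) + f (A \<inter> B) \<le> f A + f B)"

definition packing_feasible ::
    "nat \<Rightarrow> nat \<Rightarrow> (nat \<Rightarrow> real) \<Rightarrow> (nat \<Rightarrow> nat \<Rightarrow> real) \<Rightarrow> nat set \<Rightarrow> bool" where
  "packing_feasible n m c s T \<longleftrightarrow> T \<subseteq> {..<n} \<and> (\<forall>j<m. (\<Sum>i\<in>T. s i j) \<le> c j)"

definition submod_opt ::
    "nat \<Rightarrow> nat \<Rightarrow> (nat set \<Rightarrow> real) \<Rightarrow> (nat \<Rightarrow> real) \<Rightarrow> (nat \<Rightarrow> nat \<Rightarrow> real) \<Rightarrow> real" where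
  "submod_opt n m f c s = Max (f ` {T. packing_feasible n m c s T})"

definition output_set :: "nat \<Rightarrow> state \<Rightarrow> nat set" where
  "output_set n \<sigma> = {i. i < n \<and> fst \<sigma> ''x'' 0 i \<noteq> 0}"

text \<open>
  The objective \<open>f\<close> is not part of the input state (its array \<open>w\<close> is zero) and can be accessed only
  by queries.
\<close>

definition submod_approx_algorithm :: "com \<Rightarrow> (nat \<Rightarrow> real \<Rightarrow> real) \<Rightarrow> bool" where
  "submod_approx_algorithm prog \<rho> \<longleftrightarrow>
     (\<exists>p :: nat poly. \<forall>n m k f c s.
        packing_instance n m k c s \<and>
        (\<forall>A\<subseteq>{..<n}. 0 \<le> f A) \<and> mono_on (Pow {..<n}) f \<and> submodular_on {..<n} f \<longrightarrow>
        (let t = poly p (n * m + n + m);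
             \<sigma>0 = input_state n m k (\<lambda>_. 0) c s;
             D = final_states f t prog \<sigma>0
         in halts_within f t prog \<sigma>0 \<and>
            (\<forall>\<sigma>\<in>set_pmf D. packing_feasible n m c s (output_set n \<sigma>)) \<and>
            measure_pmf.expectation D (\<lambda>\<sigma>. f (output_set n \<sigma>))
              \<ge> submod_opt n m f c s / \<rho> k (slack n m c s)))"

end

theory Submission
  imports Defs
begin

text \<open>
  One program with vanishing error term serves both problems. Normalise the sizes to
  \<open>a i j = s i j / c j\<close> and let \<open>b\<close> be the integral slack. In each of \<open>n\<close> rounds at most one item
  is added to a random set \<open>R\<close>. The item is drawn from an approximately optimal fractional solution
  of the packing problem whose weights are the marginal values of \<open>f\<close> at \<open>R\<close>, discounted by the risk
  of a later deletion; the fractional solution comes from multiplicative weights, and as it is a list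
  of items of length at most a power of two, it can be sampled exactly with fair bits. No
  multilinear extension and no exact linear programming is needed.

  At the end an item is kept if in each of its constraints the items of \<open>R\<close> that are at least as large
  fit. Overflow of constraint \<open>j\<close> forces the potential
  \<open>\<Prod>q\<in>R. 1 + l * b * a q j\<close> to be at least \<open>(1 + l) ^ b / (b + 1)\<close>, whereas its expectation grows by
  at most the factor \<open>1 + b / (2 * n)\<close> per round because every round has expected load at most
  \<open>1 / (2 * l * n)\<close>. Taking \<open>l\<close> of order \<open>(b * k) powr (1 / b)\<close> therefore bounds the risk of each of the
  \<open>k\<close> constraints of an item. Since this holds for the items of a fixed optimum as well, the
  fractional optimum of a round stays, in expectation, a constant fraction of \<open>f T - f R\<close>.
\<close>

section \<open>Terminating executions with a time bound\<close>

text \<open>The obstacle is adaptivity: choices depend on \<open>R\<close> through the marginals, so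
  deletions are dependent and no one-shot concentration bound applies. The product potential,
  multiplied by its growth factor once for each remaining round, is a supermartingale under every
  adaptive choice. The sum of these over the constraints of an item is a risk that can be evaluated
  in any round, which is what makes discounted weights possible. The factor 4 consists of two
  halves. Picking only items of risk at most 1/2 lets \<open>f R\<close> grow by at most twice the
  credited gain, which caps the obtainable share of \<open>f T\<close> at 1/2; an initial risk of at
  most 1/4 leaves half of each marginal of the optimum. The result is the ratio
  \<open>4 * (l / (95/100) + 1)\<close>. No error term remains because \<open>n\<close> rounds
  inflate the potential by at most \<open>exp (b / 2)\<close>, whereas the \<open>b\<close>-th power
  of the target admits \<open>exp b\<close>; the spare \<open>exp (b / 2)\<close> pays for all
  rounding losses. Reals cannot be rounded to naturals and only fair bits are available, so the
  slack, \<open>l\<close> and \<open>K\<close> are found by counting, and \<open>P\<close> is a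
  power of two.\<close>

text \<open>\<open>bs f c st D t\<close>: every execution of \<open>c\<close> from \<open>st\<close> halts within \<open>t\<close> steps, and the final state has
  distribution \<open>D\<close>.\<close>

definition bs :: "(nat set \<Rightarrow> real) \<Rightarrow> com \<Rightarrow> state \<Rightarrow> state pmf \<Rightarrow> nat \<Rightarrow> bool" where
  "bs f c st D t \<longleftrightarrow> run f t c st = map_pmf (Pair Skip) D"

lemma run_Skip [simp]: "run f t Skip st = return_pmf (Skip, st)"
  by (induction t) (auto simp: bind_return_pmf)

text \<open>\<open>run\<close> unfolds at its last step, whereas reasoning along the structure of a
  program needs the first step exposed.\<close>

lemma run_Suc_front:
  "run f (Suc t) c st = bind_pmf (step f c st) (\<lambda>(c', st'). run f t c' st')"
proof (induction t)
  case 0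
  then show ?case by (simp add: bind_return_pmf case_prod_unfold bind_return_pmf')
next
  case (Suc t)
  have "run f (Suc (Suc t)) c st = bind_pmf (run f (Suc t) c st) (\<lambda>(c', st'). step f c' st')"
    by simp
  also have "... = bind_pmf (step f c st) (\<lambda>(c', st'). run f (Suc t) c' st')"
    unfolding Suc by (simp add: bind_assoc_pmf case_prod_unfold)
  finally show ?case .
qed

lemma bs_Skip: "bs f Skip st (return_pmf st) t"
  by (simp add: bs_def)

lemma bs_Suc: "bs f c st D t \<Longrightarrow> bs f c st D (Suc t)"
  unfolding bs_def by (simp add: bind_map_pmf) (simp add: map_pmf_def)

lemma bs_mono: "bs f c st D t \<Longrightarrow> t \<le> t' \<Longrightarrow> bs f c st D t'"
proof -
  assume *: "bs f c st D t" "t \<le> t'"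
  have "bs f c st D (t + d)" for d
    by (induction d) (use * in \<open>auto intro: bs_Suc\<close>)
  from this[of "t' - t"] * show ?thesis by simp
qed

lemma bs_step:
  assumes "step f c st = return_pmf (c', st')" "bs f c' st' D t"
  shows "bs f c st D (Suc t)"
  using assms unfolding bs_def run_Suc_front by (simp add: bind_return_pmf)

lemma bs_step1:
  assumes "step f c st = map_pmf (Pair Skip) D"
  shows "bs f c st D 1"
  using assms by (simp add: bs_def bind_return_pmf)

text \<open>A finished command stays at \<open>Skip\<close>, so branches of \<open>c1\<close> that
  halt early only leave spare time and one bound \<open>t1\<close> serves all of them. The summand 1
  pays for discarding the finished \<open>c1\<close>.\<close>

lemma bs_Seq:
  assumes "bs f c1 st D t1" "\<And>st'. st' \<in> set_pmf D \<Longrightarrow> bs f c2 st' (E st') t2"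
  shows "bs f (Seq c1 c2) st (bind_pmf D E) (t1 + t2 + 1)"
  using assms
proof (induction t1 arbitrary: c1 st D)
  case 0
  have "map_pmf (Pair Skip) D = return_pmf (c1, st)" using 0(1) by (simp add: bs_def)
  then have "map_pmf fst (map_pmf (Pair Skip) D) = map_pmf fst (return_pmf (c1, st))"
    "map_pmf snd (map_pmf (Pair Skip) D) = map_pmf snd (return_pmf (c1, st))" by simp_all
  then have "c1 = Skip" "D = return_pmf st"
    by (simp_all add: pmf.map_comp o_def)
  with 0(2) show ?case
    by (auto intro!: bs_step simp: bind_return_pmf)
next
  case (Suc t1)
  show ?case
  proof (cases "c1 = Skip")
    case True
    have "map_pmf (Pair Skip) D = return_pmf (c1, st)" using Suc(2) True by (simp add: bs_def bind_return_pmf)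
    then have "map_pmf snd (map_pmf (Pair Skip) D) = map_pmf snd (return_pmf (c1, st))" by simp
    then have "D = return_pmf st" by (simp add: pmf.map_comp o_def)
    with Suc(3) have "bs f c2 st (E st) t2" by auto
    then have "bs f c2 st (E st) (Suc t1 + t2)" by (rule bs_mono) simp
    then have "bs f (Seq c1 c2) st (E st) (Suc (Suc t1 + t2))"
      by (rule bs_step[rotated]) (simp add: True)
    then show ?thesis using \<open>D = _\<close> by (simp add: bind_return_pmf)
  next
    case False
    \<comment> \<open>\<open>D' x\<close> is the law of the final state once the first step has led
      to \<open>x\<close>; \<open>D\<close> is the mixture of these laws.\<close>
    define D' where "D' = (\<lambda>x. map_pmf snd (run f t1 (fst x) (snd x)))"
    have r: "map_pmf (Pair Skip) D = bind_pmf (step f c1 st) (\<lambda>x. run f t1 (fst x) (snd x))"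
      using Suc(2) unfolding bs_def run_Suc_front by (simp add: case_prod_unfold)
    have "map_pmf snd (map_pmf (Pair Skip) D) = bind_pmf (step f c1 st) D'"
      unfolding r D'_def by (simp add: map_bind_pmf)
    then have D: "D = bind_pmf (step f c1 st) D'" by (simp add: pmf.map_comp o_def)
    \<comment> \<open>Runs from an intermediate configuration lie in the support of the complete
      run, hence all of them end in \<open>Skip\<close>.\<close>
    have b: "bs f (fst x) (snd x) (D' x) t1" if "x \<in> set_pmf (step f c1 st)" for x
    proof -
      have "fst y = Skip" if y: "y \<in> set_pmf (run f t1 (fst x) (snd x))" for y
      proof -
        have "y \<in> set_pmf (map_pmf (Pair Skip) D)" unfolding r using \<open>x \<in> _\<close> y by auto
        then show ?thesis by auto
      qed
      then have "map_pmf (\<lambda>y. (Skip, snd y)) (run f t1 (fst x) (snd x)) = map_pmf id (run f t1 (fst x) (snd x))"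
        by (intro map_pmf_cong refl) (metis id_apply prod.collapse)
      then show ?thesis unfolding bs_def D'_def by (simp add: pmf.map_comp o_def)
    qed
    have "bs f (Seq (fst x) c2) (snd x) (bind_pmf (D' x) E) (t1 + t2 + 1)"
      if x: "x \<in> set_pmf (step f c1 st)" for x
      by (rule Suc.IH[OF b[OF x]]) (use x D Suc(3) in auto)
    then have *: "run f (t1 + t2 + 1) (Seq (fst x) c2) (snd x) = map_pmf (Pair Skip) (bind_pmf (D' x) E)"
      if x: "x \<in> set_pmf (step f c1 st)" for x using x unfolding bs_def by blast
    have "run f (Suc (t1 + t2 + 1)) (Seq c1 c2) st
        = bind_pmf (step f c1 st) (\<lambda>x. run f (t1 + t2 + 1) (Seq (fst x) c2) (snd x))"
      unfolding run_Suc_front using False by (simp add: bind_map_pmf case_prod_unfold del: run.simps)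
    also have "... = bind_pmf (step f c1 st) (\<lambda>x. map_pmf (Pair Skip) (bind_pmf (D' x) E))"
      by (intro bind_pmf_cong refl *)
    also have "... = map_pmf (Pair Skip) (bind_pmf D E)"
      unfolding D by (simp add: map_bind_pmf bind_assoc_pmf)
    finally show ?thesis unfolding bs_def by simp
  qed
qed

lemma bs_Cond:
  assumes "bs f (if bval b st then c1 else c2) st D t"
  shows "bs f (Cond b c1 c2) st D (Suc t)"
  using assms by (intro bs_step) (auto split: if_splits)

lemma bs_While:
  assumes "bs f (if bval b st then Seq c (While b c) else Skip) st D t"
  shows "bs f (While b c) st D (Suc t)"
  using assms by (intro bs_step) (auto split: if_splits)

lemma bs_halts: "bs f c st D t \<Longrightarrow> halts_within f t c st"
  by (auto simp: bs_def halts_within_def)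

lemma bs_final: "bs f c st D t \<Longrightarrow> final_states f t c st = D"
  by (simp add: bs_def final_states_def pmf.map_comp o_def)

subsection \<open>Frames\<close>

text \<open>Syntactic write sets, one per sort of array, from which all framing is derived: later
  proofs use \<open>agrD\<close> as a rewrite rule for reads from unwritten arrays.\<close>

primrec nwr :: "com \<Rightarrow> vname set" where
  "nwr Skip = {}"
| "nwr (NAssign x d e a) = {x}"
| "nwr (RAssign x d e a) = {}"
| "nwr (Flip x) = {x}"
| "nwr (Query y x d) = {}"
| "nwr (Seq c1 c2) = nwr c1 \<union> nwr c2"
| "nwr (Cond b c1 c2) = nwr c1 \<union> nwr c2"
| "nwr (While b c) = nwr c"

primrec rwr :: "com \<Rightarrow> vname set" where
  "rwr Skip = {}"
| "rwr (NAssign x d e a) = {}"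
| "rwr (RAssign x d e a) = {x}"
| "rwr (Flip x) = {}"
| "rwr (Query y x d) = {y}"
| "rwr (Seq c1 c2) = rwr c1 \<union> rwr c2"
| "rwr (Cond b c1 c2) = rwr c1 \<union> rwr c2"
| "rwr (While b c) = rwr c"

definition agr :: "vname set \<Rightarrow> vname set \<Rightarrow> state \<Rightarrow> state \<Rightarrow> bool" where
  "agr X Y st st' \<longleftrightarrow> (\<forall>v. v \<notin> X \<longrightarrow> fst st' v = fst st v) \<and> (\<forall>v. v \<notin> Y \<longrightarrow> snd st' v = snd st v)"

lemma agr_refl: "agr X Y st st" by (simp add: agr_def)

lemma agr_trans: "agr X Y st st' \<Longrightarrow> agr X Y st' st'' \<Longrightarrow> agr X Y st st''"
  by (simp add: agr_def)

lemma agr_mono: "agr X Y st st' \<Longrightarrow> X \<subseteq> X' \<Longrightarrow> Y \<subseteq> Y' \<Longrightarrow> agr X' Y' st st'"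
  by (auto simp: agr_def)

lemma agrD:
  assumes "agr X Y st st'"
  shows "v \<notin> X \<Longrightarrow> fst st' v = fst st v" "v \<notin> Y \<Longrightarrow> snd st' v = snd st v"
  using assms by (auto simp: agr_def)

text \<open>The write sets of the residual command belong to the claim because the induction over
  \<open>run\<close> continues with that command.\<close>

lemma step_frame:
  "(c', st') \<in> set_pmf (step f c st) \<Longrightarrow>
     nwr c' \<subseteq> nwr c \<and> rwr c' \<subseteq> rwr c \<and> agr (nwr c) (rwr c) st st'"
proof (induction c arbitrary: c' st')
  case (Seq c1 c2)
  show ?case
  proof (cases "c1 = Skip")
    case True
    then show ?thesis using Seq.prems by (auto simp: agr_refl)
  next
    case False
    then obtain c1' where c': "c' = Seq c1' c2" "(c1', st') \<in> set_pmf (step f c1 st)"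
      using Seq.prems by auto
    then show ?thesis using Seq.IH(1)[OF c'(2)] by (auto intro: agr_mono)
  qed
qed (auto simp: agr_refl agr_def nupd_def rupd_def split: if_splits)

lemma run_frame:
  "(c', st') \<in> set_pmf (run f t c st) \<Longrightarrow>
     nwr c' \<subseteq> nwr c \<and> rwr c' \<subseteq> rwr c \<and> agr (nwr c) (rwr c) st st'"
proof (induction t arbitrary: c' st')
  case (Suc t)
  then obtain c1 st1 where "(c1, st1) \<in> set_pmf (run f t c st)" "(c', st') \<in> set_pmf (step f c1 st1)"
    by auto
  with Suc.IH[of c1 st1] step_frame[of c' st' f c1 st1] show ?case
    by (meson agr_mono agr_trans subset_trans)
qed (auto simp: agr_refl)

lemma bs_frame: "bs f c st D t \<Longrightarrow> st' \<in> set_pmf D \<Longrightarrow> agr (nwr c) (rwr c) st st'"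
  using run_frame[of Skip st' f t c st] by (auto simp: bs_def)

subsection \<open>Deterministic executions and loops\<close>

definition dex :: "(nat set \<Rightarrow> real) \<Rightarrow> com \<Rightarrow> state \<Rightarrow> state \<Rightarrow> nat \<Rightarrow> bool" where
  "dex f c st st' t \<longleftrightarrow> bs f c st (return_pmf st') t"

lemma dex_mono: "dex f c st st' t \<Longrightarrow> t \<le> t' \<Longrightarrow> dex f c st st' t'"
  by (auto simp: dex_def intro: bs_mono)

lemma dex_frame: "dex f c st st' t \<Longrightarrow> agr (nwr c) (rwr c) st st'"
  by (auto simp: dex_def dest: bs_frame)

lemma dex_Skip: "dex f Skip st st 0"
  by (simp add: dex_def bs_Skip)

lemma dex_NAssign:
  "dex f (NAssign x d e a) st (nupd x (nval d st) (nval e st) (nval a st) st) 1"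
  unfolding dex_def by (intro bs_step1) simp

lemma dex_RAssign:
  "dex f (RAssign x d e a) st (rupd x (nval d st) (nval e st) (rval a st) st) 1"
  unfolding dex_def by (intro bs_step1) simp

lemma dex_Query:
  "dex f (Query y x d) st (rupd y 0 0 (f {i. fst st x (nval d st) i \<noteq> 0}) st) 1"
  unfolding dex_def by (intro bs_step1) simp

lemma dex_Seq: "dex f c1 st st1 t1 \<Longrightarrow> dex f c2 st1 st2 t2 \<Longrightarrow> dex f (Seq c1 c2) st st2 (t1 + t2 + 1)"
  using bs_Seq[of f c1 st "return_pmf st1" t1 c2 "\<lambda>_. return_pmf st2" t2]
  by (simp add: dex_def bind_return_pmf)

lemma dex_Cond: "dex f (if bval b st then c1 else c2) st st' t \<Longrightarrow> dex f (Cond b c1 c2) st st' (Suc t)"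
  by (simp add: dex_def bs_Cond)

text \<open>The index \<open>i\<close> counts iterations and need not be a program variable, so the
  bound \<open>N\<close> may come from a purely mathematical termination argument.\<close>

lemma dex_While:
  assumes init: "I 0 st0"
    and step: "\<And>i st. I i st \<Longrightarrow> bval g st \<Longrightarrow> agr (nwr c) (rwr c) st0 st \<Longrightarrow>
                 \<exists>st'. dex f c st st' tb \<and> I (Suc i) st'"
    and bound: "\<And>i st. I i st \<Longrightarrow> bval g st \<Longrightarrow> agr (nwr c) (rwr c) st0 st \<Longrightarrow> i < N"
  shows "\<exists>i st'. dex f (While g c) st0 st' (N * (tb + 2) + 1) \<and> I i st' \<and> \<not> bval g st'
           \<and> agr (nwr c) (rwr c) st0 st'"
proof -
  have "\<exists>i' st'. dex f (While g c) st st' (r * (tb + 2) + 1) \<and> I i' st' \<and> \<not> bval g st'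
           \<and> agr (nwr c) (rwr c) st0 st'"
    if "I i st" "agr (nwr c) (rwr c) st0 st" "N - i \<le> r" for i r st
    using that
  proof (induction r arbitrary: i st)
    case 0
    with bound[of i st] have g: "\<not> bval g st" by force
    have "bs f (While g c) st (return_pmf st) (Suc 0)"
      by (rule bs_While) (simp add: g bs_Skip)
    then have "dex f (While g c) st st (0 * (tb + 2) + 1)" by (simp add: dex_def)
    with 0 g show ?case by blast
  next
    case (Suc r)
    show ?case
    proof (cases "bval g st")
      case True
      from step[OF Suc.prems(1) True Suc.prems(2)] obtain st1 where
        s1: "dex f c st st1 tb" "I (Suc i) st1" by blast
      have a1: "agr (nwr c) (rwr c) st0 st1"
        using agr_trans[OF Suc.prems(2) dex_frame[OF s1(1)]] .
      have "N - Suc i \<le> r" using Suc.prems(3) by simp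
      from Suc.IH[OF s1(2) a1 this] obtain i' st' where
        w: "dex f (While g c) st1 st' (r * (tb + 2) + 1)" "I i' st'" "\<not> bval g st'"
          "agr (nwr c) (rwr c) st0 st'" by blast
      have "dex f (Seq c (While g c)) st st' (tb + (r * (tb + 2) + 1) + 1)"
        using s1(1) w(1) by (rule dex_Seq)
      then have "dex f (While g c) st st' (Suc (tb + (r * (tb + 2) + 1) + 1))"
        unfolding dex_def by (intro bs_While) (simp add: True)
      then have "dex f (While g c) st st' (Suc r * (tb + 2) + 1)"
        by (rule dex_mono) simp
      with w show ?thesis by blast
    next
      case False
      have "bs f (While g c) st (return_pmf st) (Suc 0)"
        by (rule bs_While) (simp add: False bs_Skip)
      then have "dex f (While g c) st st (Suc r * (tb + 2) + 1)"
        unfolding dex_def by (rule bs_mono) simp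
      with Suc.prems False show ?thesis by blast
    qed
  qed
  from this[OF init agr_refl, of N] show ?thesis by simp
qed

abbreviation nv :: "vname \<Rightarrow> nexp" where "nv x \<equiv> NArr x (NConst 0) (NConst 0)"
abbreviation rv :: "vname \<Rightarrow> rexp" where "rv x \<equiv> RArr x (NConst 0) (NConst 0)"
abbreviation nset :: "vname \<Rightarrow> nexp \<Rightarrow> com" where "nset x a \<equiv> NAssign x (NConst 0) (NConst 0) a"
abbreviation rset :: "vname \<Rightarrow> rexp \<Rightarrow> com" where "rset x a \<equiv> RAssign x (NConst 0) (NConst 0) a"
abbreviation nless :: "nexp \<Rightarrow> nexp \<Rightarrow> bexp" where "nless a b \<equiv> NLe (NAdd a (NConst 1)) b"
abbreviation rless :: "rexp \<Rightarrow> rexp \<Rightarrow> bexp" where "rless a b \<equiv> BNot (RLe b a)"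

definition FOR :: "vname \<Rightarrow> nexp \<Rightarrow> com \<Rightarrow> com" where
  "FOR j e c = Seq (nset j (NConst 0))
     (While (nless (nv j) e) (Seq c (nset j (NAdd (nv j) (NConst 1)))))"

lemma nwr_FOR [simp]: "nwr (FOR j e c) = insert j (nwr c)" by (auto simp: FOR_def)
lemma rwr_FOR [simp]: "rwr (FOR j e c) = rwr c" by (auto simp: FOR_def)

lemma fst_nupd [simp]: "fst (nupd x i j a st) = (fst st)(x := (fst st x)(i := (fst st x i)(j := a)))"
  by (simp add: nupd_def)
lemma snd_nupd [simp]: "snd (nupd x i j a st) = snd st"
  by (simp add: nupd_def)
lemma fst_rupd [simp]: "fst (rupd x i j a st) = fst st"
  by (simp add: rupd_def)
lemma snd_rupd [simp]: "snd (rupd x i j a st) = (snd st)(x := (snd st x)(i := (snd st x i)(j := a)))"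
  by (simp add: rupd_def)

text \<open>The invariant may only speak about the loop variable through its first argument.\<close>

lemma dex_FOR:
  assumes j: "j \<notin> nwr c"
    and e: "\<And>st. agr (insert j (nwr c)) (rwr c) st0 st \<Longrightarrow> nval e st = N"
    and init: "\<And>st. agr {j} {} st0 st \<Longrightarrow> I 0 st"
    and inv: "\<And>i st a. I i st \<Longrightarrow> I i (nupd j 0 0 a st)"
    and step: "\<And>i st. I i st \<Longrightarrow> i < N \<Longrightarrow> fst st j 0 0 = i \<Longrightarrow>
                 agr (insert j (nwr c)) (rwr c) st0 st \<Longrightarrow> \<exists>st'. dex f c st st' tb \<and> I (Suc i) st'"
  shows "\<exists>st'. dex f (FOR j e c) st0 st' (N * (tb + 4) + 3) \<and> I N st' \<and> fst st' j 0 0 = N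
           \<and> agr (insert j (nwr c)) (rwr c) st0 st'"
proof -
  let ?st0 = "nupd j 0 0 0 st0"
  let ?inc = "nset j (NAdd (nv j) (NConst 1))"
  have a0: "agr (insert j (nwr c)) (rwr c) st0 ?st0" by (simp add: agr_def)
  have "\<exists>i st'. dex f (While (nless (nv j) e) (Seq c ?inc)) ?st0 st' (N * ((tb + 2) + 2) + 1) \<and>
          (I i st' \<and> i \<le> N \<and> fst st' j 0 0 = i) \<and> \<not> bval (nless (nv j) e) st'
           \<and> agr (nwr (Seq c ?inc)) (rwr (Seq c ?inc)) ?st0 st'"
  proof (rule dex_While)
    show "I 0 ?st0 \<and> 0 \<le> N \<and> fst ?st0 j 0 0 = 0"
      by (auto intro!: init simp: agr_def)
  next
    fix i st
    assume I: "I i st \<and> i \<le> N \<and> fst st j 0 0 = i" and g: "bval (nless (nv j) e) st"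
      and a: "agr (nwr (Seq c ?inc)) (rwr (Seq c ?inc)) ?st0 st"
    have a': "agr (insert j (nwr c)) (rwr c) st0 st"
      using agr_trans[OF a0, of st] a by (simp add: Un_commute)
    have lt: "i < N" using g e[OF a'] I by simp
    then show "i < N" .
    obtain st1 where s1: "dex f c st st1 tb" "I (Suc i) st1" using step[OF _ lt _ a'] I by blast
    have j1: "fst st1 j 0 0 = i" using agrD(1)[OF dex_frame[OF s1(1)] j] I by simp
    have "dex f (Seq c ?inc) st (nupd j 0 0 (Suc i) st1) (tb + 1 + 1)"
      using dex_Seq[OF s1(1) dex_NAssign[of f j "NConst 0" "NConst 0" "NAdd (nv j) (NConst 1)" st1]]
      by (simp add: j1)
    then show "\<exists>st'. dex f (Seq c ?inc) st st' (tb + 2) \<and> (I (Suc i) st' \<and> Suc i \<le> N \<and> fst st' j 0 0 = Suc i)"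
      using lt s1(2) inv by (intro exI[of _ "nupd j 0 0 (Suc i) st1"]) auto
  qed
  moreover have tm: "N * ((tb + 2) + 2) + 1 = N * (tb + 4) + 1" by (simp add: algebra_simps)
  ultimately obtain i st' where w: "dex f (While (nless (nv j) e) (Seq c ?inc)) ?st0 st' (N * (tb + 4) + 1)"
      "I i st'" "i \<le> N" "fst st' j 0 0 = i" "\<not> bval (nless (nv j) e) st'"
      "agr (insert j (nwr c)) (rwr c) ?st0 st'"
    unfolding tm nwr.simps rwr.simps Un_insert_right Un_empty_right by blast
  have a': "agr (insert j (nwr c)) (rwr c) st0 st'" using agr_trans[OF a0 w(6)] .
  have "i = N" using e[OF a'] w by simp
  have "dex f (nset j (NConst 0)) st0 ?st0 1"
    using dex_NAssign[of f j "NConst 0" "NConst 0" "NConst 0" st0] by simp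
  from dex_Seq[OF this w(1)] have "dex f (FOR j e c) st0 st' (N * (tb + 4) + 3)"
    unfolding FOR_def by (rule dex_mono) simp
  with w a' \<open>i = N\<close> show ?thesis by blast
qed

text \<open>\<open>A\<close> projects states to the quantity of interest. If the projected law of an
  iteration depends only on the projected state, through the kernel \<open>nx\<close>, then the
  projected loop is the composition \<open>ch\<close> of the kernels, however the rest of the state
  behaves within the invariant. It serves both the coin flips and the rounds.\<close>

lemma bs_While_chain:
  assumes step: "\<And>i st. I i st \<Longrightarrow> i < N \<Longrightarrow> bval g st \<and>
                 (\<exists>D. bs f c st D tb \<and> (\<forall>st'\<in>set_pmf D. I (Suc i) st') \<and> map_pmf A D = nx i (A st))"
    and stop: "\<And>st. I N st \<Longrightarrow> \<not> bval g st"
    and ch0: "\<And>S. ch N S = return_pmf S"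
    and chS: "\<And>i S. i < N \<Longrightarrow> ch i S = bind_pmf (nx i S) (ch (Suc i))"
    and "I i st" "i \<le> N"
  shows "\<exists>D. bs f (While g c) st D ((N - i) * (tb + 2) + 1) \<and> (\<forall>st'\<in>set_pmf D. I N st') \<and>
             map_pmf A D = ch i (A st)"
  using \<open>I i st\<close> \<open>i \<le> N\<close>
proof (induction "N - i" arbitrary: i st)
  case 0
  then have [simp]: "i = N" by simp
  have "bs f (While g c) st (return_pmf st) (Suc 0)"
    by (rule bs_While) (use stop 0 in \<open>simp add: bs_Skip\<close>)
  with 0 show ?case by (intro exI[of _ "return_pmf st"]) (simp add: ch0)
next
  case (Suc r)
  then have lt: "i < N" by simp
  from step[OF Suc.prems(1) lt] obtain D where g: "bval g st"
    and D: "bs f c st D tb" "\<forall>st'\<in>set_pmf D. I (Suc i) st'" "map_pmf A D = nx i (A st)" by blast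
  have "\<forall>st'\<in>set_pmf D. \<exists>E. bs f (While g c) st' E ((N - Suc i) * (tb + 2) + 1) \<and>
      (\<forall>st'\<in>set_pmf E. I N st') \<and> map_pmf A E = ch (Suc i) (A st')"
    using D(2) Suc.hyps(1)[of "Suc i"] Suc.hyps(2) lt by auto
  then obtain E where E: "\<And>st'. st' \<in> set_pmf D \<Longrightarrow> bs f (While g c) st' (E st') ((N - Suc i) * (tb + 2) + 1)"
      "\<And>st'. st' \<in> set_pmf D \<Longrightarrow> (\<forall>st'\<in>set_pmf (E st'). I N st') \<and> map_pmf A (E st') = ch (Suc i) (A st')"
    by metis
  have "bs f (Seq c (While g c)) st (bind_pmf D E) (tb + ((N - Suc i) * (tb + 2) + 1) + 1)"
    using D(1) E(1) by (rule bs_Seq)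
  then have "bs f (While g c) st (bind_pmf D E) (Suc (tb + ((N - Suc i) * (tb + 2) + 1) + 1))"
    by (intro bs_While) (simp add: g)
  moreover have "N - i = Suc (N - Suc i)" using lt by simp
  ultimately have b: "bs f (While g c) st (bind_pmf D E) ((N - i) * (tb + 2) + 1)"
    by (simp add: algebra_simps)
  have "map_pmf A (bind_pmf D E) = bind_pmf D (\<lambda>st'. ch (Suc i) (A st'))"
    unfolding map_bind_pmf by (intro bind_pmf_cong refl) (use E(2) in auto)
  also have "... = bind_pmf (map_pmf A D) (ch (Suc i))" by (simp add: bind_map_pmf)
  also have "... = ch i (A st)" using chS[OF lt] D(3) by simp
  finally show ?case using b E(2) by (intro exI[of _ "bind_pmf D E"]) auto
qed

section \<open>Multiplicative weights for a fractional packing problem\<close>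

primrec amax :: "(nat \<Rightarrow> real) \<Rightarrow> nat \<Rightarrow> nat" where
  "amax q 0 = 0"
| "amax q (Suc i) = (if q (amax q i) < q i then i else amax q i)"

lemma amax_less: "0 < n \<Longrightarrow> amax q n < n"
proof (induction n)
  case (Suc n)
  then show ?case by (cases n) auto
qed simp

lemma amax_ge: "i < n \<Longrightarrow> q i \<le> q (amax q n)"
proof (induction n)
  case (Suc n)
  then show ?case by (cases "i = n") force+
qed simp

text \<open>Row \<open>m\<close> is the cardinality constraint with entries \<open>1 / n\<close>; the step size is \<open>1 / 32\<close>.\<close>

definition mwq :: "nat \<Rightarrow> (nat \<Rightarrow> nat \<Rightarrow> real) \<Rightarrow> (nat \<Rightarrow> real) \<Rightarrow> (nat \<Rightarrow> real) \<Rightarrow> nat \<Rightarrow> real" where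
  "mwq m a w y i = w i / (\<Sum>j<Suc m. a i j * y j)"

primrec mwy :: "nat \<Rightarrow> nat \<Rightarrow> (nat \<Rightarrow> nat \<Rightarrow> real) \<Rightarrow> (nat \<Rightarrow> real) \<Rightarrow> nat \<Rightarrow> nat \<Rightarrow> real" where
  "mwy n m a w 0 = (\<lambda>_. 1)"
| "mwy n m a w (Suc r) =
     (\<lambda>j. mwy n m a w r j * (1 + a (amax (mwq m a w (mwy n m a w r)) n) j / 32))"

definition mwi :: "nat \<Rightarrow> nat \<Rightarrow> (nat \<Rightarrow> nat \<Rightarrow> real) \<Rightarrow> (nat \<Rightarrow> real) \<Rightarrow> nat \<Rightarrow> nat" where
  "mwi n m a w r = amax (mwq m a w (mwy n m a w r)) n"

text \<open>The total price, which drives the stopping rule and whose growth is compared with the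
  collected weight.\<close>

definition mwD :: "nat \<Rightarrow> nat \<Rightarrow> (nat \<Rightarrow> nat \<Rightarrow> real) \<Rightarrow> (nat \<Rightarrow> real) \<Rightarrow> nat \<Rightarrow> real" where
  "mwD n m a w r = (\<Sum>j<Suc m. mwy n m a w r j)"

text \<open>\<open>a_card\<close> keeps every denominator in \<open>mwq\<close> positive, even for
  an item of size 0 in all other rows, and it bounds the number of iterations.\<close>

locale mwu =
  fixes n m :: nat and a :: "nat \<Rightarrow> nat \<Rightarrow> real" and w :: "nat \<Rightarrow> real"
  assumes n_pos: "0 < n"
    and a_nonneg: "i < n \<Longrightarrow> j \<le> m \<Longrightarrow> 0 \<le> a i j"
    and a_le_1: "i < n \<Longrightarrow> j \<le> m \<Longrightarrow> a i j \<le> 1"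
    and a_card: "i < n \<Longrightarrow> a i m = 1 / n"
    and w_nonneg: "i < n \<Longrightarrow> 0 \<le> w i"
begin

abbreviation "y \<equiv> mwy n m a w"
abbreviation "it \<equiv> mwi n m a w"
abbreviation "D \<equiv> mwD n m a w"

lemma it_less: "it r < n"
  unfolding mwi_def by (rule amax_less[OF n_pos])

lemma y_Suc: "y (Suc r) j = y r j * (1 + a (it r) j / 32)"
  by (simp add: mwi_def)

declare mwy.simps(2) [simp del]

lemma y_pos: "j \<le> m \<Longrightarrow> 0 < y r j"
  by (induction r) (auto simp: y_Suc intro!: mult_pos_pos add_pos_nonneg a_nonneg it_less)

text \<open>By convexity of \<open>exp\<close>, the factor \<open>1 + x / 32\<close> is at least
  \<open>(33/32) powr x\<close> for \<open>x\<close> in [0, 1]; hence a price carries the whole load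
  of its row in the exponent.\<close>

lemma y_ge_exp: "j \<le> m \<Longrightarrow> exp (ln (33/32) * (\<Sum>q<r. a (it q) j)) \<le> y r j"
proof (induction r)
  case (Suc r)
  let ?a = "a (it r) j"
  have a: "0 \<le> ?a" "?a \<le> 1" using a_nonneg a_le_1 it_less Suc.prems by auto
  have "exp ((1 - ?a) *\<^sub>R 0 + ?a *\<^sub>R ln (33/32)) \<le> (1 - ?a) * exp 0 + ?a * exp (ln (33/32::real))"
    by (rule convex_onD[OF exp_convex]) (use a in auto)
  then have "exp (ln (33/32) * ?a) \<le> 1 + ?a / 32"
    by (simp add: algebra_simps)
  then have "exp (ln (33/32) * (\<Sum>q<r. a (it q) j)) * exp (ln (33/32) * ?a) \<le> y r j * (1 + ?a / 32)"
    using Suc y_pos by (intro mult_mono) (auto intro: less_imp_le)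
  then show ?case by (simp add: y_Suc exp_add[symmetric] algebra_simps)
qed simp

text \<open>Before the last item the stopping test bounds the load by \<open>K - 1\<close>, and the
  last item adds at most 1. This explains the exponent \<open>K - 1\<close> of the
  threshold.\<close>

lemma load_le:
  assumes "\<And>q. q < r \<Longrightarrow> D q \<le> (33/32) ^ (K - 1)" "1 \<le> K" "j \<le> m"
  shows "(\<Sum>q<r. a (it q) j) \<le> K"
proof (cases r)
  case (Suc p)
  have "exp (ln (33/32) * (\<Sum>q<p. a (it q) j)) \<le> y p j" using y_ge_exp assms by auto
  also have "... \<le> D p"
    unfolding mwD_def by (rule member_le_sum) (use assms(3) y_pos in \<open>auto intro: less_imp_le\<close>)
  also have "... \<le> (33/32) ^ (K - 1)" using assms(1) Suc by simp
  also have "... = exp (ln (33/32) * real (K - 1))"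
    using exp_of_nat_mult[of "K - 1" "ln (33/32::real)"] by (simp add: mult.commute)
  finally have "(\<Sum>q<p. a (it q) j) \<le> real (K - 1)" by simp
  moreover have "a (it p) j \<le> 1" using a_le_1 it_less assms(3) by simp
  ultimately show ?thesis using assms(2) by (simp add: Suc of_nat_diff)
qed simp

text \<open>In the cardinality row each chosen item contributes \<open>1 / n\<close>, so the load
  bound there counts iterations.\<close>

lemma count_le:
  assumes "\<And>q. q < r \<Longrightarrow> D q \<le> (33/32) ^ (K - 1)" "1 \<le> K"
  shows "r \<le> n * K"
proof -
  have "(\<Sum>q<r. a (it q) m) \<le> K" by (rule load_le) (use assms in auto)
  then have "real r / n \<le> K" using a_card it_less by simp
  then have "real r \<le> n * K" using n_pos by (simp add: field_simps)
  then show ?thesis by (metis of_nat_le_iff of_nat_mult)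
qed

lemma D_stops: "1 \<le> K \<Longrightarrow> \<exists>r. D r > (33/32) ^ (K - 1)"
  using count_le[of "Suc (n * K)" K] by (force simp: not_less)

text \<open>The chosen item has the best ratio of weight to cost and so does at least as well as
  \<open>S\<close> on average; the total cost of \<open>S\<close> is at most \<open>D\<close> by
  feasibility. Thus an iteration multiplies \<open>D\<close> by at most \<open>exp\<close> of the
  chosen weight over 32 times the weight of \<open>S\<close>. Comparing the start
  \<open>m + 1\<close> with the threshold gives the claim.\<close>

lemma value_ge:
  assumes O: "S \<subseteq> {..<n}" "\<And>j. j \<le> m \<Longrightarrow> (\<Sum>i\<in>S. a i j) \<le> 1"
    and D: "D r > (33/32) ^ (K - 1)" "1 \<le> K"
  shows "(\<Sum>i\<in>S. w i) * (real (K - 1) * ln (33/32) - ln (m + 1)) \<le> (\<Sum>q<r. w (it q)) / 32"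
proof -
  let ?W = "\<Sum>i\<in>S. w i"
  have W0: "0 \<le> ?W" using O w_nonneg by (intro sum_nonneg) auto
  have V0: "0 \<le> (\<Sum>q<r. w (it q))" by (intro sum_nonneg w_nonneg it_less)
  show ?thesis
  proof (cases "?W = 0")
    case False
    with W0 have W: "0 < ?W" by simp
    define den where "den q i = (\<Sum>j<Suc m. a i j * y q j)" for q i
    have den_pos: "0 < den q i" if "i < n" for q i
    proof -
      have "0 < a i m * y q m" using that n_pos y_pos a_card by simp
      also have "... \<le> den q i" unfolding den_def
        by (rule member_le_sum) (use that a_nonneg less_imp_le[OF y_pos] in \<open>auto intro!: mult_nonneg_nonneg\<close>)
      finally show ?thesis .
    qed
    have D_pos: "0 < D q" for q unfolding mwD_def by (rule sum_pos) (use y_pos in auto)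
    have step: "D (Suc q) \<le> D q * exp (w (it q) / 32 / ?W)" for q
    proof -
      have "w i * den q (it q) \<le> w (it q) * den q i" if "i \<in> S" for i
      proof -
        have "i < n" using that O by auto
        then have "mwq m a w (y q) i \<le> mwq m a w (y q) (it q)"
          unfolding mwi_def by (rule amax_ge)
        then have "w i / den q i \<le> w (it q) / den q (it q)" by (simp add: mwq_def den_def)
        then show ?thesis using den_pos[of i q] den_pos[OF it_less, of q] \<open>i < n\<close>
          by (simp add: field_simps)
      qed
      then have "(\<Sum>i\<in>S. w i * den q (it q)) \<le> (\<Sum>i\<in>S. w (it q) * den q i)" by (rule sum_mono)
      then have "?W * den q (it q) \<le> w (it q) * (\<Sum>i\<in>S. den q i)"
        by (simp add: sum_distrib_left sum_distrib_right)
      also have "(\<Sum>i\<in>S. den q i) = (\<Sum>j<Suc m. y q j * (\<Sum>i\<in>S. a i j))"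
        unfolding den_def by (subst sum.swap) (simp add: sum_distrib_left sum_distrib_right mult.commute del: sum.lessThan_Suc)
      also have "... \<le> (\<Sum>j<Suc m. y q j * 1)"
        by (intro sum_mono mult_left_mono O(2)) (use y_pos in \<open>auto intro: less_imp_le\<close>)
      finally have *: "?W * den q (it q) \<le> w (it q) * D q"
        using w_nonneg[OF it_less] by (simp add: mwD_def mult_left_mono del: sum.lessThan_Suc)
      have "D (Suc q) = D q + den q (it q) / 32"
        unfolding mwD_def den_def
        by (simp add: y_Suc algebra_simps sum.distrib sum_divide_distrib mult.commute del: sum.lessThan_Suc)
      also have "... \<le> D q * (1 + w (it q) / 32 / ?W)"
        using * W by (simp add: field_simps)
      also have "... \<le> D q * exp (w (it q) / 32 / ?W)"
        using D_pos[of q] by (intro mult_left_mono exp_ge_add_one_self) auto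
      finally show ?thesis .
    qed
    have "D q \<le> (m + 1) * exp ((\<Sum>p<q. w (it p)) / 32 / ?W)" for q
    proof (induction q)
      case 0
      show ?case by (simp add: mwD_def)
    next
      case (Suc q)
      have "D (Suc q) \<le> D q * exp (w (it q) / 32 / ?W)" by (rule step)
      also have "... \<le> ((m + 1) * exp ((\<Sum>p<q. w (it p)) / 32 / ?W)) * exp (w (it q) / 32 / ?W)"
        by (intro mult_right_mono Suc) auto
      finally show ?case by (simp add: mult.assoc exp_add[symmetric] add_divide_distrib)
    qed
    from this[of r] D have "(33/32) ^ (K - 1) < (m + 1) * exp ((\<Sum>p<r. w (it p)) / 32 / ?W)"
      by linarith
    then have "ln ((33/32) ^ (K - 1)) < ln ((m + 1) * exp ((\<Sum>p<r. w (it p)) / 32 / ?W))"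
      by (subst ln_less_cancel_iff) auto
    then have "real (K - 1) * ln (33/32) < ln (m + 1) + (\<Sum>p<r. w (it p)) / 32 / ?W"
      by (simp add: ln_mult ln_realpow)
    then have "?W * (real (K - 1) * ln (33/32) - ln (m + 1)) \<le> ?W * ((\<Sum>p<r. w (it p)) / 32 / ?W)"
      using W by (intro mult_left_mono) auto
    then show ?thesis using W by simp
  qed (use V0 in simp)
qed

text \<open>\<open>32 * ln (33/32)\<close> is at least 31/32, and
  \<open>4096 * (m + 1) \<le> K\<close> makes \<open>ln (m + 1)\<close> and the shifts by one
  negligible; 95/100 is a round number below what remains.\<close>

lemma value_ge':
  assumes O: "S \<subseteq> {..<n}" "\<And>j. j \<le> m \<Longrightarrow> (\<Sum>i\<in>S. a i j) \<le> 1"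
    and D: "D r > (33/32) ^ (K - 1)" and K: "4096 * (m + 1) \<le> K"
  shows "95/100 * (K + 1) * (\<Sum>i\<in>S. w i) \<le> (\<Sum>q<r. w (it q))"
proof -
  let ?W = "\<Sum>i\<in>S. w i"
  have W0: "0 \<le> ?W" using O w_nonneg by (intro sum_nonneg) auto
  have 1: "?W * (real (K - 1) * ln (33/32) - ln (m + 1)) * 32 \<le> (\<Sum>q<r. w (it q))"
    using value_ge[OF O D] K by simp
  have "1/32 - (1/32)\<^sup>2 \<le> ln (1 + 1/32 :: real)" by (rule ln_one_plus_pos_lower_bound) auto
  then have 2: "31/1024 \<le> ln (33/32 :: real)" by (simp add: power2_eq_square)
  have 3: "ln (real m + 1) \<le> m" using ln_add_one_self_le_self[of "real m"] by (simp add: add.commute)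
  have 4: "4096 * (real m + 1) \<le> real K" using K by (simp flip: of_nat_le_iff[where ?'a=real])
  define x where "x = real (K - 1) * ln (33/32)"
  have "real (K - 1) * (31/1024) \<le> x" unfolding x_def by (intro mult_left_mono 2) auto
  moreover have "real (K - 1) = real K - 1" using K by simp
  ultimately have "(real K - 1) * (31/1024) \<le> x" by simp
  then have "95/100 * (real K + 1) \<le> (real (K - 1) * ln (33/32) - ln (real m + 1)) * 32"
    using 3 4 unfolding x_def[symmetric] by (simp add: field_simps)
  then have "?W * (95/100 * (real K + 1)) \<le> ?W * ((real (K - 1) * ln (33/32) - ln (real m + 1)) * 32)"
    using W0 by (rule mult_left_mono)
  also have "... \<le> (\<Sum>q<r. w (it q))" using 1 by (simp add: algebra_simps)
  finally show ?thesis by (simp add: algebra_simps)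
qed

end

section \<open>Overflowing a constraint forces a large potential\<close>

text \<open>For a fixed sum of numbers in [0, 1] the product is smallest at \<open>N\<close> ones
  and one remainder \<open>d\<close>, as the logarithm of each factor is concave. The induction
  splits off one factor and lowers \<open>d\<close> accordingly, borrowing a one from
  \<open>N\<close> when \<open>z x\<close> exceeds \<open>d\<close>.\<close>

lemma prod_ge_interpolation:
  fixes z :: "'a \<Rightarrow> real" and l :: real
  assumes "finite Q" "0 \<le> l" "\<And>q. q \<in> Q \<Longrightarrow> 0 \<le> z q \<and> z q \<le> 1"
    and "0 \<le> d" "d \<le> 1" "N + d \<le> (\<Sum>q\<in>Q. z q)"
  shows "(1 + l) ^ N * (1 + l * d) \<le> (\<Prod>q\<in>Q. 1 + l * z q)"
  using assms(1,3-)
proof (induction Q arbitrary: N d rule: finite_induct)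
  case empty
  then have "d = 0" "N = 0" by auto
  then show ?case by simp
next
  case (insert x Q)
  have z: "0 \<le> z x" "z x \<le> 1" using insert.prems by auto
  have P1: "1 \<le> (\<Prod>q\<in>Q. 1 + l * z q)" using insert.prems \<open>0 \<le> l\<close> by (intro prod_ge_1) auto
  have eq: "(\<Prod>q\<in>insert x Q. 1 + l * z q) = (1 + l * z x) * (\<Prod>q\<in>Q. 1 + l * z q)"
    using insert by simp
  have sm: "N + d - z x \<le> (\<Sum>q\<in>Q. z q)" using insert by simp
  have lz: "0 \<le> l * z x" "0 \<le> l * d" using z \<open>0 \<le> l\<close> insert.prems by auto
  consider "z x \<le> d" | "d < z x" "N = 0" | N' where "d < z x" "N = Suc N'"
    by (cases N) (auto simp: not_le[symmetric])
  then show ?case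
  proof cases
    case 1
    have "(1 + l) ^ N * (1 + l * (d - z x)) \<le> (\<Prod>q\<in>Q. 1 + l * z q)"
      by (rule insert.IH) (use insert.prems(1) in blast, use insert.prems(2,3) sm z 1 in linarith, use insert.prems(2,3) sm z 1 in linarith, use insert.prems(2,3) sm z 1 in linarith)
    then have "(1 + l * z x) * ((1 + l) ^ N * (1 + l * (d - z x))) \<le> (\<Prod>q\<in>insert x Q. 1 + l * z q)"
      unfolding eq using lz by (intro mult_left_mono) auto
    moreover have "1 + l * d \<le> (1 + l * z x) * (1 + l * (d - z x))"
    proof -
      have "0 \<le> (l * z x) * (l * (d - z x))" using z 1 \<open>0 \<le> l\<close> by simp
      then show ?thesis by (simp add: algebra_simps)
    qed
    then have "(1 + l) ^ N * (1 + l * d) \<le> (1 + l) ^ N * ((1 + l * z x) * (1 + l * (d - z x)))"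
      using \<open>0 \<le> l\<close> by (intro mult_left_mono) auto
    ultimately show ?thesis by (simp add: algebra_simps)
  next
    case 2
    have "1 + l * d \<le> 1 + l * z x" using 2 \<open>0 \<le> l\<close> by (simp add: mult_left_mono)
    also have "... \<le> (1 + l * z x) * (\<Prod>q\<in>Q. 1 + l * z q)" using P1 lz by (simp add: mult_le_cancel_left1)
    finally show ?thesis using 2 eq by simp
  next
    case 3
    have "(1 + l) ^ N' * (1 + l * (1 + d - z x)) \<le> (\<Prod>q\<in>Q. 1 + l * z q)"
      by (rule insert.IH) (use insert.prems(1) in blast, use insert.prems(2,3) sm z 3 in linarith, use insert.prems(2,3) sm z 3 in linarith, use insert.prems(2,3) sm z 3 in simp)
    then have "(1 + l * z x) * ((1 + l) ^ N' * (1 + l * (1 + d - z x))) \<le> (\<Prod>q\<in>insert x Q. 1 + l * z q)"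
      unfolding eq using lz by (intro mult_left_mono) auto
    moreover have "(1 + l) * (1 + l * d) \<le> (1 + l * z x) * (1 + l * (1 + d - z x))"
    proof -
      have "0 \<le> (l * l) * ((1 - z x) * (z x - d))" using z 3 \<open>0 \<le> l\<close> by simp
      then show ?thesis by (simp add: algebra_simps)
    qed
    then have "(1 + l) ^ N' * ((1 + l) * (1 + l * d)) \<le> (1 + l) ^ N' * ((1 + l * z x) * (1 + l * (1 + d - z x)))"
      using \<open>0 \<le> l\<close> by (intro mult_left_mono) auto
    ultimately show ?thesis using 3 by (simp add: algebra_simps)
  qed
qed

text \<open>The bound of \<open>prod_ge_interpolation\<close> for the sum
  \<open>b - 1 + 1 / (b + 1)\<close>, which an overflow is shown to force.\<close>

definition Ym :: "real \<Rightarrow> nat \<Rightarrow> real" where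
  "Ym l b = (1 + l) ^ (b - 1) * (1 + l / (b + 1))"

text \<open>Only items at least as large as \<open>i\<close> count. Hence either \<open>i\<close> is small and the others exceed
  \<open>1 - 1 / (b + 1)\<close>, or there are at least \<open>b\<close> others, each larger than \<open>1 / (b + 1)\<close>.\<close>

lemma overflow_potential:
  fixes a :: "nat \<Rightarrow> real"
  assumes fin: "finite A" and i: "i \<in> A" and b: "1 \<le> b" and l: "0 \<le> l"
    and a: "\<And>i. i \<in> A \<Longrightarrow> 0 \<le> a i \<and> b * a i \<le> 1"
    and over: "1 < (\<Sum>q | q \<in> A \<and> a i \<le> a q. a q)"
  shows "Ym l b \<le> (\<Prod>q\<in>A - {i}. 1 + l * b * a q)"
proof -
  define Q where "Q = {q \<in> A. a i \<le> a q} - {i}"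
  have finQ: "finite Q" using fin by (simp add: Q_def)
  have QA: "Q \<subseteq> A - {i}" by (auto simp: Q_def)
  have "(\<Sum>q | q \<in> A \<and> a i \<le> a q. a q) = a i + (\<Sum>q\<in>Q. a q)"
    unfolding Q_def using fin i by (subst sum.remove[of _ i]) auto
  then have "1 - a i < (\<Sum>q\<in>Q. a q)" using over by linarith
  then have "b * (1 - a i) < b * (\<Sum>q\<in>Q. a q)" using b by simp
  then have s: "b - b * a i < (\<Sum>q\<in>Q. b * a q)" by (simp add: sum_distrib_left algebra_simps)
  have z1: "b * a q \<le> 1" "0 \<le> b * a q" if "q \<in> A" for q using a that by auto
  have zQ: "0 \<le> b * a q \<and> b * a q \<le> 1" if "q \<in> Q" for q using z1 that QA by auto
  \<comment> \<open>The number also equals \<open>b * (b / (b + 1))\<close>, so the cut at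
    \<open>b / (b + 1)\<close> balances both cases: a small \<open>i\<close> leaves at least this
    much to the others, and otherwise \<open>b\<close> others have scaled size at least
    \<open>b / (b + 1)\<close> each.\<close>
  have id: "real (b - 1) + 1 / (real b + 1) = b - b / (b + 1)" using b by (simp add: field_simps of_nat_diff)
  have "real (b - 1) + 1 / (real b + 1) \<le> (\<Sum>q\<in>Q. b * a q)"
  proof (cases "b * a i \<le> b / (b + 1)")
    case True
    then show ?thesis unfolding id using s by linarith
  next
    case False
    have "(\<Sum>q\<in>Q. b * a q) \<le> (\<Sum>q\<in>Q. 1)" by (rule sum_mono) (use zQ in auto)
    then have "real b - 1 < card Q" using s z1[OF i] by simp
    then have cQ: "b \<le> card Q" using b by linarith
    have "b - b / (b + 1) = b * (b / (b + 1))" by (simp add: field_simps)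
    also have "... \<le> card Q * (b / (b + 1))" using cQ by (intro mult_right_mono) auto
    also have "... = (\<Sum>q\<in>Q. b / (b + 1))" by simp
    also have "... \<le> (\<Sum>q\<in>Q. b * a q)"
    proof (rule sum_mono)
      fix q assume "q \<in> Q"
      then have "a i \<le> a q" by (simp add: Q_def)
      then have "b * a i \<le> b * a q" by (intro mult_left_mono) auto
      then show "b / (b + 1) \<le> b * a q" using False by linarith
    qed
    finally show ?thesis unfolding id .
  qed
  then have "(1 + l) ^ (b - 1) * (1 + l * (1 / (real b + 1))) \<le> (\<Prod>q\<in>Q. 1 + l * (b * a q))"
    by (intro prod_ge_interpolation finQ l) (use zQ in auto)
  also have "... \<le> (\<Prod>q\<in>A - {i}. 1 + l * (b * a q))"
    by (rule prod_mono2) (use fin QA z1 l in auto)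
  finally show ?thesis by (simp add: Ym_def mult.assoc add.commute)
qed

section \<open>Submodular functions\<close>

lemma submodular_marginal_antimono:
  assumes f: "submodular_on V f" and "A \<subseteq> B" "B \<subseteq> V" "x \<in> V" "x \<notin> B"
  shows "f (insert x B) - f B \<le> f (insert x A) - f A"
proof -
  have "f (insert x A \<union> B) + f (insert x A \<inter> B) \<le> f (insert x A) + f B"
    by (rule f[unfolded submodular_on_def, rule_format]) (use assms in auto)
  moreover have "insert x A \<union> B = insert x B" "insert x A \<inter> B = A" using assms by auto
  ultimately show ?thesis by simp
qed

text \<open>The optimum is compared through its marginals \<open>d\<close> along a fixed enumeration. Since the
  coefficients lie in \<open>[0, 1]\<close>, passing to marginals with respect to \<open>S\<close> costs at most the total
  drop, which monotonicity bounds by \<open>f S - f {}\<close>.\<close>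

lemma marginals_lower_bound:
  fixes f :: "nat set \<Rightarrow> real"
  assumes sub: "submodular_on V f" and mon: "mono_on (Pow V) f" and "finite V" "T \<subseteq> V"
  shows "\<exists>d. (\<forall>i\<in>T. 0 \<le> d i) \<and> (\<Sum>i\<in>T. d i) = f T - f {} \<and>
     (\<forall>S be. S \<subseteq> V \<longrightarrow> (\<forall>i\<in>T. 0 \<le> be i \<and> be i \<le> 1) \<longrightarrow>
        (\<Sum>i\<in>T. be i * d i) - (f S - f {}) \<le> (\<Sum>i\<in>T. be i * (f (insert i S) - f S)))"
proof -
  have "finite T" using assms finite_subset by blast
  \<comment> \<open>For the induction the term \<open>f (S \<union> T) - f S\<close> is kept exact;
    only afterwards does monotonicity replace \<open>f (S \<union> T)\<close> by
    \<open>f T\<close>.\<close>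
  then have "T \<subseteq> V \<Longrightarrow> \<exists>d. (\<forall>i\<in>T. 0 \<le> d i) \<and> (\<Sum>i\<in>T. d i) = f T - f {} \<and>
     (\<forall>S be. S \<subseteq> V \<longrightarrow> (\<forall>i\<in>T. 0 \<le> be i \<and> be i \<le> 1) \<longrightarrow>
        (\<Sum>i\<in>T. be i * d i) - (f T - f {}) + (f (S \<union> T) - f S)
          \<le> (\<Sum>i\<in>T. be i * (f (insert i S) - f S)))"
  proof (induction T rule: finite_induct)
    case empty
    then show ?case by simp
  next
    case (insert x T)
    then obtain d where d: "\<forall>i\<in>T. 0 \<le> d i" "(\<Sum>i\<in>T. d i) = f T - f {}"
      and main: "\<And>S be. S \<subseteq> V \<Longrightarrow> (\<forall>i\<in>T. 0 \<le> be i \<and> be i \<le> 1) \<Longrightarrow>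
        (\<Sum>i\<in>T. be i * d i) - (f T - f {}) + (f (S \<union> T) - f S)
          \<le> (\<Sum>i\<in>T. be i * (f (insert i S) - f S))" by auto
    define d' where "d' = d(x := f (insert x T) - f T)"
    have dT: "(\<Sum>i\<in>T. g i (d' i)) = (\<Sum>i\<in>T. g i (d i))" for g :: "nat \<Rightarrow> real \<Rightarrow> real"
      by (rule sum.cong) (use insert in \<open>auto simp: d'_def\<close>)
    have dx: "d' x = f (insert x T) - f T" by (simp add: d'_def)
    have "f T \<le> f (insert x T)" by (rule mono_onD[OF mon]) (use insert.prems in auto)
    then have "\<forall>i\<in>insert x T. 0 \<le> d' i" using d by (auto simp: d'_def)
    moreover have "(\<Sum>i\<in>insert x T. d' i) = f (insert x T) - f {}"
      using insert d dT[of "\<lambda>_ v. v"] dx by simp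
    moreover have "(\<Sum>i\<in>insert x T. be i * d' i) - (f (insert x T) - f {}) + (f (S \<union> insert x T) - f S)
          \<le> (\<Sum>i\<in>insert x T. be i * (f (insert i S) - f S))"
      if S: "S \<subseteq> V" and be: "\<forall>i\<in>insert x T. 0 \<le> be i \<and> be i \<le> 1" for S be
    proof -
      have b: "0 \<le> be x" "be x \<le> 1" using be by auto
      let ?u = "f (insert x (S \<union> T)) - f (S \<union> T)"
      have u1: "?u \<le> f (insert x S) - f S"
      proof (cases "x \<in> S \<union> T")
        case True
        then have "x \<in> S" using insert by auto
        then show ?thesis by (simp add: insert_absorb)
      next
        case False
        then show ?thesis using S insert.prems
          by (intro submodular_marginal_antimono[OF sub]) auto
      qed
      have u2: "?u \<le> d' x"
      proof (cases "x \<in> S \<union> T")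
        case True
        then show ?thesis using dx \<open>f T \<le> f (insert x T)\<close> by (simp add: insert_absorb)
      next
        case False
        then show ?thesis unfolding dx using S insert.prems
          by (intro submodular_marginal_antimono[OF sub]) auto
      qed
      \<comment> \<open>\<open>?u\<close> is split with the weights \<open>be x\<close> and
        \<open>1 - be x\<close>; the former part is charged to the marginal at \<open>S\<close>, the
        latter to \<open>d' x\<close>.\<close>
      have "(1 - be x) * ?u \<le> (1 - be x) * d' x" using b u2 by (intro mult_left_mono) auto
      moreover have "be x * ?u \<le> be x * (f (insert x S) - f S)" using b u1 by (intro mult_left_mono) auto
      ultimately have "be x * d' x - d' x + ?u \<le> be x * (f (insert x S) - f S)"
        by (simp add: algebra_simps)
      moreover have "(\<Sum>i\<in>T. be i * d i) - (f T - f {}) + (f (S \<union> T) - f S)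
          \<le> (\<Sum>i\<in>T. be i * (f (insert i S) - f S))" by (rule main) (use S be in auto)
      ultimately show ?thesis using insert dT[of "\<lambda>i v. be i * v"] dx by simp
    qed
    ultimately show ?case by blast
  qed
  from this[OF \<open>T \<subseteq> V\<close>] obtain d where d: "\<forall>i\<in>T. 0 \<le> d i" "(\<Sum>i\<in>T. d i) = f T - f {}"
    and main: "\<And>S be. S \<subseteq> V \<Longrightarrow> (\<forall>i\<in>T. 0 \<le> be i \<and> be i \<le> 1) \<Longrightarrow>
        (\<Sum>i\<in>T. be i * d i) - (f T - f {}) + (f (S \<union> T) - f S)
          \<le> (\<Sum>i\<in>T. be i * (f (insert i S) - f S))" by blast
  have *: "f T \<le> f (S \<union> T)" if "S \<subseteq> V" for S
    by (rule mono_onD[OF mon]) (use that \<open>T \<subseteq> V\<close> in auto)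
  have "(\<Sum>i\<in>T. be i * d i) - (f S - f {}) \<le> (\<Sum>i\<in>T. be i * (f (insert i S) - f S))"
    if "S \<subseteq> V" "\<forall>i\<in>T. 0 \<le> be i \<and> be i \<le> 1" for S be
    using main[OF that] * [OF that(1)] by linarith
  with d show ?thesis by blast
qed

section \<open>The random process and its analysis\<close>

text \<open>\<open>P\<close> is the number of equally likely outcomes of the sampling in one round, and the loads of the
  sampled list of items are at most \<open>K\<close>, so that one round has expected load at most
  \<open>K / P \<le> 1 / (2 * l * n)\<close>. Below, \<open>pp S tr i\<close> bounds the probability that item \<open>i\<close> is deleted at the end
  if the current set is \<open>S\<close> and \<open>tr\<close> rounds remain.\<close>

locale alg =
  fixes n m kk b P K :: nat and a :: "nat \<Rightarrow> nat \<Rightarrow> real" and l :: real and f :: "nat set \<Rightarrow> real"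
  assumes n_ge: "2 \<le> n" and b_pos: "1 \<le> b"
    and a_nonneg: "i < n \<Longrightarrow> j < m \<Longrightarrow> 0 \<le> a i j"
    and a_le: "i < n \<Longrightarrow> j < m \<Longrightarrow> b * a i j \<le> 1"
    and a_card: "i < n \<Longrightarrow> a i m = 1 / n"
    and sparse: "i < n \<Longrightarrow> card {j. j < m \<and> 0 < a i j} \<le> kk"
    and l_ge: "1 / 2 \<le> l"
    and l_big: "4 * kk * ((1 + b / (2 * n)) ^ n - 1) \<le> Ym l b - 1"
    and P_pos: "0 < P"
    and P_ge: "2 * l * n * K \<le> P" and P_less: "P < 2 * l * n * (K + 1)"
    and K_ge: "4096 * (m + 1) \<le> K"
    and f_nonneg: "A \<subseteq> {..<n} \<Longrightarrow> 0 \<le> f A"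
    and f_mono: "mono_on (Pow {..<n}) f"
    and f_sub: "submodular_on {..<n} f"
begin

definition "cc = 1 + b / (2 * n)"
text \<open>Normalisation: \<open>th * (Y S j - 1)\<close> is 0 for the empty set and at least 1
  once \<open>Y S j\<close> reaches \<open>Ym l b\<close>.\<close>

definition "th = 1 / (Ym l b - 1)"
definition "Y S j = (\<Prod>i\<in>S. 1 + l * b * a i j)" for S j
definition "pp S tr i = (\<Sum>j | j < m \<and> 0 < a i j. th * (Y S j * cc ^ tr - 1))" for S tr i
text \<open>Because of the cut at 1/2, the marginal of a picked item is at most twice its discounted
  marginal.\<close>

definition "wt S tr i = (if pp S tr i \<le> 1/2 then (f (insert i S) - f S) * (1 - pp S tr i) else 0)" for S tr i
definition "it S tr r = mwi n m a (wt S tr) r" for S tr r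
definition "NN S tr = (LEAST r. (33/32) ^ (K - 1) < mwD n m a (wt S tr) r)" for S tr
text \<open>Outcomes beyond the end of the list select nothing. Items of weight 0 are skipped, so a
  picked item is always new.\<close>

definition "nxS S tr r = (if r < NN S tr \<and> 0 < wt S tr (it S tr r) then insert (it S tr r) S else S)" for S tr r
definition "keep A = {i \<in> A. \<forall>j<m. 0 < a i j \<longrightarrow> (\<Sum>q | q \<in> A \<and> a i j \<le> a q j. a q j) \<le> 1}" for A

primrec chain :: "nat \<Rightarrow> nat set \<Rightarrow> nat set pmf" where
  "chain 0 S = return_pmf S"
| "chain (Suc tr) S = bind_pmf (map_pmf (nxS S (Suc tr)) (pmf_of_set {..<P})) (chain tr)"

lemma n_pos: "0 < n" using n_ge by simp

lemma l_pos: "0 < l" using l_ge by simp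

lemma cc_ge_1: "1 \<le> cc" by (simp add: cc_def)

lemma Ym_gt_1: "1 < Ym l b"
proof -
  have "1 \<le> (1 + l) ^ (b - 1)" using l_pos by simp
  moreover have "1 < 1 + l / (b + 1)" using l_pos by simp
  ultimately have "1 * 1 < (1 + l) ^ (b - 1) * (1 + l / (b + 1))"
    by (intro mult_le_less_imp_less) auto
  then show ?thesis unfolding Ym_def by simp
qed

lemma th_pos: "0 < th" using Ym_gt_1 by (simp add: th_def)

lemma Y_ge_1: "S \<subseteq> {..<n} \<Longrightarrow> j < m \<Longrightarrow> 1 \<le> Y S j"
  unfolding Y_def by (intro prod_ge_1) (use l_pos a_nonneg in auto)

lemma Y_nonneg: "S \<subseteq> {..<n} \<Longrightarrow> j < m \<Longrightarrow> 0 \<le> Y S j"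
  by (rule order_trans[OF zero_le_one Y_ge_1])

lemma pp_nonneg:
  assumes "S \<subseteq> {..<n}" shows "0 \<le> pp S tr i"
  unfolding pp_def
proof (intro sum_nonneg)
  fix j assume "j \<in> {j. j < m \<and> 0 < a i j}"
  then have "1 * 1 \<le> Y S j * cc ^ tr"
    using Y_ge_1[OF assms] Y_nonneg[OF assms] cc_ge_1 by (intro mult_mono) auto
  then show "0 \<le> th * (Y S j * cc ^ tr - 1)" using th_pos by simp
qed

lemma pp_Suc:
  assumes "S \<subseteq> {..<n}" shows "pp S tr i \<le> pp S (Suc tr) i"
  unfolding pp_def
proof (intro sum_mono)
  fix j assume "j \<in> {j. j < m \<and> 0 < a i j}"
  then have "0 \<le> Y S j" using Y_ge_1[OF assms, of j] by simp
  then have "Y S j * cc ^ tr \<le> Y S j * cc ^ Suc tr"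
    using cc_ge_1 by (intro mult_left_mono power_increasing) auto
  then show "th * (Y S j * cc ^ tr - 1) \<le> th * (Y S j * cc ^ Suc tr - 1)" using th_pos by simp
qed

lemma pp_empty: "i < n \<Longrightarrow> pp {} n i \<le> 1/4"
proof -
  assume i: "i < n"
  have c: "0 \<le> cc ^ n - 1" using cc_ge_1 by simp
  have "pp {} n i = card {j. j < m \<and> 0 < a i j} * (th * (cc ^ n - 1))"
    by (simp add: pp_def Y_def)
  also have "... \<le> kk * (th * (cc ^ n - 1))"
    using sparse[OF i] c th_pos by (intro mult_right_mono) auto
  also have "... \<le> 1/4"
    using l_big Ym_gt_1 unfolding cc_def[symmetric] th_def by (simp add: field_simps)
  finally show ?thesis .
qed

lemma wt_nonneg:
  assumes "S \<subseteq> {..<n}" "i < n" shows "0 \<le> wt S tr i"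
proof -
  have "f S \<le> f (insert i S)" by (rule mono_onD[OF f_mono]) (use assms in auto)
  then show ?thesis by (auto simp: wt_def)
qed

lemma mwu:
  assumes "S \<subseteq> {..<n}" shows "mwu n m a (wt S tr)"
proof
  fix i j assume i: "i < n" and j: "j \<le> m"
  show "0 \<le> a i j" using a_nonneg[OF i] a_card[OF i] j by (cases "j = m") auto
  show "a i j \<le> 1"
  proof (cases "j = m")
    case True
    then show ?thesis using a_card[OF i] n_pos by simp
  next
    case False
    then have "0 \<le> a i j" "b * a i j \<le> 1" using a_nonneg[OF i] a_le[OF i] j by auto
    moreover have "1 * a i j \<le> b * a i j" using \<open>0 \<le> a i j\<close> b_pos by (intro mult_right_mono) auto
    ultimately show ?thesis by linarith
  qed
qed (use n_pos a_card assms wt_nonneg in auto)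

lemma K_ge_1: "1 \<le> K" using K_ge by simp

lemma NN_stop:
  assumes "S \<subseteq> {..<n}"
  shows "(33/32) ^ (K - 1) < mwD n m a (wt S tr) (NN S tr)"
  unfolding NN_def by (rule LeastI_ex) (rule mwu.D_stops[OF mwu[OF assms] K_ge_1])

lemma NN_before: "q < NN S tr \<Longrightarrow> mwD n m a (wt S tr) q \<le> (33/32) ^ (K - 1)"
  unfolding NN_def not_less[symmetric] by (rule not_less_Least)

lemma it_less: "S \<subseteq> {..<n} \<Longrightarrow> it S tr r < n"
  unfolding it_def by (rule mwu.it_less[OF mwu])

lemma nxS_subset: "S \<subseteq> {..<n} \<Longrightarrow> nxS S tr r \<subseteq> {..<n}"
  using it_less by (auto simp: nxS_def)

lemma load_le:
  assumes "S \<subseteq> {..<n}" "j \<le> m"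
  shows "(\<Sum>q<NN S tr. a (it S tr q) j) \<le> K"
  unfolding it_def by (rule mwu.load_le[OF mwu[OF assms(1)] NN_before K_ge_1 assms(2)])

lemma NN_le: assumes "S \<subseteq> {..<n}" shows "NN S tr \<le> n * K"
  by (rule mwu.count_le[OF mwu[OF assms] NN_before K_ge_1])

lemma nK_le_P: "n * K \<le> P"
proof -
  have "1 * real (n * K) \<le> (2 * l) * real (n * K)" using l_ge by (intro mult_right_mono) auto
  also have "... \<le> P" using P_ge by (simp add: algebra_simps)
  finally show ?thesis by (simp only: mult_1 of_nat_le_iff)
qed

lemma NN_le_P: "S \<subseteq> {..<n} \<Longrightarrow> NN S tr \<le> P"
  using NN_le nK_le_P le_trans by blast

section \<open>Supermartingale property of the potentials and of the risk bounds\<close>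

lemma Y_insert_le:
  assumes S: "S \<subseteq> {..<n}" and i: "i < n" "j < m"
  shows "Y (insert i S - {x}) j \<le> Y (S - {x}) j * (1 + l * b * a i j)"
proof -
  have fin: "finite S" using S finite_subset by blast
  have g: "1 \<le> 1 + l * b * a i j" using a_nonneg[OF i] l_pos by simp
  have Y1: "1 \<le> Y (S - {x}) j" using Y_ge_1[of "S - {x}" j] S i by auto
  show ?thesis
  proof (cases "i = x \<or> i \<in> S")
    case True
    then have "insert i S - {x} = S - {x}" by auto
    moreover have "Y (S - {x}) j * 1 \<le> Y (S - {x}) j * (1 + l * b * a i j)"
      using Y1 g by (intro mult_left_mono) auto
    ultimately show ?thesis by simp
  next
    case False
    then have "insert i S - {x} = insert i (S - {x})" by auto
    then show ?thesis using False fin by (simp add: Y_def)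
  qed
qed

lemma sum_split_NN:
  assumes "S \<subseteq> {..<n}"
  shows "(\<Sum>r<P. if r < NN S tr then g r else 0) = (\<Sum>r<NN S tr. g r :: real)"
proof -
  have "{..<P} \<inter> {r. r < NN S tr} = {..<NN S tr}" using NN_le_P[OF assms, of tr] by auto
  then show ?thesis by (simp add: sum.If_cases)
qed

text \<open>Averaged over the \<open>P\<close> outcomes, the load added to constraint
  \<open>j\<close> is at most \<open>K / P\<close>, hence at most \<open>1 / (2 * l * n)\<close>;
  scaled by \<open>l * b\<close> this is the excess of \<open>cc\<close> over 1. Removing
  \<open>x\<close> prepares for the risk of item \<open>x\<close>, to which its own size does not
  contribute.\<close>

lemma sum_Y_le:
  assumes S: "S \<subseteq> {..<n}" and j: "j < m"
  shows "(\<Sum>r<P. Y (nxS S tr r - {x}) j) \<le> P * (Y (S - {x}) j * cc)"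
proof -
  let ?Y = "Y (S - {x}) j"
  have Y0: "0 \<le> ?Y" using S j by (intro Y_nonneg) auto
  have "Y (nxS S tr r - {x}) j \<le> ?Y + (if r < NN S tr then ?Y * (l * b) * a (it S tr r) j else 0)" for r
  proof (cases "r < NN S tr \<and> 0 < wt S tr (it S tr r)")
    case True
    then show ?thesis using Y_insert_le[OF S it_less[OF S] j, of tr r x]
      by (simp add: nxS_def algebra_simps)
  next
    case False
    have "0 \<le> ?Y * (l * b) * a (it S tr r) j"
      using Y0 l_pos a_nonneg[OF it_less[OF S] j] by simp
    then show ?thesis using False by (auto simp: nxS_def)
  qed
  then have "(\<Sum>r<P. Y (nxS S tr r - {x}) j) \<le>
      (\<Sum>r<P. ?Y + (if r < NN S tr then ?Y * (l * b) * a (it S tr r) j else 0))" by (rule sum_mono)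
  also have "... = P * ?Y + ?Y * (l * b) * (\<Sum>q<NN S tr. a (it S tr q) j)"
    by (simp add: sum.distrib sum_split_NN[OF S] sum_distrib_left)
  also have "... \<le> P * ?Y + ?Y * (l * b) * K"
    using load_le[OF S, of j tr] j Y0 l_pos by (intro add_left_mono mult_left_mono) auto
  also have "... = P * ?Y + ?Y * b * (l * K)" by simp
  also have "... \<le> P * ?Y + ?Y * b * (P / (2 * n))"
    using P_ge n_pos Y0 by (intro add_left_mono mult_left_mono) (auto simp: field_simps)
  also have "... = P * (?Y * cc)" by (simp add: cc_def algebra_simps)
  finally show ?thesis .
qed

text \<open>The growth of \<open>Y\<close> by \<open>cc\<close> in a round is compensated by the
  exponent of \<open>cc\<close> dropping by one.\<close>

lemma sum_pp_le:
  assumes S: "S \<subseteq> {..<n}"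
  shows "(\<Sum>r<P. pp (nxS S (Suc tr) r - {x}) tr i) \<le> P * pp (S - {x}) (Suc tr) i"
proof -
  have "(\<Sum>r<P. pp (nxS S (Suc tr) r - {x}) tr i) =
      (\<Sum>j | j < m \<and> 0 < a i j. \<Sum>r<P. th * (Y (nxS S (Suc tr) r - {x}) j * cc ^ tr - 1))"
    unfolding pp_def by (rule sum.swap)
  also have "... \<le> (\<Sum>j | j < m \<and> 0 < a i j. P * (th * (Y (S - {x}) j * cc ^ Suc tr - 1)))"
  proof (rule sum_mono)
    fix j assume j: "j \<in> {j. j < m \<and> 0 < a i j}"
    have "(\<Sum>r<P. Y (nxS S (Suc tr) r - {x}) j) * cc ^ tr \<le> P * (Y (S - {x}) j * cc) * cc ^ tr"
      using sum_Y_le[OF S, of j "Suc tr" x] j cc_ge_1 by (intro mult_right_mono) auto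
    then have "th * ((\<Sum>r<P. Y (nxS S (Suc tr) r - {x}) j) * cc ^ tr - P)
        \<le> th * (P * (Y (S - {x}) j * cc) * cc ^ tr - P)"
      using th_pos by (intro mult_left_mono) auto
    then show "(\<Sum>r<P. th * (Y (nxS S (Suc tr) r - {x}) j * cc ^ tr - 1))
        \<le> P * (th * (Y (S - {x}) j * cc ^ Suc tr - 1))"
      by (simp add: sum_distrib_left[symmetric] sum_distrib_right[symmetric] sum_subtractf algebra_simps)
  qed
  finally show ?thesis by (simp add: pp_def sum_distrib_left)
qed

text \<open>Instance \<open>x = n\<close>, which is not an item, so that nothing is removed.\<close>

lemma sum_pp_le':
  assumes S: "S \<subseteq> {..<n}"
  shows "(\<Sum>r<P. pp (nxS S (Suc tr) r) tr i) \<le> P * pp S (Suc tr) i"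
proof -
  have "n \<notin> nxS S (Suc tr) r" "n \<notin> S" for r using nxS_subset[OF S] S by blast+
  then show ?thesis using sum_pp_le[OF S, of tr n i] by simp
qed

section \<open>Discounted gain of one round\<close>

definition "wg S tr r = (if r < NN S tr then wt S tr (it S tr r) else 0)" for S tr r

lemma wg_nonneg: "S \<subseteq> {..<n} \<Longrightarrow> 0 \<le> wg S tr r"
  unfolding wg_def using wt_nonneg it_less by auto

lemma f_nxS_le:
  assumes "S \<subseteq> {..<n}" shows "f (nxS S tr r) - f S \<le> 2 * wg S tr r"
proof (cases "r < NN S tr \<and> 0 < wt S tr (it S tr r)")
  case True
  let ?i = "it S tr r"
  have p: "pp S tr ?i \<le> 1/2" using True by (auto simp: wt_def split: if_splits)
  have g: "0 \<le> f (insert ?i S) - f S" using mono_onD[OF f_mono, of S "insert ?i S"] it_less assms by auto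
  have "(f (insert ?i S) - f S) * (1/2) \<le> (f (insert ?i S) - f S) * (1 - pp S tr ?i)"
    using p g by (intro mult_left_mono) auto
  then show ?thesis using True p by (simp add: nxS_def wg_def wt_def)
qed (use wg_nonneg[OF assms, of tr r] in \<open>auto simp: nxS_def\<close>)

text \<open>Guaranteed share of the fractional optimum gained per round: 95/100 is the loss of
  multiplicative weights, and \<open>(K + 1) / P\<close> exceeds
  \<open>1 / (2 * l * n)\<close>.\<close>

definition "eta = 95/100 / (2 * l * n)"

definition "feas T \<longleftrightarrow> T \<subseteq> {..<n} \<and> (\<forall>j<m. (\<Sum>i\<in>T. a i j) \<le> 1)" for T

lemma sum_wg_ge:
  assumes S: "S \<subseteq> {..<n}" and T: "feas T"
  shows "P * (eta * (\<Sum>i\<in>T. wt S tr i)) \<le> (\<Sum>r<P. wg S tr r)"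
proof -
  have T': "T \<subseteq> {..<n}" using T by (simp add: feas_def)
  have W0: "0 \<le> (\<Sum>i\<in>T. wt S tr i)" using T' wt_nonneg[OF S] by (intro sum_nonneg) auto
  have rows: "(\<Sum>i\<in>T. a i j) \<le> 1" if "j \<le> m" for j
  proof (cases "j = m")
    case True
    have "card T \<le> n" using card_mono[OF _ T'] by simp
    moreover have "(\<Sum>i\<in>T. a i m) = card T / n" using T' a_card by (subst sum.cong[OF refl, of _ _ "\<lambda>_. 1 / n"]) auto
    ultimately show ?thesis using True n_pos by simp
  qed (use T that in \<open>auto simp: feas_def\<close>)
  have "P * eta \<le> 95/100 * (K + 1)"
    using P_less l_pos n_pos unfolding eta_def by (simp add: field_simps)
  then have "P * eta * (\<Sum>i\<in>T. wt S tr i) \<le> 95/100 * (K + 1) * (\<Sum>i\<in>T. wt S tr i)"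
    using W0 by (rule mult_right_mono)
  also have "... \<le> (\<Sum>q<NN S tr. wt S tr (it S tr q))"
    unfolding it_def using mwu.value_ge'[OF mwu[OF S] T' rows NN_stop[OF S] K_ge, of tr] by (simp add: add.commute)
  also have "... = (\<Sum>r<P. wg S tr r)" unfolding wg_def by (rule sum_split_NN[OF S, symmetric])
  finally show ?thesis by (simp add: mult.assoc)
qed

section \<open>Pruning: feasibility, risk of deletion, credits of the survivors\<close>

lemma keep_subset: "keep A \<subseteq> A" by (auto simp: keep_def)

text \<open>In constraint \<open>j\<close> take the smallest survivor of positive size. Its own
  survival test already counts every other survivor with positive size in \<open>j\<close>.\<close>

lemma feas_keep: assumes A: "A \<subseteq> {..<n}" shows "feas (keep A)"
  unfolding feas_def
proof (intro conjI allI impI)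
  show "keep A \<subseteq> {..<n}" using A keep_subset by blast
  fix j assume j: "j < m"
  have fin: "finite A" using A finite_subset by blast
  define Q where "Q = {i \<in> keep A. 0 < a i j}"
  have finQ: "finite Q" using fin keep_subset by (auto simp: Q_def intro: finite_subset)
  have ann: "0 \<le> a i j" if "i \<in> A" for i using a_nonneg that A j by auto
  have eq: "(\<Sum>i\<in>keep A. a i j) = (\<Sum>i\<in>Q. a i j)"
    using fin keep_subset ann finite_subset[OF keep_subset fin]
    by (intro sum.mono_neutral_right) (force simp: Q_def)+
  show "(\<Sum>i\<in>keep A. a i j) \<le> 1"
  proof (cases "Q = {}")
    case False
    then obtain i where i: "i \<in> Q" "\<And>q. q \<in> Q \<Longrightarrow> a i j \<le> a q j"
      using finQ arg_min_if_finite(1)[of Q "\<lambda>i. a i j"] arg_min_least[of Q _ "\<lambda>i. a i j"] by blast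
    have "(\<Sum>i\<in>Q. a i j) \<le> (\<Sum>q | q \<in> A \<and> a i j \<le> a q j. a q j)"
      using fin i keep_subset ann by (intro sum_mono2) (auto simp: Q_def)
    also have "... \<le> 1" using i(1) j by (auto simp: Q_def keep_def)
    finally show ?thesis unfolding eq .
  qed (simp add: eq)
qed

text \<open>The violated constraint alone contributes at least 1 to the risk, and no other term is
  negative.\<close>

lemma killed_pp:
  assumes A: "A \<subseteq> {..<n}" and i: "i \<in> A" "i \<notin> keep A"
  shows "1 \<le> pp (A - {i}) 0 i"
proof -
  have fin: "finite A" using A finite_subset by blast
  obtain j where j: "j < m" "0 < a i j" "1 < (\<Sum>q | q \<in> A \<and> a i j \<le> a q j. a q j)"
    using i by (force simp: keep_def)
  have "Ym l b \<le> Y (A - {i}) j"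
    unfolding Y_def
    by (rule overflow_potential[OF fin i(1) b_pos less_imp_le[OF l_pos] _ j(3)])
       (use A a_nonneg a_le j(1) in auto)
  then have "1 \<le> th * (Y (A - {i}) j * cc ^ 0 - 1)"
    using Ym_gt_1 by (simp add: th_def)
  also have "... \<le> pp (A - {i}) 0 i"
    unfolding pp_def
  proof (rule member_le_sum)
    fix j' assume "j' \<in> {j. j < m \<and> 0 < a i j} - {j}"
    then have "1 \<le> Y (A - {i}) j'" using A by (intro Y_ge_1) auto
    then show "0 \<le> th * (Y (A - {i}) j' * cc ^ 0 - 1)" using th_pos by simp
  qed (use j in auto)
  finally show ?thesis .
qed

text \<open>\<open>g i\<close> is the marginal value of \<open>i\<close> at the time of its insertion; by submodularity these credits
  remain valid for every subset that survives the deletions.\<close>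

definition "cred S g \<longleftrightarrow> (\<forall>i\<in>S. 0 \<le> g i) \<and> (\<forall>U\<subseteq>S. f {} + (\<Sum>i\<in>U. g i) \<le> f U)" for S and g :: "nat \<Rightarrow> real"

text \<open>For \<open>U\<close> containing \<open>i\<close>, submodularity lets the marginal at the
  smaller set \<open>U - {i}\<close> dominate the credit, which was measured at
  \<open>S\<close>.\<close>

lemma cred_insert:
  assumes g: "cred S g" and S: "S \<subseteq> {..<n}" and i: "i < n" "i \<notin> S"
  shows "cred (insert i S) (g(i := f (insert i S) - f S))"
  unfolding cred_def
proof (intro conjI ballI allI impI)
  let ?g = "g(i := f (insert i S) - f S)"
  have "f S \<le> f (insert i S)" by (rule mono_onD[OF f_mono]) (use S i in auto)
  then show "0 \<le> ?g q" if "q \<in> insert i S" for q using that g by (auto simp: cred_def)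
  fix U assume U: "U \<subseteq> insert i S"
  have eq: "(\<Sum>q\<in>U - {i}. ?g q) = (\<Sum>q\<in>U - {i}. g q)" by (rule sum.cong) auto
  have "U - {i} \<subseteq> S" using U by auto
  then have U': "f {} + (\<Sum>q\<in>U - {i}. g q) \<le> f (U - {i})" using g unfolding cred_def by blast
  have fin: "finite U" using U S finite_subset by (metis finite_insert finite_lessThan)
  show "f {} + (\<Sum>q\<in>U. ?g q) \<le> f U"
  proof (cases "i \<in> U")
    case True
    have "f (insert i S) - f S \<le> f (insert i (U - {i})) - f (U - {i})"
      by (rule submodular_marginal_antimono[OF f_sub]) (use U S i in auto)
    moreover have "(\<Sum>q\<in>U. ?g q) = ?g i + (\<Sum>q\<in>U - {i}. ?g q)" using fin True by (rule sum.remove)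
    moreover have "insert i (U - {i}) = U" using True by auto
    ultimately show ?thesis using U' eq by simp
  next
    case False
    then have "U - {i} = U" by auto
    then show ?thesis using U' eq by simp
  qed
qed

text \<open>Estimate of the credit that will survive pruning. Leaving \<open>i\<close> out of its
  own risk means that inserting \<open>i\<close> does not raise the risk by which \<open>i\<close>
  was discounted.\<close>

definition "Psi tr S g = (\<Sum>i\<in>S. g i * (1 - pp (S - {i}) tr i))" for tr S and g :: "nat \<Rightarrow> real"

lemma keep_value:
  assumes S: "S \<subseteq> {..<n}" and g: "cred S g"
  shows "f {} + Psi 0 S g \<le> f (keep S)"
proof -
  have fin: "finite S" using S finite_subset by blast
  have "Psi 0 S g \<le> (\<Sum>i\<in>S. if i \<in> keep S then g i else 0)"
    unfolding Psi_def
  proof (rule sum_mono)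
    fix i assume i: "i \<in> S"
    have g0: "0 \<le> g i" using g i by (auto simp: cred_def)
    show "g i * (1 - pp (S - {i}) 0 i) \<le> (if i \<in> keep S then g i else 0)"
    proof (cases "i \<in> keep S")
      case True
      have "0 \<le> pp (S - {i}) 0 i" using S by (intro pp_nonneg) auto
      then have "g i * (1 - pp (S - {i}) 0 i) \<le> g i * 1" using g0 by (intro mult_left_mono) auto
      then show ?thesis using True by simp
    next
      case False
      then show ?thesis using killed_pp[OF S i False] g0 by (simp add: mult_nonneg_nonpos)
    qed
  qed
  also have "... = (\<Sum>i\<in>keep S. g i)"
    using fin keep_subset[of S] by (simp add: sum.If_cases Int_absorb1)
  finally have "Psi 0 S g \<le> (\<Sum>i\<in>keep S. g i)" .
  moreover have "f {} + (\<Sum>i\<in>keep S. g i) \<le> f (keep S)"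
    using g keep_subset[of S] unfolding cred_def by blast
  ultimately show ?thesis by linarith
qed

definition "upd S tr r g = (if r < NN S tr \<and> 0 < wt S tr (it S tr r)
    then g(it S tr r := f (insert (it S tr r) S) - f S) else g)" for S tr r and g :: "nat \<Rightarrow> real"

lemma picked_new: "0 < wt S tr i \<Longrightarrow> i \<notin> S"
  by (auto simp: wt_def insert_absorb split: if_splits)

lemma cred_upd:
  assumes "cred S g" "S \<subseteq> {..<n}"
  shows "cred (nxS S tr r) (upd S tr r g)"
  using assms cred_insert[OF assms it_less[OF assms(2)]] picked_new by (auto simp: nxS_def upd_def)

text \<open>Old items keep their discounted credit on average, since their risks form
  supermartingales; the new item enters with credit at least \<open>wg\<close>. Its weight was
  computed with \<open>Suc tr\<close> rounds to go and it joins with \<open>tr\<close>, which only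
  lowers its risk.\<close>

lemma sum_Psi_ge:
  assumes S: "S \<subseteq> {..<n}" and g: "cred S g"
  shows "P * Psi (Suc tr) S g + (\<Sum>r<P. wg S (Suc tr) r)
           \<le> (\<Sum>r<P. Psi tr (nxS S (Suc tr) r) (upd S (Suc tr) r g))"
proof -
  have fin: "finite S" using S finite_subset by blast
  let ?old = "\<lambda>r. \<Sum>i\<in>S. g i * (1 - pp (nxS S (Suc tr) r - {i}) tr i)"
  have "?old r + wg S (Suc tr) r \<le> Psi tr (nxS S (Suc tr) r) (upd S (Suc tr) r g)" for r
  proof (cases "r < NN S (Suc tr) \<and> 0 < wt S (Suc tr) (it S (Suc tr) r)")
    case True
    define i where "i = it S (Suc tr) r"
    have i: "i \<notin> S" "i < n" using True picked_new it_less[OF S] by (auto simp: i_def)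
    have nx: "nxS S (Suc tr) r = insert i S" "upd S (Suc tr) r g = g(i := f (insert i S) - f S)"
      using True by (auto simp: nxS_def upd_def i_def)
    have wg: "wg S (Suc tr) r = (f (insert i S) - f S) * (1 - pp S (Suc tr) i)"
      using True by (auto simp: wg_def wt_def i_def split: if_splits)
    have "0 \<le> f (insert i S) - f S" using mono_onD[OF f_mono, of S "insert i S"] i S by auto
    then have "wg S (Suc tr) r \<le> (f (insert i S) - f S) * (1 - pp S tr i)"
      unfolding wg using pp_Suc[OF S, of tr i] by (intro mult_left_mono) auto
    moreover have "(\<Sum>q\<in>S. (g(i := f (insert i S) - f S)) q * (1 - pp (insert i S - {q}) tr q)) = ?old r"
      unfolding nx by (rule sum.cong) (use i in auto)
    ultimately show ?thesis unfolding nx Psi_def using i fin by simp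
  next
    case False
    moreover have "wg S (Suc tr) r \<le> 0" using False by (auto simp: wg_def)
    moreover have nx: "nxS S (Suc tr) r = S" "upd S (Suc tr) r g = g"
      using False by (auto simp: nxS_def upd_def)
    ultimately show ?thesis unfolding nx Psi_def by simp
  qed
  then have "(\<Sum>r<P. ?old r) + (\<Sum>r<P. wg S (Suc tr) r)
      \<le> (\<Sum>r<P. Psi tr (nxS S (Suc tr) r) (upd S (Suc tr) r g))"
    by (simp add: sum.distrib[symmetric] sum_mono)
  moreover have "P * Psi (Suc tr) S g \<le> (\<Sum>r<P. ?old r)"
  proof -
    have "(\<Sum>r<P. ?old r) = (\<Sum>i\<in>S. g i * (P - (\<Sum>r<P. pp (nxS S (Suc tr) r - {i}) tr i)))"
      by (subst sum.swap) (simp add: sum_distrib_left[symmetric] sum_subtractf)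
    also have "... \<ge> (\<Sum>i\<in>S. g i * (P - P * pp (S - {i}) (Suc tr) i))"
      using g sum_pp_le[OF S] by (intro sum_mono mult_left_mono diff_left_mono) (auto simp: cred_def)
    finally show ?thesis by (simp add: Psi_def sum_distrib_left algebra_simps)
  qed
  ultimately show ?thesis by linarith
qed

section \<open>Expected value of the whole process\<close>

primrec acc :: "nat \<Rightarrow> real" where
  "acc 0 = 0"
| "acc (Suc tr) = acc tr + eta * (1 - 2 * acc tr)"

lemma eta_pos: "0 < eta" using l_pos n_pos by (simp add: eta_def)

lemma eta_le: "2 * eta \<le> 1"
proof -
  have "1 * 2 \<le> (2 * l) * real n" using l_ge n_ge by (intro mult_mono) auto
  then show ?thesis using l_pos n_pos by (simp add: eta_def field_simps)
qed

text \<open>\<open>acc\<close> is the Euler discretisation of \<open>z' = eta * (1 - 2 * z)\<close>;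
  the fixed point 1/2 is half of the value of the optimum.\<close>

lemma acc_closed: "1 - 2 * acc tr = (1 - 2 * eta) ^ tr"
proof (induction tr)
  case (Suc tr)
  have "1 - 2 * acc (Suc tr) = (1 - 2 * eta) * (1 - 2 * acc tr)" by (simp add: algebra_simps)
  then show ?case using Suc by simp
qed simp

lemma acc_nonneg: "0 \<le> acc tr" and acc_le: "acc tr \<le> 1/2"
proof -
  have "(1 - 2 * eta) ^ tr \<le> 1" "0 \<le> (1 - 2 * eta) ^ tr"
    using eta_pos eta_le by (auto intro!: power_le_one)
  then show "0 \<le> acc tr" "acc tr \<le> 1/2" using acc_closed[of tr] by linarith+
qed

lemma finite_chain: "finite (set_pmf (chain tr S))"
  using P_pos by (induction tr arbitrary: S) (auto simp: set_pmf_of_set lessThan_empty_iff)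

lemma expectation_chain_Suc:
  fixes h :: "nat set \<Rightarrow> real"
  shows "measure_pmf.expectation (chain (Suc tr) S) h =
    (\<Sum>r<P. measure_pmf.expectation (chain tr (nxS S (Suc tr) r)) h) / P"
proof -
  have "chain (Suc tr) S = bind_pmf (pmf_of_set {..<P}) (\<lambda>r. chain tr (nxS S (Suc tr) r))"
    by (simp add: bind_map_pmf)
  then show ?thesis using P_pos
    by (simp only:) (subst pmf_expectation_bind_pmf_of_set,
      auto simp: finite_chain lessThan_empty_iff sum_divide_distrib divide_inverse_commute sum_distrib_left)
qed

text \<open>A round with average discounted gain \<open>G\<close> raises \<open>Psi\<close> by
  \<open>G\<close> and \<open>f S\<close> by at most \<open>2 * G\<close>, a net effect of
  \<open>(1 - 2 * acc tr) * G\<close>. As \<open>G\<close> is at least \<open>eta\<close> times the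
  bracket, this is exactly the recursion of \<open>acc\<close>. All averages are written as sums
  over \<open>P\<close> outcomes.\<close>

lemma chain_value:
  assumes T: "feas T" and d: "\<forall>i\<in>T. 0 \<le> d i"
    and main: "\<And>S be. S \<subseteq> {..<n} \<Longrightarrow> (\<forall>i\<in>T. 0 \<le> be i \<and> be i \<le> 1) \<Longrightarrow>
        (\<Sum>i\<in>T. be i * d i) - (f S - f {}) \<le> (\<Sum>i\<in>T. be i * (f (insert i S) - f S))"
    and S: "S \<subseteq> {..<n}" and g: "cred S g"
  shows "f {} + Psi tr S g + acc tr * ((\<Sum>i\<in>T. d i * (1 - 2 * pp S tr i)) - (f S - f {}))
     \<le> measure_pmf.expectation (chain tr S) (\<lambda>A. f (keep A))"
  using S g
proof (induction tr arbitrary: S g)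
  case 0
  then show ?case using keep_value by simp
next
  case (Suc tr)
  note S = Suc.prems(1) and g = Suc.prems(2)
  have T': "T \<subseteq> {..<n}" using T by (simp add: feas_def)
  let ?N = "nxS S (Suc tr)" and ?A = "acc tr"
  let ?G = "\<Sum>r<P. wg S (Suc tr) r"
  let ?X = "(\<Sum>i\<in>T. d i * (1 - 2 * pp S (Suc tr) i)) - (f S - f {})"
  have G: "P * (eta * ?X) \<le> ?G"
  proof -
    \<comment> \<open>The cut-off discount factor is not linear in the risk; its minorant
      \<open>1 - 2 * pp\<close> is, and hence survives averaging.\<close>
    define be where "be i = (if pp S (Suc tr) i \<le> 1/2 then 1 - pp S (Suc tr) i else 0)" for i
    have b: "0 \<le> be i \<and> be i \<le> 1 \<and> 1 - 2 * pp S (Suc tr) i \<le> be i" for i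
      using pp_nonneg[OF S, of "Suc tr" i] by (auto simp: be_def)
    have "?X \<le> (\<Sum>i\<in>T. be i * d i) - (f S - f {})"
      using b d by (intro diff_right_mono sum_mono) (subst mult.commute, auto intro!: mult_right_mono)
    also have "... \<le> (\<Sum>i\<in>T. be i * (f (insert i S) - f S))"
      by (rule main[OF S]) (use b in auto)
    also have "... = (\<Sum>i\<in>T. wt S (Suc tr) i)" by (rule sum.cong) (auto simp: be_def wt_def)
    finally have "P * (eta * ?X) \<le> P * (eta * (\<Sum>i\<in>T. wt S (Suc tr) i))"
      using eta_pos by (intro mult_left_mono) auto
    also have "... \<le> ?G" by (rule sum_wg_ge[OF S T])
    finally show ?thesis .
  qed
  have F: "(\<Sum>r<P. f (?N r)) \<le> P * f S + 2 * ?G"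
  proof -
    have "(\<Sum>r<P. f (?N r) - f S) \<le> (\<Sum>r<P. 2 * wg S (Suc tr) r)" by (intro sum_mono f_nxS_le S)
    then show ?thesis by (simp add: sum_subtractf sum_distrib_left)
  qed
  have D: "P * (\<Sum>i\<in>T. d i * (1 - 2 * pp S (Suc tr) i)) \<le> (\<Sum>r<P. \<Sum>i\<in>T. d i * (1 - 2 * pp (?N r) tr i))"
  proof -
    have "(\<Sum>r<P. \<Sum>i\<in>T. d i * (1 - 2 * pp (?N r) tr i))
        = (\<Sum>i\<in>T. d i * (P - 2 * (\<Sum>r<P. pp (?N r) tr i)))"
      by (subst sum.swap) (simp add: sum_distrib_left[symmetric] sum_subtractf)
    also have "... \<ge> (\<Sum>i\<in>T. d i * (P - 2 * (P * pp S (Suc tr) i)))"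
      using d sum_pp_le'[OF S] by (intro sum_mono mult_left_mono diff_left_mono) auto
    finally show ?thesis by (simp add: sum_distrib_left algebra_simps)
  qed
  have "P * (f {} + Psi (Suc tr) S g + acc (Suc tr) * ?X)
      = P * f {} + P * Psi (Suc tr) S g + (1 - 2 * ?A) * (P * (eta * ?X)) + ?A * (P * ?X)"
    by (simp add: algebra_simps)
  also have "... \<le> P * f {} + P * Psi (Suc tr) S g + (1 - 2 * ?A) * ?G + ?A * (P * ?X)"
    using G acc_le[of tr] by (intro add_mono mult_left_mono order.refl) auto
  also have "... = P * f {} + (P * Psi (Suc tr) S g + ?G)
      + ?A * (P * (\<Sum>i\<in>T. d i * (1 - 2 * pp S (Suc tr) i)) - (P * f S + 2 * ?G) + P * f {})"
    by (simp add: algebra_simps)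
  also have "... \<le> P * f {} + (\<Sum>r<P. Psi tr (?N r) (upd S (Suc tr) r g))
      + ?A * ((\<Sum>r<P. \<Sum>i\<in>T. d i * (1 - 2 * pp (?N r) tr i)) - (\<Sum>r<P. f (?N r)) + P * f {})"
    using sum_Psi_ge[OF S g, of tr] D F acc_nonneg[of tr]
    by (intro add_mono mult_left_mono diff_mono order.refl) auto
  also have "... = (\<Sum>r<P. f {} + Psi tr (?N r) (upd S (Suc tr) r g)
      + ?A * ((\<Sum>i\<in>T. d i * (1 - 2 * pp (?N r) tr i)) - (f (?N r) - f {})))"
    by (simp add: sum.distrib sum_subtractf sum_distrib_left[symmetric])
  also have "... \<le> (\<Sum>r<P. measure_pmf.expectation (chain tr (?N r)) (\<lambda>A. f (keep A)))"
    by (intro sum_mono Suc.IH nxS_subset S cred_upd g)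
  also have "... = P * measure_pmf.expectation (chain (Suc tr) S) (\<lambda>A. f (keep A))"
    using P_pos by (simp add: expectation_chain_Suc del: chain.simps)
  finally show ?case using P_pos by (simp del: chain.simps acc.simps)
qed

lemma expected_value:
  assumes T: "feas T"
  shows "f T / (4 * (l / (95/100) + 1)) \<le> measure_pmf.expectation (chain n {}) (\<lambda>A. f (keep A))"
proof -
  have T': "T \<subseteq> {..<n}" using T by (simp add: feas_def)
  obtain d where d: "\<forall>i\<in>T. 0 \<le> d i" "(\<Sum>i\<in>T. d i) = f T - f {}"
    and main: "\<And>S be. S \<subseteq> {..<n} \<Longrightarrow> (\<forall>i\<in>T. 0 \<le> be i \<and> be i \<le> 1) \<Longrightarrow>
        (\<Sum>i\<in>T. be i * d i) - (f S - f {}) \<le> (\<Sum>i\<in>T. be i * (f (insert i S) - f S))"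
    using marginals_lower_bound[OF f_sub f_mono _ T'] by auto
  have f0: "0 \<le> f {}" "f {} \<le> f T" using f_nonneg[of "{}"] mono_onD[OF f_mono, of "{}" T] T' by auto
  have "cred {} (\<lambda>_. 0)" by (auto simp: cred_def)
  then have "f {} + Psi n {} (\<lambda>_. 0) + acc n * ((\<Sum>i\<in>T. d i * (1 - 2 * pp {} n i)) - (f {} - f {}))
      \<le> measure_pmf.expectation (chain n {}) (\<lambda>A. f (keep A))"
    by (intro chain_value[OF T d(1)] main) auto
  then have v: "f {} + acc n * (\<Sum>i\<in>T. d i * (1 - 2 * pp {} n i))
      \<le> measure_pmf.expectation (chain n {}) (\<lambda>A. f (keep A))" by (simp add: Psi_def)
  have "(\<Sum>i\<in>T. d i * (1/2)) \<le> (\<Sum>i\<in>T. d i * (1 - 2 * pp {} n i))"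
  proof (intro sum_mono mult_left_mono)
    fix i assume "i \<in> T"
    then show "1/2 \<le> 1 - 2 * pp {} n i" "0 \<le> d i" using pp_empty[of i] T' d by auto
  qed
  then have "(f T - f {}) / 2 \<le> (\<Sum>i\<in>T. d i * (1 - 2 * pp {} n i))"
    using d(2) by (simp add: sum_divide_distrib[symmetric])
  then have "acc n * ((f T - f {}) / 2) \<le> acc n * (\<Sum>i\<in>T. d i * (1 - 2 * pp {} n i))"
    using acc_nonneg by (rule mult_left_mono)
  with v have v2: "f {} + acc n * ((f T - f {}) / 2)
      \<le> measure_pmf.expectation (chain n {}) (\<lambda>A. f (keep A))" by linarith
  let ?z = "95/100 / l"
  have z: "0 < ?z" using l_pos by simp
  \<comment> \<open>Bounding \<open>exp (- ?z)\<close> by \<open>1 / (1 + ?z)\<close> is what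
    produces the summand 1 next to \<open>l / (95/100)\<close> in the ratio.\<close>
  have "(1 - 2 * eta) ^ n \<le> exp (- 2 * eta) ^ n"
    using exp_ge_add_one_self[of "- 2 * eta"] eta_le by (intro power_mono) auto
  also have "... = exp (- ?z)"
    unfolding exp_of_nat_mult[symmetric] using n_pos l_pos by (simp add: eta_def field_simps)
  also have "... \<le> 1 / (1 + ?z)"
    unfolding exp_minus inverse_eq_divide using exp_ge_add_one_self[of ?z] z by (intro frac_le) (auto intro: add_pos_pos)
  finally have "1 - 1 / (1 + ?z) \<le> 2 * acc n" using acc_closed[of n] by linarith
  moreover have "1 - 1 / (1 + ?z) = 1 / (l / (95/100) + 1)" using l_pos by (simp add: field_simps)
  moreover have "1 / (4 * (l / (95/100) + 1)) = 1 / (l / (95/100) + 1) / 4" by simp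
  moreover have "x / 4 \<le> y / 2" if "x \<le> 2 * y" for x y :: real using that by simp
  ultimately have A: "1 / (4 * (l / (95/100) + 1)) \<le> acc n / 2" by metis
  have "f T / (4 * (l / (95/100) + 1)) \<le> acc n / 2 * f T"
    using mult_right_mono[OF A, of "f T"] f0 by simp
  also have "... = acc n / 2 * f {} + acc n * ((f T - f {}) / 2)" by (simp add: field_simps)
  also have "... \<le> f {} + acc n * ((f T - f {}) / 2)"
    using acc_le[of n] f0(1) acc_nonneg[of n] by (intro add_right_mono mult_left_le_one_le) auto
  finally show ?thesis using v2 by linarith
qed

end

section \<open>Choice of the parameters\<close>

lemma one_plus_power_le_exp: "(1 + b / (2 * n)) ^ n \<le> exp (real b / 2)" if "0 < n" for n b :: nat
proof -
  have "(1 + b / (2 * n)) ^ n \<le> exp (b / (2 * real n)) ^ n"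
    by (intro power_mono) (use exp_ge_add_one_self in auto)
  also have "... = exp (real b / 2)"
    unfolding exp_of_nat_mult[symmetric] using that by simp
  finally show ?thesis .
qed

lemma exp_1_bounds: "271/100 \<le> exp (1::real)" "exp (1::real) \<le> 272/100"
  using e_approx_32 e_less_272 by (auto simp: abs_le_iff abs_mult[symmetric] abs_if split: if_splits)

lemma exp_half_bounds: "1648/1000 \<le> exp (1/2::real)" "exp (1/2::real) \<le> 165/100"
proof -
  have e: "(exp (1/2::real))\<^sup>2 = exp 1" by (simp add: exp_double[symmetric])
  have "(1648/1000)\<^sup>2 \<le> (exp (1/2::real))\<^sup>2" unfolding e using e_approx_32
    by (auto simp: abs_if power2_eq_square split: if_splits)
  then show "1648/1000 \<le> exp (1/2::real)" by (rule power2_le_imp_le) simp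
  have "(exp (1/2::real))\<^sup>2 \<le> (165/100)\<^sup>2" unfolding e using exp_1_bounds(2) by (simp add: power2_eq_square)
  then show "exp (1/2::real) \<le> 165/100" by (rule power2_le_imp_le) simp
qed

lemma power_le_Ym:
  assumes "1 \<le> b" "0 \<le> l" shows "(1 + l) ^ b \<le> (real b + 1) * Ym l b"
proof -
  have "1 + l \<le> (b + 1) * (1 + l / (b + 1))" by (simp add: field_simps)
  then have "(1 + l) ^ (b - 1) * (1 + l) \<le> (1 + l) ^ (b - 1) * ((b + 1) * (1 + l / (b + 1)))"
    using assms by (intro mult_left_mono) auto
  moreover have "(1 + l) ^ (b - 1) * (1 + l) = (1 + l) ^ b"
    using assms by (metis One_nat_def Suc_pred less_eq_Suc_le mult.commute power_Suc)
  ultimately show ?thesis by (simp add: Ym_def algebra_simps)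
qed

text \<open>\<open>l\<close> is found by a search in steps of 1/64, so either it is the initial
  value 1/2 or \<open>l - 1/64\<close> still violates the risk condition, which bounds
  \<open>l\<close> from above. The case \<open>b = 1\<close> is numerical; for larger
  \<open>b\<close> the \<open>b\<close>-th powers are compared.\<close>

lemma ratio_bound:
  fixes l :: real and b k n :: nat
  assumes b: "1 \<le> b" and k: "1 \<le> k" and n: "0 < n" and l: "1/2 \<le> l"
    and min: "l = 1/2 \<or> Ym (l - 1/64) b - 1 < 4 * k * ((1 + b / (2 * n)) ^ n - 1)"
  shows "l / (95/100) + 1 \<le> exp 1 * (exp 1 * b * k) powr (1 / b)"
proof -
  have bk: "1 \<le> real b * real k" using b k by (metis mult_le_mono nat_mult_1 of_nat_1 of_nat_le_iff of_nat_mult)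
  have base: "1 \<le> exp 1 * real b * real k"
    using mult_mono[of 1 "exp 1::real" 1 "real b * real k"] bk by (simp add: mult.assoc)
  show ?thesis
  proof (cases "l = 1/2")
    case True
    have "1 \<le> (exp 1 * real b * real k) powr (1 / b)" using base by (intro ge_one_powr_ge_zero) auto
    then have "271/100 * 1 \<le> exp 1 * (exp 1 * real b * real k) powr (1 / b)"
      using exp_1_bounds by (intro mult_mono) auto
    then show ?thesis using True by simp
  next
    case False
    define l' where "l' = l - 1/64"
    have l': "0 \<le> l'" using l by (simp add: l'_def)
    have "Ym l' b - 1 < 4 * k * ((1 + b / (2 * n)) ^ n - 1)" using min False by (simp add: l'_def)
    also have "... \<le> 4 * k * (exp (real b / 2) - 1)"
      using one_plus_power_le_exp[OF n, of b] by (intro mult_left_mono) auto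
    finally have Y: "Ym l' b - 1 < 4 * k * (exp (real b / 2) - 1)" .
    consider "b = 1" | "2 \<le> b" using b by linarith
    then show ?thesis
    proof cases
      case 1
      have "l' / 2 < 4 * k * (exp (1/2) - 1)" using Y 1 by (simp add: Ym_def)
      also have "... \<le> 4 * k * (65/100)" using exp_half_bounds by (intro mult_left_mono) auto
      finally have "l < 52/10 * k + 1/64" by (simp add: l'_def)
      define X where "X = (exp 1 * exp 1) * real k"
      note \<open>l < _\<close>
      moreover have "(271/100 * (271/100)) * k \<le> X"
        unfolding X_def using exp_1_bounds by (intro mult_right_mono mult_mono) auto
      moreover have "1 \<le> real k" using k by simp
      ultimately have "l / (95/100) + 1 \<le> X" by (simp add: field_simps)
      then show ?thesis using 1 base by (simp add: X_def mult.assoc)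
    next
      case 2
      let ?R = "exp 1 * (exp 1 * real b * real k) powr (1 / b)"
      \<comment> \<open>Accounts for the step 1/64 of the search and the loss 95/100 at once:
        \<open>l / (95/100) + 1 \<le> ?u * (1 + l')\<close>.\<close>
      let ?u = "(65/64) / (95/100) :: real"
      have Rb: "?R ^ b = exp b * (exp 1 * b * k)"
      proof -
        have "((exp 1 * real b * real k) powr (1 / b)) ^ b = exp 1 * b * k"
          using base b k by (subst powr_realpow[symmetric]) (auto simp: powr_powr)
        then show ?thesis by (simp add: power_mult_distrib exp_of_nat_mult[symmetric])
      qed
      have hb: "exp (1/2) ^ b = exp (real b / 2)" by (simp add: exp_of_nat_mult[symmetric])
      have "Ym l' b < 4 * k * exp (real b / 2)"
      proof -
        have "1 \<le> real k" using k by simp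
        then show ?thesis using Y by (simp add: algebra_simps)
      qed
      then have "(real b + 1) * Ym l' b \<le> (real b + 1) * (4 * k * exp (real b / 2))"
        by (intro mult_left_mono) auto
      then have 3: "(1 + l') ^ b \<le> (real b + 1) * (4 * k * exp (real b / 2))"
        using power_le_Ym[OF b l'] by linarith
      \<comment> \<open>The constant 154/100 divides the spare \<open>exp (1/2)\<close> per factor
        in two: its powers absorb \<open>4 * (b + 1) / (exp 1 * b)\<close>, and the rest still
        covers \<open>?u\<close>.\<close>
      have "4 * (real b + 1) \<le> 6 * real b" using 2 by simp
      also have "6 * real b \<le> (154/100)\<^sup>2 * (271/100) * b" by (simp add: power2_eq_square)
      also have "... \<le> (154/100) ^ b * exp 1 * b"
        using 2 exp_1_bounds by (intro mult_right_mono mult_mono power_increasing) auto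
      finally have 4: "4 * (real b + 1) \<le> (154/100) ^ b * exp 1 * b" .
      have "?u * (154/100) \<le> exp (1/2)" using exp_half_bounds by simp
      then have "(?u * (154/100)) ^ b \<le> exp (1/2) ^ b" by (intro power_mono) auto
      then have 5: "?u ^ b * (154/100) ^ b \<le> exp (real b / 2)" by (simp only: power_mult_distrib hb)
      have "(?u * (1 + l')) ^ b = ?u ^ b * (1 + l') ^ b" by (rule power_mult_distrib)
      also have "... \<le> ?u ^ b * ((real b + 1) * (4 * k * exp (real b / 2)))"
        using 3 by (intro mult_left_mono) auto
      also have "... = (4 * (real b + 1)) * (?u ^ b * k * exp (real b / 2))" by (simp add: algebra_simps)
      also have "... \<le> ((154/100) ^ b * exp 1 * b) * (?u ^ b * k * exp (real b / 2))"
        using 4 by (intro mult_right_mono) auto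
      also have "... = (?u ^ b * (154/100) ^ b) * (exp 1 * b * k * exp (real b / 2))"
        by (simp only: mult.assoc mult.commute mult.left_commute)
      also have "... \<le> exp (real b / 2) * (exp 1 * b * k * exp (real b / 2))"
        using 5 by (intro mult_right_mono) auto
      also have "... = ?R ^ b" unfolding Rb by (simp add: exp_add[symmetric] field_simps mult_exp_exp)
      finally have "?u * (1 + l') \<le> ?R"
        using b by (subst (asm) power_mono_iff) (use l' in auto)
      moreover have "l / (95/100) + 1 \<le> ?u * (1 + l')" using l' by (simp add: l'_def field_simps)
      ultimately show ?thesis by linarith
    qed
  qed
qed

text \<open>Makes the search for \<open>l\<close> end after polynomially many steps, since
  \<open>l = 16 * m\<close> always suffices. The loss \<open>b + 1\<close> of
  \<open>power_le_Ym\<close> and the inflation of the potential are each at most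
  \<open>2 ^ b\<close>.\<close>

lemma Ym_large:
  fixes b m kk n :: nat
  assumes b: "1 \<le> b" and m: "1 \<le> m" and kk: "kk \<le> m" and n: "0 < n"
  shows "4 * kk * ((1 + b / (2 * n)) ^ n - 1) \<le> Ym (16 * real m) b - 1"
proof -
  have c1: "1 \<le> (1 + b / (2 * n)) ^ n" by simp
  have m1: "1 \<le> real m" using m by simp
  have "exp (real b / 2) = exp (1/2) ^ b" by (simp add: exp_of_nat_mult[symmetric])
  also have "... \<le> 2 ^ b" using exp_half_bounds by (intro power_mono) auto
  finally have e: "(1 + b / (2 * n)) ^ n \<le> 2 ^ b" using one_plus_power_le_exp[OF n, of b] by linarith
  have "4 * kk * ((1 + b / (2 * n)) ^ n - 1) \<le> 4 * m * ((1 + b / (2 * n)) ^ n - 1)"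
    using kk c1 by (intro mult_right_mono) auto
  also have "... \<le> real (4 * m) * (2 ^ b - 1)" using e by (intro mult_left_mono) auto
  also have "... \<le> real (4 * m) * 2 ^ b - 1" using m1 by (simp add: algebra_simps)
  finally have 1: "4 * kk * ((1 + b / (2 * n)) ^ n - 1) \<le> real (4 * m) * 2 ^ b - 1" .
  have "(real b + 1) \<le> 2 ^ b"
  proof -
    have "b < 2 ^ b" by (rule less_exp)
    then have "Suc b \<le> 2 ^ b" by (rule Suc_leI)
    then have "real (Suc b) \<le> real (2 ^ b)" by (simp only: of_nat_le_iff)
    then show ?thesis by simp
  qed
  have "(4::real) ^ 1 \<le> 4 ^ b" using b by (intro power_increasing) auto
  moreover have "real m ^ 1 \<le> real m ^ b" using b m1 by (intro power_increasing) auto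
  ultimately have "4 * m \<le> (4 * real m) ^ b" by (simp add: power_mult_distrib mult_mono)
  then have "(2 ^ b * 2 ^ b) * real (4 * m) \<le> (2 ^ b * 2 ^ b) * (4 * real m) ^ b" by (intro mult_left_mono) auto
  also have "... = (2 * 2 * (4 * real m)) ^ b" by (simp only: power_mult_distrib)
  also have "... \<le> (1 + 16 * real m) ^ b"
    by (intro power_mono) auto
  also have "... \<le> (real b + 1) * Ym (16 * real m) b" by (rule power_le_Ym[OF b]) simp
  also have "... \<le> 2 ^ b * Ym (16 * real m) b"
    using \<open>real b + 1 \<le> 2 ^ b\<close> by (intro mult_right_mono) (auto simp: Ym_def)
  finally have "2 ^ b * (2 ^ b * real (4 * m)) \<le> 2 ^ b * Ym (16 * real m) b" by (simp only: mult.assoc)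
  then have "2 ^ b * real (4 * m) \<le> Ym (16 * real m) b" by (subst (asm) mult_le_cancel_left_pos) auto
  then have "real (4 * m) * 2 ^ b \<le> Ym (16 * real m) b" by (simp only: mult.commute)
  with 1 show ?thesis by linarith
qed

section \<open>Program logic\<close>

text \<open>Total correctness of a deterministic execution with a time bound, as a
  weakest-precondition style judgement about one start state.\<close>

definition hr :: "(nat set \<Rightarrow> real) \<Rightarrow> com \<Rightarrow> state \<Rightarrow> (state \<Rightarrow> bool) \<Rightarrow> nat \<Rightarrow> bool" where
  "hr f c st Q t \<longleftrightarrow> (\<exists>st'. dex f c st st' t \<and> Q st')"

lemma hr_conseq: "hr f c st Q t \<Longrightarrow> t \<le> t' \<Longrightarrow> (\<And>st'. Q st' \<Longrightarrow> agr (nwr c) (rwr c) st st' \<Longrightarrow> Q' st') \<Longrightarrow> hr f c st Q' t'"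
  unfolding hr_def using dex_mono dex_frame by blast

lemma hr_time: "hr f c st Q t \<Longrightarrow> t \<le> t' \<Longrightarrow> hr f c st Q t'"
  by (rule hr_conseq)

lemma hr_Skip: "Q st \<Longrightarrow> hr f Skip st Q 0"
  unfolding hr_def using dex_Skip by blast

lemma hr_NAssign:
  "Q (nupd x (nval d st) (nval e st) (nval a st) st) \<Longrightarrow> hr f (NAssign x d e a) st Q 1"
  unfolding hr_def using dex_NAssign by blast

lemma hr_RAssign:
  "Q (rupd x (nval d st) (nval e st) (rval a st) st) \<Longrightarrow> hr f (RAssign x d e a) st Q 1"
  unfolding hr_def using dex_RAssign by blast

lemma hr_Query:
  "Q (rupd y 0 0 (f {i. fst st x (nval d st) i \<noteq> 0}) st) \<Longrightarrow> hr f (Query y x d) st Q 1"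
  unfolding hr_def using dex_Query by blast

lemma hr_Seq: "hr f c1 st (\<lambda>st'. hr f c2 st' Q tc) ta \<Longrightarrow> hr f (Seq c1 c2) st Q (ta + tc + 1)"
  unfolding hr_def using dex_Seq by blast

lemma hr_Cond:
  assumes "bval b st \<Longrightarrow> hr f c1 st Q t" "\<not> bval b st \<Longrightarrow> hr f c2 st Q t'"
  shows "hr f (Cond b c1 c2) st Q (t + t' + 1)"
proof (cases "bval b st")
  case True
  then obtain st' where s: "dex f c1 st st' t" "Q st'" using assms unfolding hr_def by blast
  then have "dex f (Cond b c1 c2) st st' (Suc t)" by (intro dex_Cond) (simp add: True)
  then have "dex f (Cond b c1 c2) st st' (t + t' + 1)" by (rule dex_mono) simp
  with s show ?thesis unfolding hr_def by blast
next
  case False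
  then obtain st' where s: "dex f c2 st st' t'" "Q st'" using assms unfolding hr_def by blast
  then have "dex f (Cond b c1 c2) st st' (Suc t')" by (intro dex_Cond) (simp add: False)
  then have "dex f (Cond b c1 c2) st st' (t + t' + 1)" by (rule dex_mono) simp
  with s show ?thesis unfolding hr_def by blast
qed

lemma hr_While:
  assumes "I 0 st0"
    and "\<And>i st. I i st \<Longrightarrow> bval g st \<Longrightarrow> agr (nwr c) (rwr c) st0 st \<Longrightarrow> hr f c st (I (Suc i)) tb"
    and "\<And>i st. I i st \<Longrightarrow> bval g st \<Longrightarrow> agr (nwr c) (rwr c) st0 st \<Longrightarrow> i < N"
    and "\<And>i st. I i st \<Longrightarrow> \<not> bval g st \<Longrightarrow> agr (nwr c) (rwr c) st0 st \<Longrightarrow> Q st"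
  shows "hr f (While g c) st0 Q (N * (tb + 2) + 1)"
proof -
  have "\<exists>i st'. dex f (While g c) st0 st' (N * (tb + 2) + 1) \<and> I i st' \<and> \<not> bval g st'
           \<and> agr (nwr c) (rwr c) st0 st'"
    by (rule dex_While) (use assms(1-3) in \<open>auto simp: hr_def\<close>)
  then show ?thesis using assms(4) unfolding hr_def by blast
qed

lemma hr_FOR:
  assumes "j \<notin> nwr c"
    and "\<And>st. agr (insert j (nwr c)) (rwr c) st0 st \<Longrightarrow> nval e st = N"
    and "\<And>st. agr {j} {} st0 st \<Longrightarrow> I 0 st"
    and "\<And>i st a. I i st \<Longrightarrow> I i (nupd j 0 0 a st)"
    and "\<And>i st. I i st \<Longrightarrow> i < N \<Longrightarrow> fst st j 0 0 = i \<Longrightarrow>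
                 agr (insert j (nwr c)) (rwr c) st0 st \<Longrightarrow> hr f c st (I (Suc i)) tb"
    and "\<And>st. I N st \<Longrightarrow> agr (insert j (nwr c)) (rwr c) st0 st \<Longrightarrow> Q st"
  shows "hr f (FOR j e c) st0 Q (N * (tb + 4) + 3)"
proof -
  have "\<exists>st'. dex f (FOR j e c) st0 st' (N * (tb + 4) + 3) \<and> I N st' \<and> fst st' j 0 0 = N
           \<and> agr (insert j (nwr c)) (rwr c) st0 st'"
    by (rule dex_FOR) (use assms(1-5) in \<open>auto simp: hr_def\<close>)
  then show ?thesis using assms(6) unfolding hr_def by blast
qed

subsection \<open>Uniform sampling by coin flips\<close>

text \<open>The leading bit is split off, in the order in which the loop of \<open>flips\<close>
  produces the bits.\<close>

lemma uniform_split: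
  "pmf_of_set {..<(2::nat) ^ Suc d} =
     bind_pmf (pmf_of_set (UNIV :: bool set))
       (\<lambda>b. map_pmf (\<lambda>x. (if b then 2 ^ d else 0) + x) (pmf_of_set {..<2 ^ d}))"
proof (rule pmf_eqI)
  fix y :: nat
  have ne: "{..<(2::nat) ^ e} \<noteq> {}" for e by (auto simp: lessThan_empty_iff)
  have m: "map_pmf (\<lambda>x. c + x) (pmf_of_set {..<2 ^ d}) = pmf_of_set {c..<c + 2 ^ d}" for c :: nat
  proof -
    have "(\<lambda>x. c + x) ` {..<2 ^ d} = {c..<c + 2 ^ d}"
      using image_add_atLeastLessThan[of c 0 "2 ^ d"] by (simp add: lessThan_atLeast0 add.commute)
    then show ?thesis using ne by (subst map_pmf_of_set_inj) auto
  qed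
  show "pmf (pmf_of_set {..<(2::nat) ^ Suc d}) y = pmf (bind_pmf (pmf_of_set (UNIV :: bool set))
       (\<lambda>b. map_pmf (\<lambda>x. (if b then 2 ^ d else 0) + x) (pmf_of_set {..<2 ^ d}))) y"
    unfolding m pmf_bind using ne[of d] ne[of "Suc d"]
    by (subst integral_pmf_of_set) (auto simp: UNIV_bool indicator_def)
qed

definition flips :: com where
  "flips = Seq (nset ''r'' (NConst 0)) (Seq (nset ''pw'' (NConst 1))
     (While (nless (nv ''pw'') (nv ''P''))
       (Seq (Flip ''z'') (Seq (nset ''r'' (NAdd (NAdd (nv ''r'') (nv ''r'')) (nv ''z'')))
          (nset ''pw'' (NAdd (nv ''pw'') (nv ''pw'')))))))"

lemma nwr_flips [simp]: "nwr flips = {''r'', ''pw'', ''z''}" by (auto simp: flips_def)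
lemma rwr_flips [simp]: "rwr flips = {}" by (auto simp: flips_def)

lemma bs_flips:
  assumes P: "fst st ''P'' 0 0 = 2 ^ e"
  shows "\<exists>D. bs f flips st D (7 * e + 5) \<and> map_pmf (\<lambda>st. fst st ''r'' 0 0) D = pmf_of_set {..<2 ^ e}"
proof -
  let ?A = "\<lambda>st::state. fst st ''r'' 0 0"
  let ?body = "Seq (Flip ''z'') (Seq (nset ''r'' (NAdd (NAdd (nv ''r'') (nv ''r'')) (nv ''z'')))
          (nset ''pw'' (NAdd (nv ''pw'') (nv ''pw''))))"
  let ?g = "nless (nv ''pw'') (nv ''P'')"
  let ?I = "\<lambda>(i::nat) (st::state). fst st ''pw'' 0 0 = 2 ^ i \<and> fst st ''P'' 0 0 = (2 ^ e :: nat)"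
  let ?coin = "pmf_of_set (UNIV :: bool set)"
  let ?nx = "\<lambda>(i::nat) r::nat. map_pmf (\<lambda>b. 2 * r + (if b then 1 else 0)) ?coin"
  \<comment> \<open>After \<open>i\<close> bits the final number is uniform on the block of length
    \<open>2 ^ (e - i)\<close> that starts at \<open>r * 2 ^ (e - i)\<close>.\<close>
  let ?ch = "\<lambda>i r::nat. map_pmf (\<lambda>x. r * 2 ^ (e - i) + x) (pmf_of_set {..<2 ^ (e - i)})"
  define st1 where "st1 = nupd ''pw'' 0 0 1 (nupd ''r'' 0 0 0 st)"
  have "\<exists>D. bs f (While ?g ?body) st1 D ((e - 0) * (5 + 2) + 1) \<and> (\<forall>st'\<in>set_pmf D. ?I e st') \<and>
             map_pmf ?A D = ?ch 0 (?A st1)"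
  proof (rule bs_While_chain[where nx = ?nx and ch = ?ch and I = ?I and A = ?A and N = e and tb = 5])
    fix i and st :: state assume I: "?I i st" and i: "i < e"
    define h where "h b = nupd ''pw'' 0 0 (2 ^ Suc i) (nupd ''r'' 0 0 (2 * ?A st + (if b then 1 else 0))
       (nupd ''z'' 0 0 (if b then 1 else 0) st))" for b
    have g: "bval ?g st" using I i by (simp add: Suc_le_eq)
    have z: "bs f (Flip ''z'') st (map_pmf (\<lambda>b. nupd ''z'' 0 0 (if b then 1 else 0) st) ?coin) 1"
      by (rule bs_step1) (simp add: pmf.map_comp o_def)
    define E where "E = (\<lambda>st'. return_pmf (nupd ''pw'' 0 0 (2 ^ Suc i)
       (nupd ''r'' 0 0 (2 * fst st' ''r'' 0 0 + fst st' ''z'' 0 0) st')))"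
    have "bs f (Seq (nset ''r'' (NAdd (NAdd (nv ''r'') (nv ''r'')) (nv ''z'')))
          (nset ''pw'' (NAdd (nv ''pw'') (nv ''pw'')))) st' (E st') 3"
      if "st' \<in> set_pmf (map_pmf (\<lambda>b. nupd ''z'' 0 0 (if b then 1 else 0) st) ?coin)" for st'
    proof -
      have pw: "fst st' ''pw'' 0 0 = 2 ^ i" using that I by (auto simp: set_pmf_of_set)
      show ?thesis
        using dex_Seq[OF dex_NAssign[of f "''r''" "NConst 0" "NConst 0" "NAdd (NAdd (nv ''r'') (nv ''r'')) (nv ''z'')" st']
          dex_NAssign[of f "''pw''" "NConst 0" "NConst 0" "NAdd (nv ''pw'') (nv ''pw'')"]]
        by (simp add: dex_def E_def pw mult_2 eval_nat_numeral)
    qed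
    from bs_Seq[OF z this] have b: "bs f ?body st
       (bind_pmf (map_pmf (\<lambda>b. nupd ''z'' 0 0 (if b then 1 else 0) st) ?coin) E) 5" by simp
    have "bind_pmf (map_pmf (\<lambda>b. nupd ''z'' 0 0 (if b then 1 else 0) st) ?coin) E = map_pmf h ?coin"
      by (simp add: E_def h_def map_pmf_def bind_assoc_pmf bind_return_pmf)
    with b have "bs f ?body st (map_pmf h ?coin) 5" by simp
    moreover have "\<forall>st'\<in>set_pmf (map_pmf h ?coin). ?I (Suc i) st'" using I by (auto simp: h_def)
    moreover have "map_pmf ?A (map_pmf h ?coin) = ?nx i (?A st)" by (simp add: pmf.map_comp o_def h_def)
    ultimately show "bval ?g st \<and> (\<exists>D. bs f ?body st D 5 \<and> (\<forall>st'\<in>set_pmf D. ?I (Suc i) st') \<and>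
        map_pmf ?A D = ?nx i (?A st))" using g by blast
  next
    fix i r :: nat assume i: "i < e"
    then obtain d where d: "e - i = Suc d" "e - Suc i = d" by (metis Suc_diff_Suc)
    show "?ch i r = bind_pmf (?nx i r) (?ch (Suc i))"
      unfolding d uniform_split map_bind_pmf bind_map_pmf pmf.map_comp o_def
      by (intro bind_pmf_cong map_pmf_cong refl) (auto simp: algebra_simps)
  next
    fix S :: nat show "?ch e S = return_pmf S"
      by (simp add: lessThan_Suc pmf_of_set_singleton)
  qed (auto simp: st1_def P)
  then obtain D where D: "bs f (While ?g ?body) st1 D (7 * e + 1)"
      "map_pmf ?A D = pmf_of_set {..<2 ^ e}" by (auto simp: st1_def mult.commute)
  have "bs f (Seq (nset ''pw'' (NConst 1)) (While ?g ?body)) (nupd ''r'' 0 0 0 st)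
      (bind_pmf (return_pmf st1) (\<lambda>_. D)) (1 + (7 * e + 1) + 1)"
    by (rule bs_Seq) (use D dex_NAssign[of f "''pw''" "NConst 0" "NConst 0" "NConst 1"]
      in \<open>auto simp: dex_def st1_def\<close>)
  then have "bs f flips st (bind_pmf (return_pmf (nupd ''r'' 0 0 0 st)) (\<lambda>_. D)) (1 + (1 + (7 * e + 1) + 1) + 1)"
    unfolding flips_def
    by (intro bs_Seq) (use dex_NAssign[of f "''r''" "NConst 0" "NConst 0" "NConst 0"]
      in \<open>auto simp: dex_def bind_return_pmf\<close>)
  moreover have "1 + (1 + (7 * e + 1) + 1) + 1 = 7 * e + 5" by simp
  ultimately show ?thesis using D(2) by (metis bind_return_pmf)
qed

section \<open>The program: parameters\<close>

abbreviation r1 :: "vname \<Rightarrow> vname \<Rightarrow> rexp" where "r1 x j \<equiv> RArr x (NConst 0) (nv j)"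
abbreviation r2 :: "vname \<Rightarrow> vname \<Rightarrow> vname \<Rightarrow> rexp" where "r2 x i j \<equiv> RArr x (nv i) (nv j)"
abbreviation rc :: "nat \<Rightarrow> rexp" where "rc k \<equiv> RNat (NConst k)"
abbreviation rn :: "vname \<Rightarrow> rexp" where "rn x \<equiv> RNat (nv x)"

text \<open>If \<open>c j = 0\<close>, then all sizes in row \<open>j\<close> are 0 as well, and
  division by zero yields the correct normalised size 0.\<close>

definition mk_a :: com where
  "mk_a = FOR ''i'' (nv ''n'') (Seq
     (FOR ''j'' (nv ''m'') (RAssign ''a'' (nv ''i'') (nv ''j'') (RDiv (r2 ''s'' ''i'' ''j'') (r1 ''c'' ''j''))))
     (RAssign ''a'' (nv ''i'') (nv ''m'') (RDiv (rc 1) (rn ''n''))))"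

lemma wr_mk_a [simp]: "nwr mk_a = {''i'', ''j''}" "rwr mk_a = {''a''}" by (auto simp: mk_a_def)

lemma hr_mk_a:
  assumes [simp]: "fst st0 ''n'' 0 0 = n" "fst st0 ''m'' 0 0 = m"
  shows "hr f mk_a st0 (\<lambda>st. \<forall>i<n. (\<forall>j<m. snd st ''a'' i j = snd st0 ''s'' i j / snd st0 ''c'' 0 j)
            \<and> snd st ''a'' i m = 1 / n) (n * (m * 5 + 9) + 3)"
  unfolding mk_a_def
proof (rule hr_time, rule hr_FOR[where N = n and tb = "m * 5 + 5" and I = "\<lambda>i st. \<forall>i'<i. (\<forall>j<m. snd st ''a'' i' j = snd st0 ''s'' i' j / snd st0 ''c'' 0 j)
            \<and> snd st ''a'' i' m = 1 / n"], goal_cases)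
  case (5 i st)
  note ag = agrD[OF 5(4), simp] and [simp] = 5(3)
  show ?case
  proof (rule hr_time, rule hr_Seq[where tc = 1], rule hr_FOR[where N = m and tb = 1 and I = "\<lambda>j st'. (\<forall>i'<i. (\<forall>j<m. snd st' ''a'' i' j = snd st0 ''s'' i' j / snd st0 ''c'' 0 j)
            \<and> snd st' ''a'' i' m = 1 / n) \<and> (\<forall>j'<j. snd st' ''a'' i j' = snd st0 ''s'' i j' / snd st0 ''c'' 0 j')"], goal_cases)
    case (3 st')
    then show ?case using 5(1) by (simp add: agrD[OF 3])
  next
    case (5 j st')
    note [simp] = agrD[OF 5(4)] 5(3)
    show ?case by (rule hr_RAssign) (use 5(1,2) in \<open>auto simp: less_Suc_eq\<close>)
  next
    case (6 st')
    note [simp] = agrD[OF 6(2)]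
    show ?case by (rule hr_RAssign) (use 6(1) in \<open>auto simp: less_Suc_eq\<close>)
  qed (auto simp: agrD)
qed (auto simp: agrD)

text \<open>The number \<open>k\<close> is not bounded by the input length, but a column has at most
  \<open>m\<close> nonzero entries; the minimum keeps the search for \<open>l\<close>
  polynomial.\<close>

definition mk_kk :: com where
  "mk_kk = Cond (NLe (nv ''k'') (nv ''m'')) (nset ''kk'' (nv ''k'')) (nset ''kk'' (nv ''m''))"

lemma wr_mk_kk [simp]: "nwr mk_kk = {''kk''}" "rwr mk_kk = {}" by (auto simp: mk_kk_def)

lemma hr_mk_kk: "hr f mk_kk st (\<lambda>st'. fst st' ''kk'' 0 0 = min (fst st ''k'' 0 0) (fst st ''m'' 0 0)) 3"
  unfolding mk_kk_def
  by (rule hr_time, rule hr_Cond, rule hr_NAssign, simp, rule hr_NAssign, simp, simp)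

definition mk_mx :: com where
  "mk_mx = Seq (rset ''mx'' (rc 0)) (FOR ''i'' (nv ''n'') (FOR ''j'' (nv ''m'')
     (Cond (rless (rv ''mx'') (r2 ''a'' ''i'' ''j'')) (rset ''mx'' (r2 ''a'' ''i'' ''j'')) Skip)))"

lemma wr_mk_mx [simp]: "nwr mk_mx = {''i'', ''j''}" "rwr mk_mx = {''mx''}" by (auto simp: mk_mx_def)

lemma hr_mk_mx:
  assumes [simp]: "fst st0 ''n'' 0 0 = n" "fst st0 ''m'' 0 0 = m" and a: "snd st0 ''a'' = a"
  shows "hr f mk_mx st0 (\<lambda>st. (\<forall>i<n. \<forall>j<m. a i j \<le> snd st ''mx'' 0 0) \<and>
     (snd st ''mx'' 0 0 = 0 \<or> (\<exists>i<n. \<exists>j<m. a i j = snd st ''mx'' 0 0))) (n * (m * 6 + 7) + 5)"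
  unfolding mk_mx_def
proof (rule hr_time, rule hr_Seq, rule hr_RAssign, rule hr_FOR[where N = n and tb = "m * 6 + 3" and I = "\<lambda>i st. (\<forall>i'<i. \<forall>j<m. a i' j \<le> snd st ''mx'' 0 0) \<and>
     (snd st ''mx'' 0 0 = 0 \<or> (\<exists>i<n. \<exists>j<m. a i j = snd st ''mx'' 0 0))"], goal_cases)
  case (5 i st)
  note [simp] = agrD[OF 5(4)] 5(3)
  note i = 5(1,2)
  show ?case
  proof (rule hr_time, rule hr_FOR[where N = m and tb = 2 and I = "\<lambda>j st'. (\<forall>i'<i. \<forall>j<m. a i' j \<le> snd st' ''mx'' 0 0)
     \<and> (\<forall>j'<j. a i j' \<le> snd st' ''mx'' 0 0) \<and>
     (snd st' ''mx'' 0 0 = 0 \<or> (\<exists>i<n. \<exists>j<m. a i j = snd st' ''mx'' 0 0))"], goal_cases)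
    case (3 st')
    then show ?case using i by (simp add: agrD[OF 3])
  next
    case (5 j st')
    note [simp] = agrD[OF 5(4)] 5(3)
    show ?case
    proof (rule hr_time, rule hr_Cond[where t = 1 and t' = 0], rule hr_RAssign, goal_cases)
      case 1
      have "a i j > snd st' ''mx'' 0 0" using 1 by (simp add: a)
      moreover have "\<forall>i'<i. \<forall>j'<m. a i' j' \<le> a i j" "\<forall>j'<j. a i j' \<le> a i j"
        using 5(1) calculation by (meson less_imp_le order_trans)+
      ultimately show ?case using 5(2) i(2) by (auto simp: a less_Suc_eq)
    next
      case 2
      show ?case by (rule hr_Skip) (use 2 5(1,2) in \<open>auto simp: a less_Suc_eq\<close>)
    qed simp
  qed (auto simp: agrD less_Suc_eq)
qed (auto simp: agrD)

text \<open>The floor of the slack by counting. The cap at \<open>n\<close> is necessary for the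
  running time, as the slack can be arbitrarily large.\<close>

definition mk_b :: com where
  "mk_b = Seq (nset ''b'' (NConst 1))
     (While (BAnd (nless (nv ''b'') (nv ''n'')) (RLe (RMul (RNat (NAdd (nv ''b'') (NConst 1))) (rv ''mx'')) (rc 1)))
        (nset ''b'' (NAdd (nv ''b'') (NConst 1))))"

lemma wr_mk_b [simp]: "nwr mk_b = {''b''}" "rwr mk_b = {}" by (auto simp: mk_b_def)

lemma hr_mk_b:
  assumes [simp]: "fst st0 ''n'' 0 0 = n" "snd st0 ''mx'' 0 0 = mx" and "1 \<le> n" "mx \<le> 1"
  shows "hr f mk_b st0 (\<lambda>st. \<exists>b. fst st ''b'' 0 0 = b \<and> 1 \<le> b \<and> b \<le> n \<and> b * mx \<le> 1 \<and> (b = n \<or> 1 < (real b + 1) * mx))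
     (n * 3 + 3)"
  unfolding mk_b_def
proof (rule hr_time, rule hr_Seq, rule hr_NAssign, rule hr_While[where N = n and tb = 1 and
   I = "\<lambda>i st. fst st ''b'' 0 0 = Suc i \<and> Suc i \<le> n \<and> real (Suc i) * mx \<le> 1"], goal_cases)
  case (2 i st)
  note [simp] = agrD[OF 2(3)]
  show ?case by (rule hr_NAssign) (use 2(1,2) in \<open>auto simp: add.commute\<close>)
next
  case (4 i st)
  note [simp] = agrD[OF 4(3)]
  show ?case using 4(1,2) by (auto simp: not_le add.commute)
qed (use assms in \<open>auto simp: agrD\<close>)

definition mk_cc :: com where
  "mk_cc = Seq (rset ''cc'' (RAdd (rc 1) (RDiv (rn ''b'') (RMul (rc 2) (rn ''n'')))))
     (Seq (rset ''cn'' (rc 1)) (FOR ''i'' (nv ''n'') (rset ''cn'' (RMul (rv ''cn'') (rv ''cc'')))))"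

lemma wr_mk_cc [simp]: "nwr mk_cc = {''i''}" "rwr mk_cc = {''cc'', ''cn''}" by (auto simp: mk_cc_def)

lemma hr_mk_cc:
  assumes [simp]: "fst st0 ''n'' 0 0 = n" "fst st0 ''b'' 0 0 = b"
  shows "hr f mk_cc st0 (\<lambda>st. snd st ''cc'' 0 0 = 1 + b / (2 * n) \<and> snd st ''cn'' 0 0 = (1 + b / (2 * n)) ^ n) (n * 5 + 7)"
  unfolding mk_cc_def
proof (rule hr_time, rule hr_Seq, rule hr_RAssign, rule hr_Seq, rule hr_RAssign, rule hr_FOR[where N = n and tb = 1 and
   I = "\<lambda>i st. snd st ''cn'' 0 0 = (1 + b / (2 * n)) ^ i"], goal_cases)
  case (5 i st)
  note [simp] = agrD[OF 5(4)]
  show ?case by (rule hr_RAssign) (use 5(1) in simp)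
qed (auto simp: agrD)

definition mk_Ym :: com where
  "mk_Ym = Seq (rset ''la'' (RDiv (rn ''lh'') (rc 64)))
     (Seq (rset ''Ym'' (RAdd (rc 1) (RDiv (rv ''la'') (RAdd (rn ''b'') (rc 1)))))
     (FOR ''i'' (NSub (nv ''b'') (NConst 1)) (rset ''Ym'' (RMul (rv ''Ym'') (RAdd (rc 1) (rv ''la''))))))"

lemma wr_mk_Ym [simp]: "nwr mk_Ym = {''i''}" "rwr mk_Ym = {''la'', ''Ym''}" by (auto simp: mk_Ym_def)

lemma hr_mk_Ym:
  assumes [simp]: "fst st0 ''lh'' 0 0 = h" "fst st0 ''b'' 0 0 = b"
  shows "hr f mk_Ym st0 (\<lambda>st. snd st ''la'' 0 0 = h / 64 \<and> snd st ''Ym'' 0 0 = Ym (h / 64) b) (b * 5 + 7)"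
  unfolding mk_Ym_def
proof (rule hr_time, rule hr_Seq, rule hr_RAssign, rule hr_Seq, rule hr_RAssign, rule hr_FOR[where N = "b - 1" and tb = 1 and
   I = "\<lambda>i st. snd st ''Ym'' 0 0 = (1 + h / 64) ^ i * (1 + h / 64 / (b + 1))"], goal_cases)
  case (5 i st)
  note [simp] = agrD[OF 5(4)]
  show ?case by (rule hr_RAssign) (use 5(1) in simp)
qed (auto simp: agrD Ym_def)

definition mk_la :: com where
  "mk_la = Seq (nset ''lh'' (NConst 32)) (Seq mk_Ym
     (Seq (While (rless (RSub (rv ''Ym'') (rc 1)) (RMul (RMul (rc 4) (rn ''kk'')) (RSub (rv ''cn'') (rc 1))))
       (Seq (nset ''lh'' (NAdd (nv ''lh'') (NConst 1))) mk_Ym))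
     (rset ''th'' (RDiv (rc 1) (RSub (rv ''Ym'') (rc 1))))))"

lemma wr_mk_la [simp]: "nwr mk_la = {''i'', ''lh''}" "rwr mk_la = {''la'', ''Ym'', ''th''}" by (auto simp: mk_la_def)

lemma Ym_mono: "0 \<le> l \<Longrightarrow> l \<le> l' \<Longrightarrow> Ym l b \<le> Ym l' b"
  unfolding Ym_def by (intro mult_mono power_mono add_left_mono divide_right_mono) auto

text \<open>The failure of the previous candidate is kept in the invariant and returned, since
  \<open>ratio_bound\<close> needs it.\<close>

lemma hr_mk_la:
  fixes b kk m n :: nat
  assumes [simp]: "fst st0 ''b'' 0 0 = b" "fst st0 ''kk'' 0 0 = kk" "snd st0 ''cn'' 0 0 = (1 + b / (2 * n)) ^ n"
    and b: "1 \<le> b" "b \<le> n" and m: "1 \<le> m" "kk \<le> m"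
  shows "hr f mk_la st0 (\<lambda>st. \<exists>l::real. snd st ''la'' 0 0 = l \<and> snd st ''th'' 0 0 = 1 / (Ym l b - 1) \<and> 1 / 2 \<le> l \<and> l \<le> 16 * m \<and>
      4 * kk * ((1 + b / (2 * n)) ^ n - 1) \<le> Ym l b - 1 \<and>
      (l = 1/2 \<or> Ym (l - 1/64) b - 1 < 4 * kk * ((1 + b / (2 * n)) ^ n - 1)))
    (1024 * m * (b * 5 + 11) + b * 5 + 13)"
proof -
  let ?X = "4 * kk * ((1 + b / (2 * n)) ^ n - 1)"
  let ?I = "\<lambda>(i::nat) (st::state). fst st ''lh'' 0 0 = 32 + i \<and> snd st ''la'' 0 0 = (32 + real i) / 64 \<and>
     snd st ''Ym'' 0 0 = Ym ((32 + real i) / 64) b \<and> (i = 0 \<or> Ym ((31 + real i) / 64) b - 1 < ?X)"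
  have lim: "i < 1024 * m - 32" if "Ym ((32 + real i) / 64) b - 1 < ?X" for i
  proof (rule ccontr)
    assume "\<not> ?thesis"
    then have "1024 * m \<le> 32 + i" by simp
    then have "real (1024 * m) \<le> real (32 + i)" by (simp only: of_nat_le_iff)
    then have "16 * real m \<le> (32 + real i) / 64" by simp
    then have "Ym (16 * real m) b \<le> Ym ((32 + real i) / 64) b" by (intro Ym_mono) auto
    then show False using Ym_large[of b m kk n] that b m by simp
  qed
  show ?thesis
    unfolding mk_la_def
  proof (rule hr_time, rule hr_Seq, rule hr_NAssign, rule hr_Seq[where tc = "(1024 * m * (b * 5 + 11) + 1) + 1 + 1"], rule hr_conseq, rule hr_mk_Ym[where h = 32 and b = b], goal_cases)
    case (4 st)
    note [simp] = agrD[OF 4(2)]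
    show ?case
    proof (rule hr_time, rule hr_Seq[where tc = 1], rule hr_While[where N = "1024 * m" and tb = "b * 5 + 9" and I = ?I], goal_cases)
      case (2 i st')
      note [simp] = agrD[OF 2(3)]
      have lt: "Ym ((32 + i) / 64) b - 1 < ?X" using 2(1,2) by simp
      show ?case
      proof (rule hr_time, rule hr_Seq, rule hr_NAssign, rule hr_conseq, rule hr_mk_Ym[where h = "Suc (32 + i)" and b = b], goal_cases)
        case (4 st'')
        note [simp] = agrD[OF 4(2)]
        show ?case using 4(1) 2(1) lt by (auto simp: add.commute)
      qed (use 2(1) in auto)
    next
      case (3 i st')
      note [simp] = agrD[OF 3(3)]
      have lt: "Ym ((32 + i) / 64) b - 1 < ?X" using 3(1,2) by simp
      then show ?case using lim[of i] by simp
    next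
      case (4 i st')
      note [simp] = agrD[OF 4(3)]
      have ge: "?X \<le> Ym ((32 + i) / 64) b - 1" using 4(1,2) by simp
      have le: "(32 + real i) / 64 \<le> 16 * m"
      proof (cases i)
        case 0
        then show ?thesis using m by simp
      next
        case (Suc i')
        have "i' < 1024 * m - 32" by (rule lim) (use 4(1) Suc in \<open>simp add: algebra_simps\<close>)
        then have "32 + i \<le> 1024 * m" using Suc by simp
        then have "real (32 + i) \<le> real (1024 * m)" by (simp only: of_nat_le_iff)
        then show ?thesis by simp
      qed
      have "(32 + real i) / 64 = 1/2 \<or> Ym ((32 + real i) / 64 - 1/64) b - 1 < ?X"
      proof (cases i)
        case (Suc i')
        have "(32 + real i) / 64 - 1/64 = (31 + real i) / 64" by simp
        moreover have "Ym ((31 + real i) / 64) b - 1 < ?X" using 4(1) Suc by blast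
        ultimately show ?thesis by metis
      qed simp
      then show ?case using 4(1) ge le by (intro hr_RAssign exI[of _ "(32 + real i) / 64"]) auto
    qed (use 4(1) in auto)
  qed (auto simp: algebra_simps)
qed

text \<open>Doubling uses only addition. The upper bound on \<open>P\<close>, obtained from
  \<open>l \<le> 16 * m\<close>, later bounds the length of the sampled list.\<close>

definition mk_P :: com where
  "mk_P = Seq (nset ''P'' (NConst 1))
     (While (rless (rn ''P'') (RMul (RMul (RMul (rc 2) (rv ''la'')) (rn ''n'')) (RMul (rc 4096) (RAdd (rn ''m'') (rc 1)))))
        (nset ''P'' (NAdd (nv ''P'') (nv ''P''))))"

lemma wr_mk_P [simp]: "nwr mk_P = {''P''}" "rwr mk_P = {}" by (auto simp: mk_P_def)

lemma hr_mk_P: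
  fixes l :: real and m n :: nat
  assumes [simp]: "fst st0 ''n'' 0 0 = n" "fst st0 ''m'' 0 0 = m" "snd st0 ''la'' 0 0 = l"
    and l: "1 / 2 \<le> l" "l \<le> 16 * m" and n: "1 \<le> n"
  shows "hr f mk_P st0 (\<lambda>st. \<exists>e. fst st ''P'' 0 0 = 2 ^ e \<and> e \<le> 131072 * m * n * (m + 1) \<and> 2 ^ e \<le> 262144 * m * n * (m + 1) \<and>
      2 * l * n * (4096 * (m + 1)) \<le> 2 ^ e) (393216 * m * n * (m + 1) + 3)"
proof -
  let ?X = "2 * l * n * (4096 * (m + 1))"
  have m1: "1 \<le> m" using l by (cases m) auto
  have X: "?X \<le> real (131072 * m * n * (m + 1))"
  proof -
    have "l * (2 * n * (4096 * (m + 1))) \<le> (16 * real m) * real (2 * n * (4096 * (m + 1)))"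
      using l by (intro mult_right_mono) auto
    then show ?thesis by (simp add: algebra_simps)
  qed
  have lim: "2 ^ i < 131072 * m * n * (m + 1)" if "2 ^ i < ?X" for i :: nat
  proof -
    have "real (2 ^ i) < real (131072 * m * n * (m + 1))" using that X by simp
    then show ?thesis by (simp only: of_nat_less_iff)
  qed
  show ?thesis
    unfolding mk_P_def
  proof (rule hr_time, rule hr_Seq, rule hr_NAssign, rule hr_While[where N = "131072 * m * n * (m + 1)" and tb = 1 and
     I = "\<lambda>i st. fst st ''P'' 0 0 = 2 ^ i \<and> (i = 0 \<or> 2 ^ (i - 1) < ?X)"], goal_cases)
    case (2 i st)
    note [simp] = agrD[OF 2(3)]
    have "2 ^ i < ?X" using 2(1,2) by (simp add: not_le add.commute)
    then show ?case by (intro hr_NAssign) (use 2(1) in auto)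
  next
    case (3 i st)
    note [simp] = agrD[OF 3(3)]
    have "2 ^ i < ?X" using 3(1,2) by (simp add: not_le add.commute)
    then have "2 ^ i < 131072 * m * n * (m + 1)" by (rule lim)
    moreover have "i < 2 ^ i" by (rule less_exp)
    ultimately show ?case by linarith
  next
    case (4 i st)
    note [simp] = agrD[OF 4(3)]
    have "?X \<le> 2 ^ i" using 4(1,2) by (simp add: not_le add.commute)
    moreover have "i \<le> 131072 * m * n * (m + 1) \<and> 2 ^ i \<le> 262144 * m * n * (m + 1)"
    proof (cases i)
      case 0
      then show ?thesis using m1 n by (simp add: Suc_le_eq)
    next
      case (Suc i')
      have "2 ^ i' < 131072 * m * n * (m + 1)" using 4(1) Suc by (intro lim) auto
      moreover have "i' < 2 ^ i'" by (rule less_exp)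
      ultimately have "2 ^ i' < 131072 * m * n * (m + 1)" "i' < 131072 * m * n * (m + 1)" by linarith+
      then show ?thesis using Suc by auto
    qed
    ultimately show ?case using 4(1) by blast
  qed (auto simp: agrD)
qed

text \<open>\<open>K\<close> is taken as large as \<open>P\<close> permits, so rounding
  \<open>P\<close> up to a power of two costs nothing in \<open>eta\<close>. The threshold
  \<open>M\<close> is accumulated along the way, since there is no exponentiation.\<close>

definition mk_K :: com where
  "mk_K = Seq (nset ''K'' (NConst 1)) (Seq (rset ''M'' (rc 1))
     (While (RLe (RMul (RMul (RMul (rc 2) (rv ''la'')) (rn ''n'')) (RAdd (rn ''K'') (rc 1))) (rn ''P''))
        (Seq (nset ''K'' (NAdd (nv ''K'') (NConst 1))) (rset ''M'' (RDiv (RMul (rv ''M'') (rc 33)) (rc 32))))))"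

lemma wr_mk_K [simp]: "nwr mk_K = {''K''}" "rwr mk_K = {''M''}" by (auto simp: mk_K_def)

lemma hr_mk_K:
  fixes l :: real and m n P :: nat
  assumes [simp]: "fst st0 ''n'' 0 0 = n" "fst st0 ''P'' 0 0 = P" "snd st0 ''la'' 0 0 = l"
    and l: "1 / 2 \<le> l" and n: "1 \<le> n" and P: "2 * l * n * (4096 * (m + 1)) \<le> P"
  shows "hr f mk_K st0 (\<lambda>st. \<exists>K. snd st ''M'' 0 0 = (33/32) ^ (K - 1) \<and> 2 * l * n * K \<le> P \<and> P < 2 * l * n * (K + 1) \<and>
      4096 * (m + 1) \<le> K) (P * 5 + 5)"
proof -
  have ln: "1 \<le> 2 * l * n"
  proof -
    have "1 * 1 \<le> (2 * l) * real n" using l n by (intro mult_mono) auto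
    then show ?thesis by simp
  qed
  have mono: "2 * l * n * x \<le> 2 * l * n * y" if "x \<le> y" for x y :: real
    using that ln by (intro mult_left_mono) auto
  show ?thesis
    unfolding mk_K_def
  proof (rule hr_time, rule hr_Seq, rule hr_NAssign, rule hr_Seq, rule hr_RAssign, rule hr_While[where N = P and tb = 3 and
     I = "\<lambda>i st. fst st ''K'' 0 0 = Suc i \<and> snd st ''M'' 0 0 = (33/32) ^ i \<and> 2 * l * n * Suc i \<le> P"], goal_cases)
    case 1
    have "2 * l * n * 1 \<le> 2 * l * n * (4096 * (m + 1))" by (rule mono) simp
    then show ?case using P by simp
  next
    case (2 i st)
    note [simp] = agrD[OF 2(3)]
    show ?case
      by (rule hr_time, rule hr_Seq, rule hr_NAssign, rule hr_RAssign) (use 2(1,2) in \<open>auto simp: algebra_simps\<close>)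
  next
    case (3 i st)
    have "1 * real (Suc i) \<le> (2 * l * n) * real (Suc i)" using ln by (intro mult_right_mono) auto
    moreover from 3(1) have "2 * l * n * real (Suc i) \<le> P" by blast
    ultimately have "real (Suc i) \<le> real P" by (metis mult_1 order_trans)
    then show ?case by (simp only: of_nat_le_iff Suc_le_eq)
  next
    case (4 i st)
    note [simp] = agrD[OF 4(3)]
    have less: "P < 2 * l * n * (real (Suc i) + 1)" using 4(1,2) by (simp add: not_le)
    have "4096 * (m + 1) \<le> Suc i"
    proof (rule ccontr)
      assume "\<not> ?thesis"
      then have "Suc (Suc i) \<le> 4096 * (m + 1)" by simp
      then have "real (Suc (Suc i)) \<le> real (4096 * (m + 1))" by (simp only: of_nat_le_iff)
      then have "2 * l * n * (real (Suc i) + 1) \<le> 2 * l * n * (4096 * (m + 1))" by (intro mono) simp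
      then show False using P less by linarith
    qed
    then show ?case using 4(1) less by (intro exI[of _ "Suc i"]) (auto simp: add.commute)
  qed auto
qed

section \<open>The program: one round and the final pruning\<close>

lemma sum_Suc_if:
  "(\<Sum>x | x < Suc i \<and> Q x. g x) = (\<Sum>x | x < i \<and> Q x. g x) + (if Q i then g i else (0::real))"
proof -
  have "{x. x < Suc i \<and> Q x} = (if Q i then insert i {x. x < i \<and> Q x} else {x. x < i \<and> Q x})"
    by (auto simp: less_Suc_eq)
  then show ?thesis by simp
qed

lemma prod_Suc_if:
  "(\<Prod>x | x < Suc i \<and> Q x. g x) = (\<Prod>x | x < i \<and> Q x. g x) * (if Q i then g i else (1::real))"
proof -
  have "{x. x < Suc i \<and> Q x} = (if Q i then insert i {x. x < i \<and> Q x} else {x. x < i \<and> Q x})"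
    by (auto simp: less_Suc_eq)
  then show ?thesis by (simp add: mult.commute)
qed

abbreviation n1 :: "vname \<Rightarrow> vname \<Rightarrow> nexp" where "n1 x j \<equiv> NArr x (NConst 0) (nv j)"

definition mk_Y :: com where
  "mk_Y = FOR ''j'' (nv ''m'') (Seq (RAssign ''Y'' (NConst 0) (nv ''j'') (rc 1))
     (FOR ''i'' (nv ''n'') (Cond (NLe (NConst 1) (n1 ''R'' ''i''))
        (RAssign ''Y'' (NConst 0) (nv ''j'') (RMul (r1 ''Y'' ''j'')
           (RAdd (rc 1) (RMul (RMul (rv ''la'') (rn ''b'')) (r2 ''a'' ''i'' ''j''))))) Skip)))"

lemma wr_mk_Y [simp]: "nwr mk_Y = {''i'', ''j''}" "rwr mk_Y = {''Y''}" by (auto simp: mk_Y_def)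

definition supp :: "nat \<Rightarrow> state \<Rightarrow> nat set" where
  "supp n st = {i. i < n \<and> fst st ''R'' 0 i \<noteq> 0}"

lemma hr_mk_Y:
  assumes [simp]: "fst st0 ''n'' 0 0 = n" "fst st0 ''m'' 0 0 = m" "fst st0 ''b'' 0 0 = b" "snd st0 ''la'' 0 0 = l"
    and a: "snd st0 ''a'' = a"
  shows "hr f mk_Y st0 (\<lambda>st. \<forall>j<m. snd st ''Y'' 0 j = (\<Prod>i\<in>supp n st0. 1 + l * b * a i j)) (m * (n * 6 + 9) + 3)"
  unfolding mk_Y_def
proof (rule hr_time, rule hr_FOR[where N = m and tb = "n * 6 + 5" and
    I = "\<lambda>j st. \<forall>j'<j. snd st ''Y'' 0 j' = (\<Prod>i\<in>supp n st0. 1 + l * b * a i j')"], goal_cases)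
  case (5 j st)
  note [simp] = agrD[OF 5(4)] 5(3)
  note j = 5(1,2)
  show ?case
  proof (rule hr_time, rule hr_Seq, rule hr_RAssign, rule hr_FOR[where N = n and tb = 2 and
    I = "\<lambda>i st'. (\<forall>j'<j. snd st' ''Y'' 0 j' = (\<Prod>i\<in>supp n st0. 1 + l * b * a i j')) \<and>
       snd st' ''Y'' 0 j = (\<Prod>q | q < i \<and> fst st0 ''R'' 0 q \<noteq> 0. 1 + l * b * a q j)"], goal_cases)
    case (3 st')
    then show ?case using j by (auto simp: agrD[OF 3])
  next
    case (5 i st')
    note [simp] = agrD[OF 5(4)] 5(3)
    show ?case
    proof (rule hr_time, rule hr_Cond[where t = 1 and t' = 0], rule hr_RAssign, goal_cases)
      case 1
      then show ?case using 5(1) by (auto simp: a prod_Suc_if)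
    next
      case 2
      then show ?case using 5(1) by (intro hr_Skip) (auto simp: a prod_Suc_if)
    qed simp
  next
    case (6 st')
    then show ?case by (auto simp: less_Suc_eq supp_def)
  qed (auto simp: agrD)
qed (auto simp: agrD)

text \<open>Interface for evaluating the objective, so that the program is verified once for both
  problems. \<open>fo\<close> is the oracle of the machine and \<open>f\<close> the objective; they
  differ in the linear case, where \<open>f\<close> is computed from the array contents
  \<open>W\<close>. The write sets are fixed to make those of larger programs computable.\<close>

definition orc_ok :: "(nat set \<Rightarrow> real) \<Rightarrow> (nat set \<Rightarrow> real) \<Rightarrow> nat \<Rightarrow> (nat \<Rightarrow> nat \<Rightarrow> real) \<Rightarrow> com \<Rightarrow> bool" where
  "orc_ok fo f n W orc \<longleftrightarrow> nwr orc = {''u''} \<and> rwr orc = {''v''} \<and>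
     (\<forall>st. fst st ''n'' 0 0 = n \<longrightarrow> snd st ''w'' = W \<longrightarrow> (\<forall>i\<ge>n. fst st ''q'' 0 i = 0) \<longrightarrow>
        hr fo orc st (\<lambda>st'. snd st' ''v'' 0 0 = f {i. fst st ''q'' 0 i \<noteq> 0}) (n * 6 + 5))"

definition mk_p :: com where
  "mk_p = Seq (rset ''p'' (rc 0)) (FOR ''j'' (nv ''m'') (Cond (rless (rc 0) (r2 ''a'' ''i'' ''j''))
       (rset ''p'' (RAdd (rv ''p'') (RMul (rv ''th'') (RSub (RMul (r1 ''Y'' ''j'') (rv ''Cf'')) (rc 1))))) Skip))"

lemma wr_mk_p [simp]: "nwr mk_p = {''j''}" "rwr mk_p = {''p''}" by (auto simp: mk_p_def)

lemma hr_mk_p: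
  assumes [simp]: "fst st0 ''i'' 0 0 = i" "fst st0 ''m'' 0 0 = m" "snd st0 ''th'' 0 0 = th" "snd st0 ''Cf'' 0 0 = C"
    and a: "snd st0 ''a'' = a" and Y: "\<forall>j<m. snd st0 ''Y'' 0 j = Y j"
  shows "hr f mk_p st0 (\<lambda>st. snd st ''p'' 0 0 = (\<Sum>j | j < m \<and> 0 < a i j. th * (Y j * C - 1))) (m * 6 + 5)"
  unfolding mk_p_def
proof (rule hr_time, rule hr_Seq, rule hr_RAssign, rule hr_FOR[where N = m and tb = 2 and
    I = "\<lambda>j' st. snd st ''p'' 0 0 = (\<Sum>j | j < j' \<and> 0 < a i j. th * (Y j * C - 1))"], goal_cases)
  case (5 j st)
  note [simp] = agrD[OF 5(4)] 5(3)
  show ?case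
  proof (rule hr_time, rule hr_Cond[where t = 1 and t' = 0], rule hr_RAssign, goal_cases)
    case 1
    then show ?case using 5(1,2) Y by (auto simp: a sum_Suc_if)
  next
    case 2
    then show ?case using 5(1) by (intro hr_Skip) (auto simp: a sum_Suc_if)
  qed simp
qed (auto simp: agrD)

definition mk_wt :: "com \<Rightarrow> com" where
  "mk_wt orc = Seq (FOR ''i'' (nv ''n'') (NAssign ''q'' (NConst 0) (nv ''i'') (n1 ''R'' ''i''))) (Seq orc
     (Seq (rset ''fR'' (rv ''v'')) (FOR ''i'' (nv ''n'') (Seq mk_p
        (Seq (NAssign ''q'' (NConst 0) (nv ''i'') (NConst 1)) (Seq orc
        (Seq (NAssign ''q'' (NConst 0) (nv ''i'') (n1 ''R'' ''i''))
          (Cond (RLe (rv ''p'') (RDiv (rc 1) (rc 2)))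
             (RAssign ''wt'' (NConst 0) (nv ''i'') (RMul (RSub (rv ''v'') (rv ''fR'')) (RSub (rc 1) (rv ''p''))))
             (RAssign ''wt'' (NConst 0) (nv ''i'') (rc 0)))))))))) "

lemma wr_mk_wt [simp]:
  assumes "orc_ok fo f n W orc"
  shows "nwr (mk_wt orc) = {''i'', ''j'', ''q'', ''u''}" "rwr (mk_wt orc) = {''p'', ''v'', ''fR'', ''wt''}"
  using assms by (auto simp: mk_wt_def orc_ok_def)

lemma hr_mk_wt:
  assumes orc: "orc_ok fo f n W orc"
    and [simp]: "fst st0 ''n'' 0 0 = n" "fst st0 ''m'' 0 0 = m" "snd st0 ''th'' 0 0 = th" "snd st0 ''Cf'' 0 0 = C"
      "snd st0 ''w'' = W"
    and a: "snd st0 ''a'' = a" and Y: "\<forall>j<m. snd st0 ''Y'' 0 j = Y j"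
    and R: "\<forall>i\<ge>n. fst st0 ''R'' 0 i = 0" and q: "\<forall>i\<ge>n. fst st0 ''q'' 0 i = 0"
    and S: "S = supp n st0"
  defines "pf \<equiv> \<lambda>i. \<Sum>j | j < m \<and> 0 < a i j. th * (Y j * C - 1)"
  shows "hr fo (mk_wt orc) st0 (\<lambda>st. (\<forall>i<n. snd st ''wt'' 0 i = (if pf i \<le> 1/2 then (f (insert i S) - f S) * (1 - pf i) else 0))
      \<and> (\<forall>i\<ge>n. fst st ''q'' 0 i = 0)) (n * (n * 6 + m * 6 + 23) + n * 11 + 20)"
proof -
  have ow [simp]: "nwr orc = {''u''}" "rwr orc = {''v''}" using orc by (auto simp: orc_ok_def)
  have S': "S = {i. fst st0 ''R'' 0 i \<noteq> 0}" unfolding S supp_def using R by (auto simp: not_less[symmetric])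
  have call: "hr fo orc st (\<lambda>st'. snd st' ''v'' 0 0 = f {i. fst st ''q'' 0 i \<noteq> 0}) (n * 6 + 5)"
    if "fst st ''n'' 0 0 = n" "snd st ''w'' = W" "\<forall>i\<ge>n. fst st ''q'' 0 i = 0" for st
    using orc that unfolding orc_ok_def by blast
  show ?thesis
    unfolding mk_wt_def
  proof (rule hr_time, rule hr_Seq[where tc = "(n * 6 + 5) + (1 + (n * (n * 6 + m * 6 + 23) + 3) + 1) + 1"],
      rule hr_FOR[where N = n and tb = 1 and I = "\<lambda>i st. (\<forall>i'<i. fst st ''q'' 0 i' = fst st0 ''R'' 0 i') \<and> (\<forall>i\<ge>n. fst st ''q'' 0 i = 0)"], goal_cases)
    case (3 st)
    then show ?case using q by (simp add: agrD[OF 3])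
  next
    case (5 i st)
    note [simp] = agrD[OF 5(4)] 5(3)
    show ?case by (rule hr_NAssign) (use 5(1,2) in \<open>auto simp: less_Suc_eq\<close>)
  next
    case (6 st1)
    note [simp] = agrD[OF 6(2)]
    have q1: "fst st1 ''q'' 0 = fst st0 ''R'' 0" using 6(1) R by (auto simp: fun_eq_iff) (metis not_le)
    show ?case
    proof (rule hr_Seq[where tc = "1 + (n * (n * 6 + m * 6 + 23) + 3) + 1"], rule hr_conseq, rule call, goal_cases)
      case (5 st2)
      note [simp] = agrD[OF 5(2)]
      have v: "snd st2 ''v'' 0 0 = f S" using 5(1) by (simp add: q1 S')
      let ?I = "\<lambda>i st. (\<forall>i'<i. snd st ''wt'' 0 i' = (if pf i' \<le> 1/2 then (f (insert i' S) - f S) * (1 - pf i') else 0))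
         \<and> fst st ''q'' 0 = fst st0 ''R'' 0"
      show ?case
      proof (rule hr_Seq, rule hr_RAssign, rule hr_time, rule hr_FOR[where N = n and tb = "n * 6 + m * 6 + 19" and I = ?I], goal_cases)
        case (3 st)
        then show ?case using q1 by (simp add: agrD[OF 3])
      next
        case (4 i st b)
        then show ?case by simp
      next
        case (5 i st)
        note [simp] = agrD[OF 5(4)] 5(3)
        note I = 5(1) and i = 5(2)
        show ?case
        proof (rule hr_time, rule hr_Seq[where tc = "1 + ((n * 6 + 5) + (1 + 3 + 1) + 1) + 1"], rule hr_conseq,
            rule hr_mk_p[where i = i and m = m and th = th and C = C and a = a and Y = Y], goal_cases)
          case (8 st')
          note [simp] = agrD[OF 8(2)]
          note p = 8(1)
          show ?case
          proof (rule hr_Seq, rule hr_NAssign, rule hr_Seq[where tc = "1 + 3 + 1"], rule hr_conseq, rule call, goal_cases)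
            case (3)
            then show ?case using I R i by auto
          next
            case (5 st'')
            note [simp] = agrD[OF 5(2)]
            have "{x. ((fst st0 ''R'' 0)(i := 1)) x \<noteq> 0} = insert i S" by (auto simp: S')
            then have v': "snd st'' ''v'' 0 0 = f (insert i S)" using 5(1) I by (simp add: Collect_conv_if)
            have q'': "(fst st'' ''q'' 0)(i := fst st0 ''R'' 0 i) = fst st0 ''R'' 0" using I by (auto simp: fun_eq_iff)
            show ?case
            proof (rule hr_Seq, rule hr_NAssign, rule hr_time, rule hr_Cond[where t = 1 and t' = 1], rule hr_RAssign, goal_cases)
              case 1
              then show ?case using I v v' p q'' by (auto simp: less_Suc_eq pf_def)
            next
              case 2
              then show ?case using I v v' p q'' by (intro hr_RAssign) (auto simp: less_Suc_eq pf_def)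
            qed simp
          qed simp_all
        qed (use a Y in auto)
      next
        case (6 st)
        then show ?case using R by simp
      qed (auto simp: agrD)
    qed (use 6(1) in auto)
  qed (auto simp: agrD)
qed

definition mk_g :: com where
  "mk_g = FOR ''i'' (nv ''n'') (Seq (rset ''de'' (rc 0))
     (Seq (FOR ''j'' (NAdd (nv ''m'') (NConst 1)) (rset ''de'' (RAdd (rv ''de'') (RMul (r2 ''a'' ''i'' ''j'') (r1 ''y'' ''j'')))))
        (RAssign ''g'' (NConst 0) (nv ''i'') (RDiv (r1 ''wt'' ''i'') (rv ''de'')))))"

lemma wr_mk_g [simp]: "nwr mk_g = {''i'', ''j''}" "rwr mk_g = {''de'', ''g''}" by (auto simp: mk_g_def)

lemma hr_mk_g:
  assumes [simp]: "fst st0 ''n'' 0 0 = n" "fst st0 ''m'' 0 0 = m"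
    and a: "snd st0 ''a'' = a" and y: "\<forall>j<Suc m. snd st0 ''y'' 0 j = y j" and w: "\<forall>i<n. snd st0 ''wt'' 0 i = w i"
  shows "hr f mk_g st0 (\<lambda>st. \<forall>i<n. snd st ''g'' 0 i = mwq m a w y i) (n * (m * 5 + 16) + 3)"
  unfolding mk_g_def
proof (rule hr_time, rule hr_FOR[where N = n and tb = "m * 5 + 12" and
    I = "\<lambda>i st. \<forall>i'<i. snd st ''g'' 0 i' = mwq m a w y i'"], goal_cases)
  case (5 i st)
  note [simp] = agrD[OF 5(4)] 5(3)
  note i = 5(1,2)
  show ?case
  proof (rule hr_time, rule hr_Seq, rule hr_RAssign, rule hr_Seq[where tc = 1], rule hr_FOR[where N = "Suc m" and tb = 1 and
    I = "\<lambda>j st'. (\<forall>i'<i. snd st' ''g'' 0 i' = mwq m a w y i') \<and> snd st' ''de'' 0 0 = (\<Sum>j<j. a i j * y j)"], goal_cases)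
    case (3 st')
    then show ?case using i by (auto simp: agrD[OF 3])
  next
    case (5 j st')
    note [simp] = agrD[OF 5(4)] 5(3)
    show ?case by (rule hr_RAssign) (use 5(1,2) y in \<open>auto simp: a\<close>)
  next
    case (6 st')
    note [simp] = agrD[OF 6(2)]
    show ?case by (rule hr_RAssign) (use 6(1) i(2) w in \<open>auto simp: less_Suc_eq mwq_def\<close>)
  qed (auto simp: agrD)
qed (auto simp: agrD)

definition mk_bi :: com where
  "mk_bi = Seq (nset ''bi'' (NConst 0)) (FOR ''i'' (nv ''n'')
     (Cond (rless (r1 ''g'' ''bi'') (r1 ''g'' ''i'')) (nset ''bi'' (nv ''i'')) Skip))"

lemma wr_mk_bi [simp]: "nwr mk_bi = {''i'', ''bi''}" "rwr mk_bi = {}" by (auto simp: mk_bi_def)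

lemma amax_cong: "(\<And>i. i < n \<Longrightarrow> q i = q' i) \<Longrightarrow> amax q n = amax q' n"
proof (induction n)
  case (Suc n)
  have eq: "amax q n = amax q' n" using Suc by simp
  show ?case
  proof (cases n)
    case (Suc k)
    then have "amax q' n < Suc n" using amax_less[of n q'] by simp
    then show ?thesis using Suc.prems eq by simp
  qed (use Suc.prems in simp)
qed simp

lemma hr_mk_bi:
  assumes [simp]: "fst st0 ''n'' 0 0 = n"
  shows "hr f mk_bi st0 (\<lambda>st. fst st ''bi'' 0 0 = amax (snd st0 ''g'' 0) n) (n * 6 + 5)"
  unfolding mk_bi_def
proof (rule hr_time, rule hr_Seq, rule hr_NAssign, rule hr_FOR[where N = n and tb = 2 and
    I = "\<lambda>i st. fst st ''bi'' 0 0 = amax (snd st0 ''g'' 0) i"], goal_cases)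
  case (5 i st)
  note [simp] = agrD[OF 5(4)] 5(3)
  show ?case
  proof (rule hr_time, rule hr_Cond[where t = 1 and t' = 0], rule hr_NAssign, goal_cases)
    case 1
    then show ?case using 5(1) by simp
  next
    case 2
    then show ?case using 5(1) by (intro hr_Skip) simp
  qed simp
qed (auto simp: agrD)

definition mk_y :: com where
  "mk_y = Seq (rset ''D'' (rc 0)) (FOR ''j'' (NAdd (nv ''m'') (NConst 1))
     (Seq (RAssign ''y'' (NConst 0) (nv ''j'') (RMul (r1 ''y'' ''j'') (RAdd (rc 1) (RDiv (r2 ''a'' ''bi'' ''j'') (rc 32)))))
          (rset ''D'' (RAdd (rv ''D'') (r1 ''y'' ''j'')))))"

lemma wr_mk_y [simp]: "nwr mk_y = {''j''}" "rwr mk_y = {''y'', ''D''}" by (auto simp: mk_y_def)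

lemma hr_mk_y:
  assumes [simp]: "fst st0 ''m'' 0 0 = m" "fst st0 ''bi'' 0 0 = i"
    and a: "snd st0 ''a'' = a" and y: "\<forall>j<Suc m. snd st0 ''y'' 0 j = y j"
  shows "hr f mk_y st0 (\<lambda>st. (\<forall>j<Suc m. snd st ''y'' 0 j = y j * (1 + a i j / 32)) \<and>
      snd st ''D'' 0 0 = (\<Sum>j<Suc m. y j * (1 + a i j / 32))) (m * 7 + 12)"
  unfolding mk_y_def
proof (rule hr_time, rule hr_Seq, rule hr_RAssign, rule hr_FOR[where N = "Suc m" and tb = 3 and
    I = "\<lambda>j st. (\<forall>j'<j. snd st ''y'' 0 j' = y j' * (1 + a i j' / 32)) \<and>
      (\<forall>j'<Suc m. j \<le> j' \<longrightarrow> snd st ''y'' 0 j' = y j') \<and>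
      snd st ''D'' 0 0 = (\<Sum>j'<j. y j' * (1 + a i j' / 32))"], goal_cases)
  case (3 st)
  then show ?case using y by (auto simp: agrD[OF 3])
next
  case (5 j st)
  note [simp] = agrD[OF 5(4)] 5(3)
  have yj: "snd st ''y'' 0 j = y j" using 5(1,2) by blast
  show ?case
    by (rule hr_time, rule hr_Seq, rule hr_RAssign, rule hr_RAssign) (use 5(1,2) yj in \<open>auto simp: a less_Suc_eq\<close>)
qed (auto simp: agrD)

text \<open>The list of items is never stored; the iteration whose number is the sampled
  \<open>r\<close> leaves its item in \<open>pk\<close>. The pair of comparisons tests
  equality.\<close>

definition mw_body :: com where
  "mw_body = Seq mk_g (Seq mk_bi (Seq
     (Cond (BAnd (NLe (nv ''cnt'') (nv ''r'')) (NLe (nv ''r'') (nv ''cnt''))) (nset ''pk'' (nv ''bi'')) Skip)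
     (Seq mk_y (nset ''cnt'' (NAdd (nv ''cnt'') (NConst 1))))))"

lemma wr_mw_body [simp]:
  "nwr mw_body = {''i'', ''j'', ''bi'', ''pk'', ''cnt''}" "rwr mw_body = {''de'', ''g'', ''y'', ''D''}"
  by (auto simp: mw_body_def)

definition mw_inv :: "nat \<Rightarrow> nat \<Rightarrow> (nat \<Rightarrow> nat \<Rightarrow> real) \<Rightarrow> (nat \<Rightarrow> real) \<Rightarrow> nat \<Rightarrow> real \<Rightarrow> nat \<Rightarrow> state \<Rightarrow> bool" where
  "mw_inv n m a w r M cnt st \<longleftrightarrow> fst st ''cnt'' 0 0 = cnt \<and> (\<forall>j<Suc m. snd st ''y'' 0 j = mwy n m a w cnt j) \<and>
     snd st ''D'' 0 0 = mwD n m a w cnt \<and> fst st ''pk'' 0 0 = (if r < cnt then mwi n m a w r else n) \<and>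
     (\<forall>q<cnt. mwD n m a w q \<le> M)"

lemma hr_mw_body:
  assumes [simp]: "fst st0 ''n'' 0 0 = n" "fst st0 ''m'' 0 0 = m" "fst st0 ''r'' 0 0 = r"
    and a: "snd st0 ''a'' = a" and w: "\<forall>i<n. snd st0 ''wt'' 0 i = w i"
    and I: "mw_inv n m a w r M cnt st0" and D: "mwD n m a w cnt \<le> M"
  shows "hr f mw_body st0 (mw_inv n m a w r M (Suc cnt)) (n * (m * 5 + 22) + m * 7 + 27)"
  unfolding mw_body_def
proof (rule hr_time, rule hr_Seq[where tc = "(n * 6 + 5) + (2 + ((m * 7 + 12) + 1 + 1) + 1) + 1"], rule hr_conseq,
    rule hr_mk_g[where n = n and m = m and a = a and y = "mwy n m a w cnt" and w = w], goal_cases)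
  case (7 st1)
  note [simp] = agrD[OF 7(2)]
  have g: "amax (snd st1 ''g'' 0) n = mwi n m a w cnt"
    unfolding mwi_def by (rule amax_cong) (use 7(1) in simp)
  show ?case
  proof (rule hr_Seq[where tc = "2 + ((m * 7 + 12) + 1 + 1) + 1"], rule hr_conseq, rule hr_mk_bi[where n = n], goal_cases)
    case (3 st2)
    note [simp] = agrD[OF 3(2)]
    have bi: "fst st2 ''bi'' 0 0 = mwi n m a w cnt" using 3(1) g by simp
    have cnt: "fst st2 ''cnt'' 0 0 = cnt" using I by (simp add: mw_inv_def)
    show ?case
    proof (rule hr_Seq[where tc = "(m * 7 + 12) + 1 + 1"], rule hr_time, rule hr_conseq[where t' = 2 and
        Q = "\<lambda>st. fst st ''pk'' 0 0 = (if r < Suc cnt then mwi n m a w r else n)"], rule hr_Cond[where t = 1 and t' = 0], rule hr_NAssign, goal_cases)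
      case 1
      then show ?case using I bi by (auto simp: mw_inv_def)
    next
      case 2
      then show ?case using I by (intro hr_Skip) (auto simp: mw_inv_def)
    next
      case (4 st3)
      note [simp] = agrD[OF 4(2)]
      show ?case
      proof (rule hr_Seq[where tc = 1], rule hr_conseq, rule hr_mk_y[where m = m and i = "mwi n m a w cnt" and a = a and y = "mwy n m a w cnt"], goal_cases)
        case (6 st4)
        note [simp] = agrD[OF 6(2)]
        show ?case
          by (rule hr_NAssign)
            (use I D 4(1) 6(1) cnt in \<open>auto simp: mw_inv_def less_Suc_eq mwD_def mwi_def[symmetric]\<close>)
      qed (use a I bi in \<open>auto simp: mw_inv_def\<close>)
    qed auto
  qed auto
qed (use a w I in \<open>auto simp: mw_inv_def algebra_simps\<close>)

definition mk_mw :: com where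
  "mk_mw = Seq (FOR ''j'' (NAdd (nv ''m'') (NConst 1)) (RAssign ''y'' (NConst 0) (nv ''j'') (rc 1)))
     (Seq (rset ''D'' (RAdd (rn ''m'') (rc 1))) (Seq (nset ''cnt'' (NConst 0)) (Seq (nset ''pk'' (nv ''n''))
        (While (RLe (rv ''D'') (rv ''M'')) mw_body))))"

lemma wr_mk_mw [simp]:
  "nwr mk_mw = {''i'', ''j'', ''bi'', ''pk'', ''cnt''}" "rwr mk_mw = {''de'', ''g'', ''y'', ''D''}"
  by (auto simp: mk_mw_def)

text \<open>Termination is the iteration count of multiplicative weights. On exit all earlier totals
  are known to lie below the threshold, so the counter is the least index \<open>N\<close>;
  \<open>pk\<close> keeps its initial value \<open>n\<close> if \<open>r\<close> was not
  reached.\<close>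

lemma hr_mk_mw:
  assumes mw: "mwu n m a w"
    and [simp]: "fst st0 ''n'' 0 0 = n" "fst st0 ''m'' 0 0 = m" "fst st0 ''r'' 0 0 = r" "snd st0 ''M'' 0 0 = (33/32) ^ (K - 1)"
    and a: "snd st0 ''a'' = a" and w: "\<forall>i<n. snd st0 ''wt'' 0 i = w i"
    and K: "1 \<le> K" and B: "n * K \<le> B"
  defines "N \<equiv> LEAST r. (33/32) ^ (K - 1) < mwD n m a w r"
  shows "hr f mk_mw st0 (\<lambda>st. fst st ''pk'' 0 0 = (if r < N then mwi n m a w r else n))
      (B * (n * (m * 5 + 22) + m * 7 + 29) + m * 5 + 19)"
proof -
  let ?M = "(33/32::real) ^ (K - 1)"
  let ?tb = "n * (m * 5 + 22) + m * 7 + 27"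
  show ?thesis
    unfolding mk_mw_def
  proof (rule hr_time, rule hr_Seq[where tc = "1 + (1 + (1 + (B * (?tb + 2) + 1) + 1) + 1) + 1"],
      rule hr_FOR[where N = "Suc m" and tb = 1 and I = "\<lambda>j st. \<forall>j'<j. snd st ''y'' 0 j' = 1"], goal_cases)
    case (5 j st)
    note [simp] = agrD[OF 5(4)] 5(3)
    show ?case by (rule hr_RAssign) (use 5(1) in \<open>auto simp: less_Suc_eq\<close>)
  next
    case (6 st1)
    note [simp] = agrD[OF 6(2)]
    show ?case
    proof (rule hr_Seq, rule hr_RAssign, rule hr_Seq, rule hr_NAssign, rule hr_Seq, rule hr_NAssign,
        rule hr_While[where N = B and tb = ?tb and I = "mw_inv n m a w r ?M"], goal_cases)
      case 1
      then show ?case using 6(1) by (auto simp: mw_inv_def mwD_def)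
    next
      case (2 i st)
      note [simp] = agrD[OF 2(3)]
      show ?case
        by (rule hr_mw_body) (use 2(1,2) a w in \<open>auto simp: mw_inv_def\<close>)
    next
      case (3 i st)
      note [simp] = agrD[OF 3(3)]
      have "mwD n m a w i \<le> ?M" using 3(1,2) by (simp add: mw_inv_def)
      then have "mwD n m a w q \<le> ?M" if "q < Suc i" for q using that 3(1) by (auto simp: mw_inv_def less_Suc_eq)
      then have "Suc i \<le> n * K" by (rule mwu.count_le[OF mw _ K])
      then show ?case using B by simp
    next
      case (4 i st)
      note [simp] = agrD[OF 4(3)]
      have "?M < mwD n m a w i" using 4(1,2) by (simp add: mw_inv_def)
      moreover have "\<forall>q<i. mwD n m a w q \<le> ?M" using 4(1) by (simp add: mw_inv_def)
      ultimately have "N = i" unfolding N_def by (intro Least_equality) (auto simp: not_le[symmetric])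
      then show ?case using 4(1) by (simp add: mw_inv_def)
    qed
  qed (auto simp: agrD algebra_simps)
qed

text \<open>Dividing \<open>Cf\<close> by \<open>cc\<close> maintains the power of \<open>cc\<close>
  for the remaining rounds.\<close>

definition mk_R :: com where
  "mk_R = Seq (Cond (BAnd (nless (nv ''pk'') (nv ''n'')) (rless (rc 0) (r1 ''wt'' ''pk'')))
       (NAssign ''R'' (NConst 0) (nv ''pk'') (NConst 1)) Skip)
     (rset ''Cf'' (RDiv (rv ''Cf'') (rv ''cc'')))"

lemma wr_mk_R [simp]: "nwr mk_R = {''R''}" "rwr mk_R = {''Cf''}" by (auto simp: mk_R_def)

lemma hr_mk_R:
  assumes [simp]: "fst st0 ''n'' 0 0 = n" "fst st0 ''pk'' 0 0 = pk"
  shows "hr f mk_R st0 (\<lambda>st. supp n st = (if pk < n \<and> 0 < snd st0 ''wt'' 0 pk then insert pk (supp n st0) else supp n st0) \<and>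
     ((\<forall>i\<ge>n. fst st0 ''R'' 0 i = 0) \<longrightarrow> (\<forall>i\<ge>n. fst st ''R'' 0 i = 0)) \<and>
     ((\<forall>i. fst st0 ''R'' 0 i \<le> 1) \<longrightarrow> (\<forall>i. fst st ''R'' 0 i \<le> 1)) \<and>
     snd st ''Cf'' 0 0 = snd st0 ''Cf'' 0 0 / snd st0 ''cc'' 0 0) 4"
  unfolding mk_R_def
proof (rule hr_time, rule hr_Seq[where tc = 1], rule hr_Cond[where t = 1 and t' = 0], rule hr_NAssign, goal_cases)
  case 1
  then show ?case by (intro hr_RAssign) (auto simp: supp_def)
next
  case 2
  then show ?case by (intro hr_Skip hr_RAssign) (auto simp: supp_def)
qed simp

definition prune :: com where
  "prune = FOR ''i'' (nv ''n'') (Seq (NAssign ''x'' (NConst 0) (nv ''i'') (n1 ''R'' ''i''))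
     (FOR ''j'' (nv ''m'') (Cond (rless (rc 0) (r2 ''a'' ''i'' ''j''))
       (Seq (rset ''su'' (rc 0)) (Seq
         (FOR ''h'' (nv ''n'') (Cond (BAnd (NLe (NConst 1) (n1 ''R'' ''h'')) (RLe (r2 ''a'' ''i'' ''j'') (r2 ''a'' ''h'' ''j'')))
            (rset ''su'' (RAdd (rv ''su'') (r2 ''a'' ''h'' ''j''))) Skip))
         (Cond (RLe (rv ''su'') (rc 1)) Skip (NAssign ''x'' (NConst 0) (nv ''i'') (NConst 0)))))
       Skip)))"

lemma wr_prune [simp]: "nwr prune = {''i'', ''j'', ''h'', ''x''}" "rwr prune = {''su''}" by (auto simp: prune_def)

lemma hr_prune:
  assumes [simp]: "fst st0 ''n'' 0 0 = n" "fst st0 ''m'' 0 0 = m" and a: "snd st0 ''a'' = a"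
    and R: "\<forall>i. fst st0 ''R'' 0 i \<le> 1"
  defines "S \<equiv> supp n st0"
  shows "hr f prune st0 (\<lambda>st. \<forall>i<n. fst st ''x'' 0 i = (if i \<in> S \<and> (\<forall>j<m. 0 < a i j \<longrightarrow>
      (\<Sum>q | q \<in> S \<and> a i j \<le> a q j. a q j) \<le> 1) then 1 else 0)) (n * (m * (n * 6 + 14) + 9) + 3)"
proof -
  define ok where "ok i j \<longleftrightarrow> (0 < a i j \<longrightarrow> (\<Sum>q | q \<in> S \<and> a i j \<le> a q j. a q j) \<le> 1)" for i j
  let ?I = "\<lambda>i st. \<forall>i'<i. fst st ''x'' 0 i' = (if i' \<in> S \<and> (\<forall>j<m. ok i' j) then 1 else 0)"
  have "hr f prune st0 (?I n) (n * (m * (n * 6 + 14) + 9) + 3)"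
    unfolding prune_def
  proof (rule hr_time, rule hr_FOR[where N = n and tb = "m * (n * 6 + 14) + 5" and I = ?I], goal_cases)
    case (5 i st)
    note [simp] = agrD[OF 5(4)] 5(3)
    note i = 5(1,2)
    let ?J = "\<lambda>j st. ?I i st \<and> fst st ''x'' 0 i = (if i \<in> S \<and> (\<forall>j'<j. ok i j') then 1 else 0)"
    have Ri: "fst st0 ''R'' 0 i = (if i \<in> S then 1 else 0)"
      using i R[rule_format, of i] by (auto simp: S_def supp_def)
    show ?case
    proof (rule hr_time, rule hr_Seq, rule hr_NAssign, rule hr_FOR[where N = m and tb = "n * 6 + 10" and I = ?J], goal_cases)
      case (3 st')
      then show ?case using i Ri by (auto simp: agrD[OF 3])
    next
      case (5 j st')
      note [simp] = agrD[OF 5(4)] 5(3)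
      note j = 5(1,2)
      show ?case
      proof (rule hr_time, rule hr_Cond[where t = "1 + ((n * 6 + 3) + 2 + 1) + 1" and t' = 0], goal_cases)
        case 1
        then have pos: "0 < a i j" by (simp add: a)
        show ?case
        proof (rule hr_time, rule hr_Seq, rule hr_RAssign, rule hr_Seq[where tc = 2], rule hr_FOR[where N = n and tb = 2 and
           I = "\<lambda>h st'. ?J j st' \<and> snd st' ''su'' 0 0 = (\<Sum>q | q < h \<and> (fst st0 ''R'' 0 q \<noteq> 0 \<and> a i j \<le> a q j). a q j)"], goal_cases)
          case (3 st'')
          then show ?case using j by (auto simp: agrD[OF 3])
        next
          case (5 h st'')
          note [simp] = agrD[OF 5(4)] 5(3)
          show ?case
          proof (rule hr_time, rule hr_Cond[where t = 1 and t' = 0], rule hr_RAssign, goal_cases)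
            case 1
            then show ?case using 5(1) by (simp add: a sum_Suc_if)
          next
            case 2
            then show ?case using 5(1) by (intro hr_Skip) (auto simp: a sum_Suc_if)
          qed simp
        next
          case (6 st'')
          note [simp] = agrD[OF 6(2)]
          have "{q. q < n \<and> (fst st0 ''R'' 0 q \<noteq> 0 \<and> a i j \<le> a q j)} = {q. q \<in> S \<and> a i j \<le> a q j}"
            by (auto simp: S_def supp_def)
          then have su: "snd st'' ''su'' 0 0 \<le> 1 \<longleftrightarrow> ok i j" using 6(1) pos by (simp add: ok_def)
          show ?case
          proof (rule hr_time, rule hr_Cond[where t = 0 and t' = 1], goal_cases)
            case 1
            then show ?case using 6(1) su by (intro hr_Skip) (auto simp: less_Suc_eq)
          next
            case 2
            then have "\<not> ok i j" using su by simp
            then show ?case using 6(1) by (intro hr_NAssign) auto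
          qed simp
        qed (auto simp: agrD)
      next
        case 2
        then have "ok i j" by (simp add: a ok_def)
        then show ?case using j by (intro hr_Skip) (auto simp: less_Suc_eq)
      qed simp
    next
      case (6 st')
      then show ?case by (auto simp: less_Suc_eq)
    qed (auto simp: agrD)
  qed (auto simp: agrD)
  then show ?thesis unfolding ok_def .
qed

section \<open>The program: assembly\<close>

definition pr :: "(nat set \<Rightarrow> real) \<Rightarrow> com \<Rightarrow> state \<Rightarrow> (state pmf \<Rightarrow> bool) \<Rightarrow> nat \<Rightarrow> bool" where
  "pr f c st G t \<longleftrightarrow> (\<exists>D. bs f c st D t \<and> G D)"

lemma pr_time: "pr f c st G t \<Longrightarrow> t \<le> t' \<Longrightarrow> pr f c st G t'"
  unfolding pr_def using bs_mono by blast

lemma pr_hr: "hr f c st Q t \<Longrightarrow> (\<And>st'. Q st' \<Longrightarrow> agr (nwr c) (rwr c) st st' \<Longrightarrow> G (return_pmf st')) \<Longrightarrow> pr f c st G t"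
  unfolding pr_def hr_def using dex_frame by (fastforce simp: dex_def)

lemma pr_hr_Seq:
  assumes "hr f c1 st Q ta" "\<And>st'. Q st' \<Longrightarrow> agr (nwr c1) (rwr c1) st st' \<Longrightarrow> pr f c2 st' G tc"
  shows "pr f (Seq c1 c2) st G (ta + tc + 1)"
proof -
  obtain st' where s: "dex f c1 st st' ta" "Q st'" using assms(1) by (auto simp: hr_def)
  then obtain D where D: "bs f c2 st' D tc" "G D" using assms(2)[OF s(2) dex_frame[OF s(1)]] by (auto simp: pr_def)
  have "bs f (Seq c1 c2) st (bind_pmf (return_pmf st') (\<lambda>_. D)) (ta + tc + 1)"
    by (rule bs_Seq) (use s D in \<open>auto simp: dex_def\<close>)
  then show ?thesis using D unfolding pr_def by (auto simp: bind_return_pmf)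
qed

text \<open>A deterministic continuation pushes the distribution forward along a function
  \<open>g\<close>, chosen state by state.\<close>

lemma bs_hr_Seq:
  assumes b: "bs f c1 st D ta" and h: "\<And>st'. st' \<in> set_pmf D \<Longrightarrow> hr f c2 st' (Q st') tc"
  shows "\<exists>g. bs f (Seq c1 c2) st (map_pmf g D) (ta + tc + 1) \<and> (\<forall>st'\<in>set_pmf D. Q st' (g st') \<and> agr (nwr c2) (rwr c2) st' (g st'))"
proof -
  have "\<forall>st'. \<exists>st''. st' \<in> set_pmf D \<longrightarrow> dex f c2 st' st'' tc \<and> Q st' st''" using h unfolding hr_def by blast
  then obtain g where g: "\<And>st'. st' \<in> set_pmf D \<Longrightarrow> dex f c2 st' (g st') tc \<and> Q st' (g st')" by metis
  have "bs f (Seq c1 c2) st (bind_pmf D (\<lambda>st'. return_pmf (g st'))) (ta + tc + 1)"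
    by (rule bs_Seq[OF b]) (use g in \<open>auto simp: dex_def\<close>)
  then have "bs f (Seq c1 c2) st (map_pmf g D) (ta + tc + 1)" by (simp add: map_pmf_def)
  then show ?thesis using g dex_frame by blast
qed

definition round_det :: "com \<Rightarrow> com" where
  "round_det orc = Seq mk_Y (Seq (mk_wt orc) (Seq mk_mw mk_R))"

text \<open>The index is drawn before the list is known. As its law does not depend on the state,
  the order is immaterial, and the rest of the round is deterministic.\<close>

definition body :: "com \<Rightarrow> com" where
  "body orc = Seq flips (Seq (round_det orc) (nset ''t'' (NAdd (nv ''t'') (NConst 1))))"

definition main_loop :: "com \<Rightarrow> com" where
  "main_loop orc = Seq (nset ''t'' (NConst 0)) (Seq (rset ''Cf'' (rv ''cn''))
     (While (nless (nv ''t'') (nv ''n'')) (body orc)))"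

definition TB :: "nat \<Rightarrow> nat \<Rightarrow> nat" where "TB n m = 262144 * m * n * (m + 1)"

definition t_round :: "nat \<Rightarrow> nat \<Rightarrow> nat" where
  "t_round n m = (m * (n * 6 + 9) + 3) + ((n * (n * 6 + m * 6 + 23) + n * 11 + 20) +
     ((TB n m * (n * (m * 5 + 22) + m * 7 + 29) + m * 5 + 19) + 4 + 1) + 1) + 1"

definition t_body :: "nat \<Rightarrow> nat \<Rightarrow> nat" where
  "t_body n m = (7 * TB n m + 5) + (t_round n m + 1 + 1) + 1"

definition t_loop :: "nat \<Rightarrow> nat \<Rightarrow> nat" where
  "t_loop n m = 1 + (1 + (n * (t_body n m + 2) + 1) + 1) + 1"

section \<open>The main loop realises the process \<open>chain\<close>\<close>

context alg
begin

text \<open>That \<open>R\<close> and \<open>q\<close> vanish beyond \<open>n\<close> makes a query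
  see exactly the intended set; that \<open>R\<close> is at most 1 lets pruning copy its entries
  into a 0/1 vector.\<close>

definition ginv :: "(nat \<Rightarrow> nat \<Rightarrow> real) \<Rightarrow> nat \<Rightarrow> state \<Rightarrow> bool" where
  "ginv W tr st \<longleftrightarrow> fst st ''n'' 0 0 = n \<and> fst st ''m'' 0 0 = m \<and> fst st ''b'' 0 0 = b \<and> fst st ''P'' 0 0 = P \<and>
     snd st ''la'' 0 0 = l \<and> snd st ''th'' 0 0 = th \<and> snd st ''cc'' 0 0 = cc \<and> snd st ''M'' 0 0 = (33/32) ^ (K - 1) \<and>
     snd st ''a'' = a \<and> snd st ''w'' = W \<and> (\<forall>i\<ge>n. fst st ''R'' 0 i = 0) \<and> (\<forall>i. fst st ''R'' 0 i \<le> 1) \<and>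
     (\<forall>i\<ge>n. fst st ''q'' 0 i = 0) \<and> snd st ''Cf'' 0 0 = cc ^ tr"

lemma supp_subset: "supp n st \<subseteq> {..<n}" by (auto simp: supp_def)

lemma hr_round_det:
  assumes orc: "orc_ok fo f n W orc" and I: "ginv W (Suc tr) st" and PB: "P \<le> TB n m"
  shows "hr fo (round_det orc) st (\<lambda>st'. ginv W tr st' \<and> supp n st' = nxS (supp n st) (Suc tr) (fst st ''r'' 0 0)) (t_round n m)"
proof -
  let ?S = "supp n st" and ?r = "fst st ''r'' 0 0"
  let ?w = "wt ?S (Suc tr)"
  note S = supp_subset[of st]
  have [simp]: "fst st ''n'' 0 0 = n" "fst st ''m'' 0 0 = m" "fst st ''b'' 0 0 = b" "fst st ''P'' 0 0 = P"
     "snd st ''la'' 0 0 = l" "snd st ''th'' 0 0 = th" "snd st ''cc'' 0 0 = cc" "snd st ''M'' 0 0 = (33/32) ^ (K - 1)"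
     "snd st ''a'' = a" "snd st ''w'' = W" "snd st ''Cf'' 0 0 = cc ^ Suc tr"
    and R: "\<forall>i\<ge>n. fst st ''R'' 0 i = 0" "\<forall>i. fst st ''R'' 0 i \<le> 1" and q: "\<forall>i\<ge>n. fst st ''q'' 0 i = 0"
    using I by (auto simp: ginv_def)
  note ww = wr_mk_wt[OF orc]
  show ?thesis
    unfolding round_det_def t_round_def
  proof (rule hr_Seq, rule hr_conseq, rule hr_mk_Y[where n = n and m = m and b = b and l = l and a = a], goal_cases)
    case (7 st1)
    note [simp] = agrD[OF 7(2)]
    have Y1: "\<forall>j<m. snd st1 ''Y'' 0 j = Y ?S j" using 7(1) by (simp add: Y_def)
    have s1: "supp n st1 = ?S" by (simp add: supp_def)
    show ?case
    proof (rule hr_Seq, rule hr_conseq, rule hr_mk_wt[OF orc, where m = m and th = th and C = "cc ^ Suc tr" and a = a and Y = "Y ?S" and S = ?S], goal_cases)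
      case (12 st2)
      note [simp] = agrD[OF 12(2), unfolded ww]
      have w2: "\<forall>i<n. snd st2 ''wt'' 0 i = ?w i" using 12(1) by (simp add: wt_def pp_def)
      have s2: "supp n st2 = ?S" by (simp add: supp_def)
      show ?case
      proof (rule hr_Seq, rule hr_conseq, rule hr_mk_mw[OF mwu[OF S, of "Suc tr"], where r = ?r and K = K and B = "TB n m"], goal_cases)
        case (10 st3)
        note [simp] = agrD[OF 10(2)]
        have s3: "supp n st3 = ?S" by (simp add: supp_def)
        define pk where "pk = (if ?r < NN ?S (Suc tr) then it ?S (Suc tr) ?r else n)"
        have pk: "fst st3 ''pk'' 0 0 = pk" using 10(1) by (simp add: pk_def NN_def it_def)
        have nx: "(if pk < n \<and> 0 < snd st3 ''wt'' 0 pk then insert pk ?S else ?S) = nxS ?S (Suc tr) ?r"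
          using w2 it_less[OF S] by (auto simp: pk_def nxS_def)
        show ?case
        proof (rule hr_conseq, rule hr_mk_R[where n = n and pk = pk], goal_cases)
          case (4 st4)
          note [simp] = agrD[OF 4(2)]
          have "snd st4 ''Cf'' 0 0 = cc ^ tr" using 4(1) cc_ge_1 by simp
          moreover have "supp n st4 = nxS ?S (Suc tr) ?r" using 4(1) unfolding s3 nx by blast
          moreover have "\<forall>i\<ge>n. fst st4 ''R'' 0 i = 0" "\<forall>i. fst st4 ''R'' 0 i \<le> 1" using 4(1) R by auto
          ultimately show ?case using 12(1) by (simp add: ginv_def)
        qed (use pk in auto)
      qed (use w2 K_ge_1 nK_le_P PB in auto)
    qed (use Y1 R q s1 in auto)
  qed auto
qed

lemma wr_round_det:
  assumes "orc_ok fo f n W orc"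
  shows "nwr (round_det orc) = {''i'', ''j'', ''q'', ''u'', ''bi'', ''pk'', ''cnt'', ''R''}"
  using wr_mk_wt[OF assms] by (auto simp: round_det_def)

lemma bs_body:
  assumes orc: "orc_ok fo f n W orc" and I: "ginv W (Suc tr) st" and t: "fst st ''t'' 0 0 = t"
    and PB: "P \<le> TB n m" and P: "P = 2 ^ e" and e: "e \<le> TB n m"
  shows "\<exists>D. bs fo (body orc) st D (t_body n m) \<and> (\<forall>st'\<in>set_pmf D. ginv W tr st' \<and> fst st' ''t'' 0 0 = Suc t) \<and>
     map_pmf (supp n) D = map_pmf (nxS (supp n st) (Suc tr)) (pmf_of_set {..<P})"
proof -
  have "fst st ''P'' 0 0 = P" using I by (simp add: ginv_def)
  also note P
  finally have Pe: "fst st ''P'' 0 0 = 2 ^ e" .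
  from bs_flips[OF Pe, of fo, folded P] obtain D where D: "bs fo flips st D (7 * e + 5)" "map_pmf (\<lambda>st. fst st ''r'' 0 0) D = pmf_of_set {..<P}"
    by blast
  let ?S = "supp n st"
  let ?c = "Seq (round_det orc) (nset ''t'' (NAdd (nv ''t'') (NConst 1)))"
  let ?Q = "\<lambda>st1 st'. ginv W tr st' \<and> fst st' ''t'' 0 0 = Suc t \<and> supp n st' = nxS ?S (Suc tr) (fst st1 ''r'' 0 0)"
  have h: "hr fo ?c st1 (?Q st1) (t_round n m + 1 + 1)" if "st1 \<in> set_pmf D" for st1
  proof -
    note [simp] = agrD[OF bs_frame[OF D(1) that]]
    have I1: "ginv W (Suc tr) st1" using I by (simp add: ginv_def)
    have s1: "supp n st1 = ?S" by (simp add: supp_def)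
    show ?thesis
    proof (rule hr_Seq, rule hr_conseq, rule hr_round_det[OF orc I1 PB], goal_cases)
      case (2 st2)
      note [simp] = agrD(1)[OF 2(2), unfolded wr_round_det[OF orc]]
      show ?case by (rule hr_NAssign) (use 2(1) t s1 in \<open>auto simp: ginv_def supp_def\<close>)
    qed simp
  qed
  from bs_hr_Seq[OF D(1) h] obtain g where g: "bs fo (body orc) st (map_pmf g D) (7 * e + 5 + (t_round n m + 1 + 1) + 1)"
      "\<And>st'. st' \<in> set_pmf D \<Longrightarrow> ?Q st' (g st')" unfolding body_def by blast
  have "bs fo (body orc) st (map_pmf g D) (t_body n m)"
    using g(1) by (rule bs_mono) (use e in \<open>simp add: t_body_def\<close>)
  moreover have "map_pmf (supp n) (map_pmf g D) = map_pmf (\<lambda>st'. nxS ?S (Suc tr) (fst st' ''r'' 0 0)) D"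
    unfolding pmf.map_comp o_def by (rule map_pmf_cong) (use g(2) in auto)
  moreover have "... = map_pmf (nxS ?S (Suc tr)) (pmf_of_set {..<P})"
    unfolding D(2)[symmetric] by (simp add: pmf.map_comp o_def)
  ultimately show ?thesis using g(2) by (intro exI[of _ "map_pmf g D"]) auto
qed

text \<open>\<open>Cf\<close> is initialised inside the loop command, hence the invariant is assumed
  for the start state with this entry already set.\<close>

lemma pr_main_loop:
  assumes orc: "orc_ok fo f n W orc" and I: "ginv W n (rupd ''Cf'' 0 0 (cc ^ n) st)" and cn: "snd st ''cn'' 0 0 = cc ^ n"
    and R: "supp n st = {}"
    and PB: "P \<le> TB n m" and P: "P = 2 ^ e" and e: "e \<le> TB n m"
  shows "pr fo (main_loop orc) st (\<lambda>D. (\<forall>st'\<in>set_pmf D. ginv W 0 st') \<and> map_pmf (supp n) D = chain n {}) (t_loop n m)"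
  unfolding main_loop_def t_loop_def
proof (rule pr_hr_Seq[where Q = "\<lambda>st1. st1 = nupd ''t'' 0 0 0 st"], rule hr_NAssign, simp,
    rule pr_hr_Seq[where Q = "\<lambda>st2. st2 = rupd ''Cf'' 0 0 (cc ^ n) (nupd ''t'' 0 0 0 st)"], rule hr_RAssign, simp add: cn, goal_cases)
  case (1 st1 st2)
  note st2 = 1(3)
  let ?I = "\<lambda>i st. ginv W (n - i) st \<and> fst st ''t'' 0 0 = i"
  have I2: "?I 0 st2" and s2: "supp n st2 = {}" using I R unfolding st2 by (auto simp: ginv_def supp_def)
  have "\<exists>D. bs fo (While (nless (nv ''t'') (nv ''n'')) (body orc)) st2 D ((n - 0) * (t_body n m + 2) + 1) \<and>
      (\<forall>st'\<in>set_pmf D. ?I n st') \<and> map_pmf (supp n) D = chain (n - 0) (supp n st2)"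
  proof (rule bs_While_chain[where I = ?I and ch = "\<lambda>i. chain (n - i)" and
      nx = "\<lambda>i S. map_pmf (nxS S (n - i)) (pmf_of_set {..<P})" and A = "supp n" and N = n and tb = "t_body n m"], goal_cases)
    case (1 i st)
    then have ni: "n - i = Suc (n - Suc i)" by simp
    have "ginv W (Suc (n - Suc i)) st" using 1(1) ni by simp
    from bs_body[OF orc this _ PB P e] 1 show ?case unfolding ni by (auto simp: ginv_def)
  next
    case (4 i S)
    then have ni: "n - i = Suc (n - Suc i)" by simp
    show ?case unfolding ni by simp
  qed (use I2 in \<open>auto simp: ginv_def\<close>)
  then show ?case unfolding pr_def s2 by auto
qed

end

section \<open>The complete program and its guarantee\<close>

definition core :: "com \<Rightarrow> com" where
  "core orc = Seq mk_cc (Seq mk_la (Seq mk_P (Seq mk_K (Seq (main_loop orc) prune))))"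

definition all_ones :: com where
  "all_ones = FOR ''i'' (nv ''n'') (NAssign ''x'' (NConst 0) (nv ''i'') (NConst 1))"

lemma hr_all_ones:
  assumes [simp]: "fst st0 ''n'' 0 0 = n"
  shows "hr f all_ones st0 (\<lambda>st. \<forall>i<n. fst st ''x'' 0 i = 1) (n * 5 + 3)"
  unfolding all_ones_def
proof (rule hr_time, rule hr_FOR[where N = n and tb = 1 and I = "\<lambda>i st. \<forall>i'<i. fst st ''x'' 0 i' = 1"], goal_cases)
  case (5 i st)
  note [simp] = agrD[OF 5(4)] 5(3)
  show ?case by (rule hr_NAssign) (use 5(1) in \<open>auto simp: less_Suc_eq\<close>)
qed (auto simp: agrD)

text \<open>If the count for the slack reaches \<open>n\<close>, every normalised size is at most
  \<open>1 / n\<close> and all items fit together. The other branch has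
  \<open>1 \<le> b < n\<close>, so there \<open>n\<close> is at least 2.\<close>

definition prog :: "com \<Rightarrow> com" where
  "prog orc = Seq mk_a (Seq mk_kk (Seq mk_mx (Seq mk_b (Cond (NLe (nv ''n'') (nv ''b'')) all_ones (core orc)))))"

definition t_core :: "nat \<Rightarrow> nat \<Rightarrow> nat" where
  "t_core n m = (n * 5 + 7) + ((1024 * m * (n * 5 + 11) + n * 5 + 13) + ((393216 * m * n * (m + 1) + 3) +
     ((TB n m * 5 + 5) + (t_loop n m + (n * (m * (n * 6 + 14) + 9) + 3) + 1) + 1) + 1) + 1) + 1"

definition t_prog :: "nat \<Rightarrow> nat \<Rightarrow> nat" where
  "t_prog n m = (n * (m * 5 + 9) + 3) + (3 + ((n * (m * 6 + 7) + 5) + ((n * 3 + 3) + ((n * 5 + 3) + t_core n m + 1) + 1) + 1) + 1) + 1"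

lemma pack_feas_iff:
  assumes pk: "packing_instance n m k c s" and a: "\<forall>i<n. \<forall>j<m. a i j = s i j / c j" and T: "T \<subseteq> {..<n}"
  shows "packing_feasible n m c s T \<longleftrightarrow> (\<forall>j<m. (\<Sum>i\<in>T. a i j) \<le> 1)"
proof -
  have "(\<Sum>i\<in>T. s i j) \<le> c j \<longleftrightarrow> (\<Sum>i\<in>T. a i j) \<le> 1" if j: "j < m" for j
  proof -
    have eq: "(\<Sum>i\<in>T. a i j) = (\<Sum>i\<in>T. s i j) / c j"
      unfolding sum_divide_distrib using a T j by (intro sum.cong) auto
    have "0 \<le> c j" using pk j by (simp add: packing_instance_def)
    then consider "c j = 0" | "0 < c j" by linarith
    then show ?thesis
    proof cases
      case 1
      have "s i j = 0" if "i \<in> T" for i using pk that T j 1 unfolding packing_instance_def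
        by (metis lessThan_iff order_antisym subsetD)
      then show ?thesis using 1 eq by simp
    qed (simp add: eq)
  qed
  then show ?thesis using T by (auto simp: packing_feasible_def)
qed

text \<open>The summand 0 is the error term of the theorem, kept so that its form matches
  literally.\<close>

definition rho :: "nat \<Rightarrow> real \<Rightarrow> real" where
  "rho k B = 4 * exp 1 * ((exp 1 + 0) * real_of_int \<lfloor>B\<rfloor> * real k) powr (1 / real_of_int \<lfloor>B\<rfloor>)"

lemma slack_properties:
  assumes pk: "packing_instance n m k c s" and a: "\<forall>i<n. \<forall>j<m. a i j = s i j / c j"
  shows "1 \<le> \<lfloor>slack n m c s\<rfloor>"
    and "\<lbrakk>\<forall>i<n. \<forall>j<m. b * a i j \<le> 1; \<exists>i<n. \<exists>j<m. 1 < (real b + 1) * a i j; 0 < b\<rbrakk> \<Longrightarrow> \<lfloor>slack n m c s\<rfloor> = int b"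
proof -
  let ?X = "{c j / s i j | i j. i < n \<and> j < m \<and> s i j > 0}"
  have "?X \<subseteq> (\<lambda>(i, j). c j / s i j) ` ({..<n} \<times> {..<m})" by auto
  then have fin: "finite ?X" by (rule finite_subset) simp
  have ne: "?X \<noteq> {}" using pk unfolding packing_instance_def by blast
  have cpos: "0 < c j" if "i < n" "j < m" "0 < s i j" for i j
    using pk that unfolding packing_instance_def by (meson less_le_trans)
  have "1 \<le> c j / s i j" if "i < n" "j < m" "0 < s i j" for i j
    using pk that unfolding packing_instance_def by (simp add: field_simps)
  then have "1 \<le> slack n m c s" unfolding slack_def using fin ne by (subst Min_ge_iff) auto
  then show "1 \<le> \<lfloor>slack n m c s\<rfloor>" by (simp add: le_floor_iff)
  assume b: "\<forall>i<n. \<forall>j<m. b * a i j \<le> 1" "\<exists>i<n. \<exists>j<m. 1 < (real b + 1) * a i j" "0 < b"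
  have "b \<le> c j / s i j" if ij: "i < n" "j < m" "0 < s i j" for i j
  proof -
    have "b * (s i j / c j) \<le> 1" using b(1) a ij by metis
    then show ?thesis using ij cpos[OF ij] by (simp add: field_simps)
  qed
  then have 1: "b \<le> slack n m c s" unfolding slack_def using fin ne by (subst Min_ge_iff) auto
  obtain i j where ij: "i < n" "j < m" "1 < (real b + 1) * a i j" using b(2) by blast
  have "0 \<le> s i j" "0 \<le> c j" using pk ij by (auto simp: packing_instance_def)
  moreover have "s i j \<noteq> 0" using ij a by auto
  ultimately have pos: "0 < s i j" by simp
  have "slack n m c s \<le> c j / s i j" unfolding slack_def using fin ij pos by (intro Min_le) auto
  also have "... < real b + 1" using ij a pos cpos[OF ij(1,2) pos] by (simp add: field_simps)
  finally show "\<lfloor>slack n m c s\<rfloor> = int b" using 1 by (intro floor_unique) auto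
qed

lemma rho_ge_1:
  assumes "1 \<le> k" "1 \<le> \<lfloor>B\<rfloor>" shows "1 \<le> rho k B"
proof -
  have "1 * 1 \<le> real_of_int \<lfloor>B\<rfloor> * real k" using assms by (intro mult_mono) auto
  then have "1 * 1 \<le> exp 1 * (real_of_int \<lfloor>B\<rfloor> * real k)" by (intro mult_mono) auto
  then have "1 \<le> ((exp 1 + 0) * real_of_int \<lfloor>B\<rfloor> * real k) powr (1 / real_of_int \<lfloor>B\<rfloor>)"
    using assms by (intro ge_one_powr_ge_zero) (auto simp: mult.assoc)
  then have "(4 * exp 1) * 1 \<le> rho k B" unfolding rho_def by (intro mult_left_mono) auto
  moreover have "(1::real) \<le> 4 * exp 1" using exp_1_bounds(1) by linarith
  ultimately show ?thesis by linarith
qed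

lemma pr_Cond:
  assumes "bval b st \<Longrightarrow> pr f c1 st G t" "\<not> bval b st \<Longrightarrow> pr f c2 st G t'"
  shows "pr f (Cond b c1 c2) st G (t + t' + 1)"
proof (cases "bval b st")
  case True
  then obtain D where D: "bs f c1 st D t" "G D" using assms by (auto simp: pr_def)
  then have "bs f (Cond b c1 c2) st D (Suc t)" by (intro bs_Cond) (simp add: True)
  then have "bs f (Cond b c1 c2) st D (t + t' + 1)" by (rule bs_mono) simp
  with D show ?thesis by (auto simp: pr_def)
next
  case False
  then obtain D where D: "bs f c2 st D t'" "G D" using assms by (auto simp: pr_def)
  then have "bs f (Cond b c1 c2) st D (Suc t')" by (intro bs_Cond) (simp add: False)
  then have "bs f (Cond b c1 c2) st D (t + t' + 1)" by (rule bs_mono) simp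
  with D show ?thesis by (auto simp: pr_def)
qed

text \<open>The comparison is with every feasible set instead of the optimum, which lets both
  problems insert their own optimal solution.\<close>

definition good :: "nat \<Rightarrow> nat \<Rightarrow> nat \<Rightarrow> (nat \<Rightarrow> real) \<Rightarrow> (nat \<Rightarrow> nat \<Rightarrow> real) \<Rightarrow> (nat set \<Rightarrow> real) \<Rightarrow> state pmf \<Rightarrow> bool" where
  "good n m k c s f D \<longleftrightarrow>
     (\<forall>st\<in>set_pmf D. (\<forall>i<n. fst st ''x'' 0 i \<le> 1) \<and> packing_feasible n m c s (output_set n st)) \<and>
     (\<forall>T. packing_feasible n m c s T \<longrightarrow>
        f T / rho k (slack n m c s) \<le> measure_pmf.expectation D (\<lambda>st. f (output_set n st)))"

lemma pr_core:
  assumes pk: "packing_instance n m k c s"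
    and f: "\<forall>A\<subseteq>{..<n}. 0 \<le> f A" "mono_on (Pow {..<n}) f" "submodular_on {..<n} f"
    and orc: "orc_ok fo f n W orc"
    and [simp]: "fst st0 ''n'' 0 0 = n" "fst st0 ''m'' 0 0 = m" "fst st0 ''kk'' 0 0 = min k m" "fst st0 ''b'' 0 0 = b"
      "snd st0 ''w'' = W" "snd st0 ''a'' = a"
    and a: "\<forall>i<n. \<forall>j<m. a i j = s i j / c j" "\<forall>i<n. a i m = 1 / n"
    and R: "fst st0 ''R'' 0 = (\<lambda>_. 0)" and q: "fst st0 ''q'' 0 = (\<lambda>_. 0)"
    and b: "1 \<le> b" "b < n" "\<forall>i<n. \<forall>j<m. b * a i j \<le> 1" "\<exists>i<n. \<exists>j<m. 1 < (real b + 1) * a i j"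
  shows "pr fo (core orc) st0 (good n m k c s f) (t_core n m)"
proof -
  have nm: "1 \<le> n" "1 \<le> m" "1 \<le> k" using pk by (auto simp: packing_instance_def)
  have fl: "\<lfloor>slack n m c s\<rfloor> = int b" using slack_properties(2)[OF pk a(1)] b by simp
  let ?kk = "min k m"
  show ?thesis
    unfolding core_def t_core_def
  proof (rule pr_hr_Seq, rule hr_mk_cc[where n = n and b = b], goal_cases)
    case (3 st1)
    note [simp] = agrD[OF 3(2)]
    note cn = 3(1)
    show ?case
    proof (rule pr_hr_Seq, rule hr_time[where t' = "1024 * m * (n * 5 + 11) + n * 5 + 13"], rule hr_mk_la[where b = b and kk = ?kk and m = m and n = n], goal_cases)
      case 8
      have "1024 * m * (b * 5 + 11) \<le> 1024 * m * (n * 5 + 11)" using b by (intro mult_le_mono) auto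
      then show ?case using b by linarith
    next
      case (9 st2)
      note [simp] = agrD[OF 9(2)]
      from 9(1) obtain l :: real where la [simp]: "snd st2 ''la'' 0 0 = l" and th: "snd st2 ''th'' 0 0 = 1 / (Ym l b - 1)"
        and l: "1 / 2 \<le> l" "l \<le> 16 * m" "4 * ?kk * ((1 + b / (2 * n)) ^ n - 1) \<le> Ym l b - 1"
          "l = 1/2 \<or> Ym (l - 1/64) b - 1 < 4 * ?kk * ((1 + b / (2 * n)) ^ n - 1)" by blast
      show ?case
      proof (rule pr_hr_Seq, rule hr_mk_P[where n = n and m = m and l = l], goal_cases)
        case (7 st3)
        note [simp] = agrD[OF 7(2)]
        from 7(1) obtain e where Pe: "fst st3 ''P'' 0 0 = 2 ^ e" "e \<le> 131072 * m * n * (m + 1)" "2 ^ e \<le> 262144 * m * n * (m + 1)"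
            "2 * l * n * (4096 * (m + 1)) \<le> 2 ^ e" by blast
        define P :: nat where "P = 2 ^ e"
        have P: "fst st3 ''P'' 0 0 = P" "P \<le> TB n m" "2 * l * n * (4096 * (m + 1)) \<le> P" "e \<le> TB n m"
          using Pe by (auto simp: P_def TB_def)
        show ?case
        proof (rule pr_hr_Seq, rule hr_time[where t' = "TB n m * 5 + 5"], rule hr_mk_K[where n = n and m = m and l = l and P = P], goal_cases)
          case (8 st4)
          note [simp] = agrD[OF 8(2)]
          from 8(1) obtain K where K: "snd st4 ''M'' 0 0 = (33/32) ^ (K - 1)" "2 * l * n * K \<le> P" "P < 2 * l * n * (K + 1)"
            "4096 * (m + 1) \<le> K" by blast
          have sc: "0 \<le> s i j" "0 \<le> c j" if "i < n" "j < m" for i j using pk that by (auto simp: packing_instance_def)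
          interpret alg n m ?kk b P K a l f
          proof (rule alg.intro)
            show "2 \<le> n" using b(1,2) by linarith
            show "1 \<le> b" "1/2 \<le> l" "4 * ?kk * ((1 + b / (2 * n)) ^ n - 1) \<le> Ym l b - 1" "2 * l * n * K \<le> P"
              "4096 * (m + 1) \<le> K" "mono_on (Pow {..<n}) f" "submodular_on {..<n} f" by fact+
            show "P < 2 * l * n * (K + 1)" using K(3) by (simp add: add.commute)
            show "0 < P" by (simp add: P_def)
            show "0 \<le> f A" if "A \<subseteq> {..<n}" for A using f(1) that by blast
          next
            fix i assume i: "i < n"
            have sub: "{j. j < m \<and> 0 < a i j} \<subseteq> {j. j < m \<and> s i j \<noteq> 0}" using a i by auto
            have "card {j. j < m \<and> 0 < a i j} \<le> card {j. j < m \<and> s i j \<noteq> 0}" by (rule card_mono[OF _ sub]) simp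
            moreover have "... \<le> k" using pk i by (simp add: packing_instance_def)
            moreover have "card {j. j < m \<and> 0 < a i j} \<le> card {..<m}" by (rule card_mono) auto
            ultimately show "card {j. j < m \<and> 0 < a i j} \<le> ?kk" by simp
            show "0 \<le> a i j" if "j < m" for j using a(1) i that sc by simp
            show "b * a i j \<le> 1" if "j < m" for j using b(3) i that by blast
            show "a i m = 1 / n" using a(2) i by blast
          qed
          have th4: "snd st4 ''th'' 0 0 = th" using th by (simp add: th_def)
          have cc4: "snd st4 ''cc'' 0 0 = cc" "snd st4 ''cn'' 0 0 = cc ^ n" using cn by (simp_all add: cc_def)
          have "pr fo (main_loop orc) st4 (\<lambda>D. (\<forall>st'\<in>set_pmf D. ginv W 0 st') \<and> map_pmf (supp n) D = chain n {}) (t_loop n m)"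
            by (rule pr_main_loop[OF orc _ _ _ P(2) P_def P(4)])
              (use P(1) K(1) th4 cc4 R q in \<open>auto simp: ginv_def supp_def\<close>)
          then obtain D where D: "bs fo (main_loop orc) st4 D (t_loop n m)" "\<And>st'. st' \<in> set_pmf D \<Longrightarrow> ginv W 0 st'"
              "map_pmf (supp n) D = chain n {}" unfolding pr_def by blast
          have h: "hr fo prune st' (\<lambda>st''. (\<forall>i<n. fst st'' ''x'' 0 i \<le> 1) \<and> output_set n st'' = keep (supp n st')) (n * (m * (n * 6 + 14) + 9) + 3)"
            if "st' \<in> set_pmf D" for st'
          proof (rule hr_conseq, rule hr_prune[where n = n and m = m and a = a], goal_cases)
            case (6 st'')
            have "\<forall>i<n. fst st'' ''x'' 0 i = (if i \<in> keep (supp n st') then 1 else 0)"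
              using 6(1) by (simp add: keep_def)
            moreover have "keep (supp n st') \<subseteq> {..<n}" using keep_subset supp_subset by blast
            ultimately show ?case by (auto simp: output_set_def split: if_splits)
          qed (use D(2)[OF that] in \<open>auto simp: ginv_def\<close>)
          from bs_hr_Seq[OF D(1) h] obtain g where g: "bs fo (Seq (main_loop orc) prune) st4 (map_pmf g D) (t_loop n m + (n * (m * (n * 6 + 14) + 9) + 3) + 1)"
            "\<And>st'. st' \<in> set_pmf D \<Longrightarrow> (\<forall>i<n. fst (g st') ''x'' 0 i \<le> 1) \<and> output_set n (g st') = keep (supp n st')" by blast
          have fe: "packing_feasible n m c s T \<longleftrightarrow> feas T" for T
            using pack_feas_iff[OF pk a(1), of T] by (auto simp: feas_def packing_feasible_def)
          have "good n m k c s f (map_pmf g D)"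
            unfolding good_def
          proof (intro conjI ballI allI impI)
            fix st assume "st \<in> set_pmf (map_pmf g D)"
            then obtain st' where "st' \<in> set_pmf D" "st = g st'" by auto
            with g(2) have *: "(\<forall>i<n. fst st ''x'' 0 i \<le> 1) \<and> output_set n st = keep (supp n st')" by blast
            show "fst st ''x'' 0 i \<le> 1" if "i < n" for i using * that by blast
            show "packing_feasible n m c s (output_set n st)" using * fe feas_keep[OF supp_subset] by simp
          next
            fix T assume T: "packing_feasible n m c s T"
            have "measure_pmf.expectation (map_pmf g D) (\<lambda>st. f (output_set n st)) = measure_pmf.expectation D (\<lambda>st'. f (keep (supp n st')))"
              unfolding integral_map_pmf by (intro integral_cong_AE) (auto simp: AE_measure_pmf_iff g(2))
            also have "... = measure_pmf.expectation (chain n {}) (\<lambda>A. f (keep A))"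
              unfolding D(3)[symmetric] integral_map_pmf ..
            also have "... \<ge> f T / (4 * (l / (95/100) + 1))" by (rule expected_value) (use T fe in simp)
            finally have E: "f T / (4 * (l / (95/100) + 1)) \<le> measure_pmf.expectation (map_pmf g D) (\<lambda>st. f (output_set n st))" .
            have "l / (95/100) + 1 \<le> exp 1 * (exp 1 * b * ?kk) powr (1 / b)"
              by (rule ratio_bound[where n = n]) (use b nm l in auto)
            \<comment> \<open>The program works with \<open>min k m\<close>; the ratio increases
              with the sparsity, so passing to \<open>k\<close> is harmless.\<close>
            also have "... \<le> exp 1 * (exp 1 * b * k) powr (1 / b)"
              by (intro mult_left_mono powr_mono2) auto
            finally have r: "4 * (l / (95/100) + 1) \<le> rho k (slack n m c s)"
              unfolding rho_def fl by simp
            have "0 < 4 * (l / (95/100) + 1)" using l by simp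
            then have "f T / rho k (slack n m c s) \<le> f T / (4 * (l / (95/100) + 1))"
              using r f(1) T by (intro divide_left_mono) (auto simp: packing_feasible_def)
            then show "f T / rho k (slack n m c s) \<le> measure_pmf.expectation (map_pmf g D) (\<lambda>st. f (output_set n st))"
              using E by linarith
          qed
          then show ?case using g(1) unfolding pr_def by blast
        qed (use P l nm in auto)
      qed (use l nm in auto)
    qed (use cn b nm in auto)
  qed auto
qed

lemma pr_prog:
  assumes pk: "packing_instance n m k c s"
    and f: "\<forall>A\<subseteq>{..<n}. 0 \<le> f A" "mono_on (Pow {..<n}) f" "submodular_on {..<n} f"
    and orc: "orc_ok fo f n W orc"
    and [simp]: "fst st0 ''n'' 0 0 = n" "fst st0 ''m'' 0 0 = m" "fst st0 ''k'' 0 0 = k" "snd st0 ''w'' = W"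
    and s: "\<forall>i<n. \<forall>j<m. snd st0 ''s'' i j = s i j" and c: "\<forall>j<m. snd st0 ''c'' 0 j = c j"
    and R: "fst st0 ''R'' 0 = (\<lambda>_. 0)" and q: "fst st0 ''q'' 0 = (\<lambda>_. 0)"
  shows "pr fo (prog orc) st0 (good n m k c s f) (t_prog n m)"
proof -
  have nm: "1 \<le> n" "1 \<le> m" "1 \<le> k" using pk by (auto simp: packing_instance_def)
  show ?thesis
    unfolding prog_def t_prog_def
  proof (rule pr_hr_Seq, rule hr_mk_a[where n = n and m = m], goal_cases)
    case (3 st1)
    note [simp] = agrD[OF 3(2)]
    define a where "a = snd st1 ''a''"
    have a: "\<forall>i<n. \<forall>j<m. a i j = s i j / c j" "\<forall>i<n. a i m = 1 / n" using 3(1) s c by (auto simp: a_def)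
    have a1: "a i j \<le> 1" if "i < n" "j < m" for i j
    proof -
      have "0 \<le> s i j" "s i j \<le> c j" using pk that by (auto simp: packing_instance_def)
      then show ?thesis using a that by (simp add: divide_le_eq)
    qed
    show ?case
    proof (rule pr_hr_Seq, rule hr_mk_kk, goal_cases)
      case (1 st2)
      note [simp] = agrD[OF 1(2)]
      note kk = 1(1)
      show ?case
      proof (rule pr_hr_Seq, rule hr_mk_mx[where n = n and m = m and a = a], goal_cases)
        case (4 st3)
        note [simp] = agrD[OF 4(2)]
        define mx where "mx = snd st3 ''mx'' 0 0"
        have mx: "\<forall>i<n. \<forall>j<m. a i j \<le> mx" "mx = 0 \<or> (\<exists>i<n. \<exists>j<m. a i j = mx)" using 4(1) by (auto simp: mx_def)
        show ?case
        proof (rule pr_hr_Seq, rule hr_mk_b[where n = n and mx = mx], goal_cases)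
          case 4
          then show ?case using mx(2) a1 by auto
        next
          case (5 st4)
          note [simp] = agrD[OF 5(2)]
          from 5(1) obtain b where b: "fst st4 ''b'' 0 0 = b" "1 \<le> b" "b \<le> n" "b * mx \<le> 1" "b = n \<or> 1 < (real b + 1) * mx" by blast
          have ba: "\<forall>i<n. \<forall>j<m. b * a i j \<le> 1"
          proof (intro allI impI)
            fix i j assume "i < n" "j < m"
            then have "b * a i j \<le> b * mx" using mx(1) by (intro mult_left_mono) auto
            then show "b * a i j \<le> 1" using b(4) by linarith
          qed
          show ?case
          proof (rule pr_Cond, goal_cases)
            case 1
            then have [simp]: "b = n" using b by simp
            have feas: "packing_feasible n m c s {..<n}"
            proof -
              have "(\<Sum>i<n. a i j) \<le> 1" if "j < m" for j
              proof -
                have "(\<Sum>i<n. a i j) \<le> (\<Sum>i<n. 1 / n)"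
                  by (rule sum_mono) (use ba that nm in \<open>auto simp: field_simps\<close>)
                then show ?thesis using nm by simp
              qed
              then show ?thesis using pack_feas_iff[OF pk a(1), of "{..<n}"] by simp
            qed
            show ?case
            proof (rule pr_hr, rule hr_all_ones[where n = n], goal_cases)
              case (2 st5)
              have o: "output_set n st5 = {..<n}" using 2(1) by (auto simp: output_set_def)
              have r: "1 \<le> rho k (slack n m c s)" by (rule rho_ge_1) (use nm slack_properties(1)[OF pk a(1)] in auto)
              have "f T / rho k (slack n m c s) \<le> f {..<n}" if T: "packing_feasible n m c s T" for T
              proof -
                have T': "T \<subseteq> {..<n}" using T by (simp add: packing_feasible_def)
                have "f T / rho k (slack n m c s) \<le> f T / 1"
                  using r f(1) T' by (intro divide_left_mono) auto
                also have "... \<le> f {..<n}" using mono_onD[OF f(2), of T "{..<n}"] T' by simp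
                finally show ?thesis .
              qed
              then show ?case using 2(1) o feas by (auto simp: good_def)
            qed simp
          next
            case 2
            then have "b < n" using b by simp
            then have "1 < (real b + 1) * mx" using b by simp
            moreover from this obtain i j where "i < n" "j < m" "a i j = mx" using mx(2) by auto
            ultimately have ex: "\<exists>i<n. \<exists>j<m. 1 < (real b + 1) * a i j" by auto
            show ?case
              by (rule pr_core[OF pk f orc, where b = b and a = a])
                (use kk b ba ex a R q \<open>b < n\<close> in \<open>auto simp: a_def\<close>)
          qed
        qed (use nm mx_def in auto)
      qed (auto simp: a_def)
    qed
  qed auto
qed

section \<open>Running time and the two problems\<close>

text \<open>Both \<open>n\<close> and \<open>m\<close> are at most \<open>n * m + n + m\<close>, so
  polynomial time reduces to closure under sums and products.\<close>

definition polyb :: "(nat \<Rightarrow> nat \<Rightarrow> nat) \<Rightarrow> bool" where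
  "polyb T \<longleftrightarrow> (\<exists>p :: nat poly. \<forall>n m. T n m \<le> poly p (n * m + n + m))"

lemma polyb_const: "polyb (\<lambda>n m. c)" unfolding polyb_def by (rule exI[of _ "[:c:]"]) simp
lemma polyb_n: "polyb (\<lambda>n m. n)" unfolding polyb_def by (rule exI[of _ "[:0, 1:]"]) simp
lemma polyb_m: "polyb (\<lambda>n m. m)" unfolding polyb_def by (rule exI[of _ "[:0, 1:]"]) simp

lemma polyb_add: "polyb S \<Longrightarrow> polyb T \<Longrightarrow> polyb (\<lambda>n m. S n m + T n m)"
  unfolding polyb_def by (metis add_mono poly_add)

lemma polyb_mult: "polyb S \<Longrightarrow> polyb T \<Longrightarrow> polyb (\<lambda>n m. S n m * T n m)"
  unfolding polyb_def by (metis mult_le_mono poly_mult)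

lemmas polyb_intros = polyb_const polyb_n polyb_m polyb_add polyb_mult

lemma polyb_t_prog: "polyb t_prog"
proof -
  have "polyb (\<lambda>n m. t_prog n m)"
    unfolding t_prog_def t_core_def t_loop_def t_body_def t_round_def TB_def by (intro polyb_intros)
  then show ?thesis by simp
qed

text \<open>The assignment to \<open>u\<close> is a dummy that gives this oracle the write sets
  required by \<open>orc_ok\<close>.\<close>

definition query_oracle :: com where
  "query_oracle = Seq (nset ''u'' (NConst 0)) (Query ''v'' ''q'' (NConst 0))"

lemma query_oracle_ok: "orc_ok f f n W query_oracle"
  unfolding orc_ok_def query_oracle_def
  by (auto intro!: hr_time[OF hr_Seq[OF hr_NAssign[OF hr_Query]]])

definition sum_oracle :: com where
  "sum_oracle = Seq (rset ''v'' (rc 0)) (FOR ''u'' (nv ''n'')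
     (Cond (NLe (NConst 1) (n1 ''q'' ''u'')) (rset ''v'' (RAdd (rv ''v'') (r1 ''w'' ''u''))) Skip))"

lemma sum_oracle_ok: "orc_ok fo (\<lambda>S. \<Sum>i\<in>S. W 0 i) n W sum_oracle"
  unfolding orc_ok_def
proof (intro conjI allI impI)
  fix st0 :: state
  assume [simp]: "fst st0 ''n'' 0 0 = n" and W: "snd st0 ''w'' = W" and q: "\<forall>i\<ge>n. fst st0 ''q'' 0 i = 0"
  have eq: "{i. i < n \<and> fst st0 ''q'' 0 i \<noteq> 0} = {i. fst st0 ''q'' 0 i \<noteq> 0}" using q by (metis not_le)
  show "hr fo sum_oracle st0 (\<lambda>st. snd st ''v'' 0 0 = (\<Sum>i\<in>{i. fst st0 ''q'' 0 i \<noteq> 0}. W 0 i)) (n * 6 + 5)"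
    unfolding sum_oracle_def eq[symmetric]
  proof (rule hr_time, rule hr_Seq, rule hr_RAssign, rule hr_FOR[where N = n and tb = 2 and
      I = "\<lambda>i st. snd st ''v'' 0 0 = (\<Sum>q | q < i \<and> fst st0 ''q'' 0 q \<noteq> 0. W 0 q)"], goal_cases)
    case (5 i st)
    note [simp] = agrD[OF 5(4)] 5(3)
    show ?case
    proof (rule hr_time, rule hr_Cond[where t = 1 and t' = 0], rule hr_RAssign, goal_cases)
      case 1
      then show ?case using 5(1) by (simp add: W sum_Suc_if)
    next
      case 2
      then show ?case using 5(1) by (intro hr_Skip) (simp add: sum_Suc_if)
    qed simp
  qed (auto simp: agrD)
qed (auto simp: sum_oracle_def)

lemma pr_prog_input:
  assumes pk: "packing_instance n m k c s"
    and f: "\<forall>A\<subseteq>{..<n}. 0 \<le> f A" "mono_on (Pow {..<n}) f" "submodular_on {..<n} f"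
    and orc: "orc_ok fo f n (snd (input_state n m k w c s) ''w'') orc"
    and t: "t_prog n m \<le> t"
  shows "halts_within fo t (prog orc) (input_state n m k w c s) \<and>
    good n m k c s f (final_states fo t (prog orc) (input_state n m k w c s))"
proof -
  have "pr fo (prog orc) (input_state n m k w c s) (good n m k c s f) (t_prog n m)"
    by (rule pr_prog[OF pk f orc]) (auto simp: input_state_def)
  then have "pr fo (prog orc) (input_state n m k w c s) (good n m k c s f) t" using t by (rule pr_time)
  then obtain D where D: "bs fo (prog orc) (input_state n m k w c s) D t" "good n m k c s f D"
    by (auto simp: pr_def)
  then show ?thesis using bs_halts bs_final by metis
qed

text \<open>Passing from 0/1 vectors to sets reduces the linear problem to the set formulation used
  throughout, and shows that the maximum is over a finite nonempty set.\<close>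

lemma pip_opt_attained:
  "\<exists>T. packing_feasible n m c s T \<and> pip_opt n m w c s = (\<Sum>i\<in>T. w i)" if pk: "packing_instance n m k c s"
proof -
  let ?X = "{\<Sum>i<n. w i * x i | x. pip_feasible n m c s x}"
  have sel: "(\<Sum>i<n. g i * x i) = (\<Sum>i | i < n \<and> x i = 1. g i)" if "\<forall>i<n. x i \<in> {0, 1}" for x g :: "nat \<Rightarrow> real"
  proof -
    have "(\<Sum>i<n. g i * x i) = (\<Sum>i\<in>{i. i < n \<and> x i = 1}. g i * x i)"
      by (rule sum.mono_neutral_right) (use that in auto)
    then show ?thesis by simp
  qed
  have "?X \<subseteq> (\<lambda>T. \<Sum>i\<in>T. w i) ` Pow {..<n}"
  proof
    fix v assume "v \<in> ?X"
    then obtain x where "v = (\<Sum>i<n. w i * x i)" "\<forall>i<n. x i \<in> {0, 1}" by (auto simp: pip_feasible_def)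
    then have "v = (\<Sum>i\<in>{i. i < n \<and> x i = 1}. w i)" using sel by simp
    moreover have "{i. i < n \<and> x i = 1} \<in> Pow {..<n}" by auto
    ultimately show "v \<in> (\<lambda>T. \<Sum>i\<in>T. w i) ` Pow {..<n}" by (rule image_eqI)
  qed
  then have fin: "finite ?X" by (rule finite_subset) simp
  have "pip_feasible n m c s (\<lambda>_. 0)" using pk by (auto simp: pip_feasible_def packing_instance_def)
  then have "?X \<noteq> {}" by blast
  then have "pip_opt n m w c s \<in> ?X" unfolding pip_opt_def using fin by (intro Max_in)
  then obtain x where x: "pip_feasible n m c s x" "pip_opt n m w c s = (\<Sum>i<n. w i * x i)" by blast
  have x01: "\<forall>i<n. x i \<in> {0, 1}" using x(1) by (simp add: pip_feasible_def)
  have "packing_feasible n m c s {i. i < n \<and> x i = 1}"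
    using x(1) sel[OF x01] by (auto simp: packing_feasible_def pip_feasible_def)
  then show ?thesis using x(2) sel[OF x01] by metis
qed

lemma submod_opt_attained:
  assumes pk: "packing_instance n m k c s"
  shows "\<exists>T. packing_feasible n m c s T \<and> submod_opt n m f c s = f T"
proof -
  have "{T. packing_feasible n m c s T} \<subseteq> Pow {..<n}" by (auto simp: packing_feasible_def)
  then have fin: "finite {T. packing_feasible n m c s T}" by (rule finite_subset) simp
  have "packing_feasible n m c s {}" using pk by (auto simp: packing_feasible_def packing_instance_def)
  then have "submod_opt n m f c s \<in> f ` {T. packing_feasible n m c s T}"
    unfolding submod_opt_def using fin by (intro Max_in) auto
  then show ?thesis by blast
qed

lemma sum_output_vector:
  assumes "\<forall>i<n. fst st ''x'' 0 i \<le> 1"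
  shows "(\<Sum>i<n. g i * output_vector st i) = (\<Sum>i\<in>output_set n st. g i)"
proof -
  have "(\<Sum>i<n. g i * output_vector st i) = (\<Sum>i\<in>output_set n st. g i * output_vector st i)"
    by (rule sum.mono_neutral_right) (auto simp: output_set_def output_vector_def)
  also have "... = (\<Sum>i\<in>output_set n st. g i)"
  proof (rule sum.cong)
    fix i assume "i \<in> output_set n st"
    then have "fst st ''x'' 0 i = 1" using assms by (force simp: output_set_def le_Suc_eq)
    then show "g i * output_vector st i = g i" by (simp add: output_vector_def)
  qed simp
  finally show ?thesis .
qed

lemma pip_approx: "pip_approx_algorithm (prog sum_oracle) rho"
proof -
  obtain p :: "nat poly" where p: "\<And>n m. t_prog n m \<le> poly p (n * m + n + m)"
    using polyb_t_prog unfolding polyb_def by blast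
  show ?thesis
    unfolding pip_approx_algorithm_def Let_def
  proof (intro exI[of _ p] allI impI, goal_cases)
    case (1 n m k w c s)
    then have pk: "packing_instance n m k c s" and w: "\<forall>i<n. 0 \<le> w i" by auto
    \<comment> \<open>The weights are read back from the input array, where they are extended by 0;
      \<open>f\<close> then agrees with what \<open>sum_oracle\<close> computes.\<close>
    define W where "W = snd (input_state n m k w c s) ''w''"
    define f where "f = (\<lambda>S. \<Sum>i\<in>S. W 0 i)"
    let ?t = "poly p (n * m + n + m)" and ?st = "input_state n m k w c s"
    let ?D = "final_states (\<lambda>_. 0) ?t (prog sum_oracle) ?st"
    have W: "W 0 i = (if i < n then w i else 0)" for i by (simp add: W_def input_state_def)
    have fw: "f S = (\<Sum>i\<in>S. w i)" if "S \<subseteq> {..<n}" for S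
      unfolding f_def by (rule sum.cong) (use that in \<open>auto simp: W\<close>)
    have W0: "0 \<le> W 0 i" for i using w by (simp add: W)
    have f1: "\<forall>A\<subseteq>{..<n}. 0 \<le> f A" unfolding f_def using W0 by (auto intro: sum_nonneg)
    have f2: "mono_on (Pow {..<n}) f"
    proof (rule mono_onI)
      fix A B assume "A \<in> Pow {..<n}" "B \<in> Pow {..<n}" "A \<subseteq> B"
      then show "f A \<le> f B" unfolding f_def using W0 by (intro sum_mono2) (auto intro: finite_subset)
    qed
    have f3: "submodular_on {..<n} f"
      unfolding submodular_on_def f_def by (auto simp: sum.union_inter finite_subset)
    have *: "halts_within (\<lambda>_. 0) ?t (prog sum_oracle) ?st \<and> good n m k c s f ?D"
      by (rule pr_prog_input[OF pk f1 f2 f3 _ p]) (simp add: f_def W_def[symmetric] sum_oracle_ok)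
    have x: "\<forall>i<n. fst st ''x'' 0 i \<le> 1" and fe: "packing_feasible n m c s (output_set n st)" if "st \<in> set_pmf ?D" for st
      using * that by (auto simp: good_def)
    have "pip_feasible n m c s (output_vector st)" if D: "st \<in> set_pmf ?D" for st
    proof -
      have "output_vector st i \<in> {0, 1}" if "i < n" for i
        using x[OF D] that by (force simp: output_vector_def le_Suc_eq)
      then show ?thesis using fe[OF D] sum_output_vector[OF x[OF D]]
        by (auto simp: pip_feasible_def packing_feasible_def)
    qed
    moreover have "pip_opt n m w c s / rho k (slack n m c s) \<le>
        measure_pmf.expectation ?D (\<lambda>st. \<Sum>i<n. w i * output_vector st i)"
    proof -
      obtain T where T: "packing_feasible n m c s T" "pip_opt n m w c s = (\<Sum>i\<in>T. w i)"
        using pip_opt_attained[OF pk] by blast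
      have "pip_opt n m w c s = f T" using T fw by (auto simp: packing_feasible_def)
      then have "pip_opt n m w c s / rho k (slack n m c s) \<le> measure_pmf.expectation ?D (\<lambda>st. f (output_set n st))"
        using * T(1) by (auto simp: good_def)
      also have "... = measure_pmf.expectation ?D (\<lambda>st. \<Sum>i<n. w i * output_vector st i)"
        by (intro integral_cong_AE)
          (auto simp: AE_measure_pmf_iff sum_output_vector[OF x] fw output_set_def subset_iff)
      finally show ?thesis .
    qed
    ultimately show ?case using * by blast
  qed
qed

text \<open>Since \<open>exp 1 - 1 \<le> exp 1\<close>, the ratio demanded in the submodular case is
  weaker than the common ratio \<open>rho\<close>.\<close>

lemma rho_le: "rho k B \<le> 4 * (exp 1)\<^sup>2 / (exp 1 - 1) * ((exp 1 + 0) * real_of_int \<lfloor>B\<rfloor> * real k) powr (1 / real_of_int \<lfloor>B\<rfloor>)"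
proof -
  have "exp 1 * (exp 1 - 1) \<le> (exp 1)\<^sup>2 * (1::real)" by (simp add: power2_eq_square algebra_simps)
  then have "4 * exp 1 \<le> 4 * (exp 1)\<^sup>2 / (exp 1 - 1 :: real)"
    by (simp add: le_divide_eq)
  then show ?thesis unfolding rho_def by (intro mult_right_mono) auto
qed

lemma submod_approx:
  "submod_approx_algorithm (prog query_oracle) (\<lambda>k B. 4 * (exp 1)\<^sup>2 / (exp 1 - 1) *
     ((exp 1 + 0) * real_of_int \<lfloor>B\<rfloor> * real k) powr (1 / real_of_int \<lfloor>B\<rfloor>))"
proof -
  obtain p :: "nat poly" where p: "\<And>n m. t_prog n m \<le> poly p (n * m + n + m)"
    using polyb_t_prog unfolding polyb_def by blast
  show ?thesis
    unfolding submod_approx_algorithm_def Let_def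
  proof (intro exI[of _ p] allI impI, goal_cases)
    case (1 n m k f c s)
    then have pk: "packing_instance n m k c s"
      and f: "\<forall>A\<subseteq>{..<n}. 0 \<le> f A" "mono_on (Pow {..<n}) f" "submodular_on {..<n} f" by auto
    let ?t = "poly p (n * m + n + m)" and ?st = "input_state n m k (\<lambda>_. 0) c s"
    let ?D = "final_states f ?t (prog query_oracle) ?st"
    let ?B = "slack n m c s"
    let ?\<rho> = "4 * (exp 1)\<^sup>2 / (exp 1 - 1) * ((exp 1 + 0) * real_of_int \<lfloor>?B\<rfloor> * real k) powr (1 / real_of_int \<lfloor>?B\<rfloor>)"
    have *: "halts_within f ?t (prog query_oracle) ?st \<and> good n m k c s f ?D"
      by (rule pr_prog_input[OF pk f query_oracle_ok p])
    obtain T where T: "packing_feasible n m c s T" "submod_opt n m f c s = f T"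
      using submod_opt_attained[OF pk] by blast
    have fT: "0 \<le> f T" using f(1) T(1) by (auto simp: packing_feasible_def)
    have "1 \<le> rho k ?B"
      using slack_properties(1)[OF pk, of "\<lambda>i j. s i j / c j"] pk
      by (intro rho_ge_1) (auto simp: packing_instance_def)
    then have "f T / ?\<rho> \<le> f T / rho k ?B"
      using rho_le[of k ?B] fT by (intro frac_le) auto
    also have "... \<le> measure_pmf.expectation ?D (\<lambda>st. f (output_set n st))"
      using * T(1) by (auto simp: good_def)
    finally show ?case using * T(2) by (auto simp: good_def)
  qed
qed

theorem theorem7:
  shows "(\<exists>(prog :: com) (\<delta> :: nat \<Rightarrow> real).
            (\<forall>k. 0 \<le> \<delta> k) \<and> \<delta> \<longlonglongrightarrow> 0 \<and>
            pip_approx_algorithm prog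
              (\<lambda>k B. 4 * exp 1 *
                 ((exp 1 + \<delta> k) * real_of_int \<lfloor>B\<rfloor> * real k) powr (1 / real_of_int \<lfloor>B\<rfloor>)))
       \<and> (\<exists>(prog :: com) (\<delta> :: nat \<Rightarrow> real).
            (\<forall>k. 0 \<le> \<delta> k) \<and> \<delta> \<longlonglongrightarrow> 0 \<and>
            submod_approx_algorithm prog
              (\<lambda>k B. 4 * (exp 1)\<^sup>2 / (exp 1 - 1) *
                 ((exp 1 + \<delta> k) * real_of_int \<lfloor>B\<rfloor> * real k) powr (1 / real_of_int \<lfloor>B\<rfloor>)))"
  using pip_approx[unfolded rho_def[abs_def]] submod_approx
  by (intro conjI exI[of _ "prog sum_oracle"] exI[of _ "prog query_oracle"] exI[of _ "\<lambda>_. 0"]) auto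

end
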